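(* Let $k$ be a field and let $Z$ be a $k$-scheme of finite type equipped with a $\mathbb{G}_m$-action. Assume that $Z$ is affine. Then the canonical morphism $\widetilde{p}:\widetilde{Z}\to\mathbb{A}^1\times Z\times Z$ is a closed embedding. In particular, $\widetilde{Z}$ is an affine $k$-scheme of finite type.
   Context: $k$ is an arbitrary field. A $k$-space is a contravariant functor from $k$-schemes to sets which is a sheaf for the fpqc topology. Let $\mathbb{X}:=\mathbb{A}^2=\mathrm{Spec}\,k[\tau_1,\tau_2]$, viewed as a scheme over $\mathbb{A}^1$ via $(\tau_1,\tau_2)\mapsto\tau_1\tau_2$, with the $\mathbb{G}_m$-action $\lambda\cdot(\tau_1,\tau_2)=(\lambda\tau_1,\lambda^{-1}\tau_2)$. For a scheme $S$ over $\mathbb{A}^1$ set $\mathbb{X}_S:=\mathbb{X}\times_{\mathbb{A}^1}S$. $\widetilde{Z}$ is the space over $\mathbb{A}^1$ such that $\mathrm{Maps}_{\mathbb{A}^1}(S,\widetilde{Z})=\mathrm{Maps}^{\mathbb{G}_m}(\mathbb{X}_S,Z)$ (the set of $\mathbb{G}_m$-equivariant morphisms) for any scheme $S$ over $\mathbb{A}^1$. A section of $\mathbb{X}\to\mathbb{A}^1$ induces by pullback a morphism $\widetilde{Z}\to Z$. Let $\pi_1,\pi_2:\widetilde{Z}\to Z$ be the morphisms corresponding to the sections $t\mapsto(1,t)$ and $t\mapsto(t,1)$, respectively. The morphism $\widetilde{p}:\widetilde{Z}\to\mathbb{A}^1\times Z\times Z$ has as components the tautological projection $\widetilde{Z}\to\mathbb{A}^1$,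 $\pi_1$, and $\pi_2$. *)

theory Defs
  imports "HOL-Algebra.Module" "HOL-Algebra.Generated_Rings"
begin

text \<open>
  Schemes and spaces over a ring \<open>k\<close> are handled through their functors of points.
  The category of affine \<open>k\<close>-schemes is the opposite of the category of commutative
  \<open>k\<close>-algebras, so a contravariant functor on affine \<open>k\<close>-schemes is a covariant functor
  on \<open>k\<close>-algebras.  All \<open>k\<close>-algebras, and \<open>k\<close> itself, have their carriers inside one type
  \<open>'u\<close>, which plays the role of a universe; when \<open>'u\<close> is infinite, every finitely generated
  algebra over a member of the universe has an isomorphic copy in the universe.
  The sheaf condition is not part of \<open>kfunctor\<close>: \<open>Z\<close> is assumed to be representable, and
  \<open>Ztilde\<close> is claimed to be, so both satisfy it automatically.
\<close>

section \<open>Algebras over a ring\<close>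

type_synonym 'u alg = "('u, 'u) module"

definition kalgs :: "'u ring \<Rightarrow> 'u alg set" where
  "kalgs k = {R. algebra k R}"

text \<open>Homomorphisms are extensional, so that equality of functions is equality of morphisms.\<close>

definition khom :: "'u ring \<Rightarrow> 'u alg \<Rightarrow> 'u alg \<Rightarrow> ('u \<Rightarrow> 'u) set" where
  "khom k R T = {h \<in> ring_hom R T \<inter> extensional (carrier R).
     \<forall>c\<in>carrier k. \<forall>x\<in>carrier R. h (c \<odot>\<^bsub>R\<^esub> x) = c \<odot>\<^bsub>T\<^esub> h x}"

abbreviation kid :: "'u alg \<Rightarrow> 'u \<Rightarrow> 'u" where
  "kid R \<equiv> restrict id (carrier R)"

definition finitely_generated_algebra :: "'u ring \<Rightarrow> 'u alg \<Rightarrow> bool" where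
  "finitely_generated_algebra k A \<longleftrightarrow>
     (\<exists>G. finite G \<and> G \<subseteq> carrier A \<and>
        carrier A = generate_ring A ((\<lambda>c. c \<odot>\<^bsub>A\<^esub> \<one>\<^bsub>A\<^esub>) ` carrier k \<union> G))"

section \<open>Functors of points\<close>

record ('u, 'x) func =
  points :: "'u alg \<Rightarrow> 'x set"
  on_hom :: "'u alg \<Rightarrow> 'u alg \<Rightarrow> ('u \<Rightarrow> 'u) \<Rightarrow> 'x \<Rightarrow> 'x"

definition kfunctor :: "'u ring \<Rightarrow> ('u, 'x) func \<Rightarrow> bool" where
  "kfunctor k F \<longleftrightarrow>
     (\<forall>R\<in>kalgs k. \<forall>T\<in>kalgs k. \<forall>h\<in>khom k R T. on_hom F R T h \<in> points F R \<rightarrow> points F T) \<and>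
     (\<forall>R\<in>kalgs k. \<forall>x\<in>points F R. on_hom F R R (kid R) x = x) \<and>
     (\<forall>R\<in>kalgs k. \<forall>S\<in>kalgs k. \<forall>T\<in>kalgs k. \<forall>h\<in>khom k R S. \<forall>g\<in>khom k S T. \<forall>x\<in>points F R.
        on_hom F R T (compose (carrier R) g h) x = on_hom F S T g (on_hom F R S h x))"

text \<open>Morphisms of functors, again extensional in both arguments.\<close>

definition kmaps ::
  "'u ring \<Rightarrow> ('u, 'x) func \<Rightarrow> ('u, 'y) func \<Rightarrow> ('u alg \<Rightarrow> 'x \<Rightarrow> 'y) set" where
  "kmaps k F G = {f \<in> (\<Pi>\<^sub>E R\<in>kalgs k. points F R \<rightarrow>\<^sub>E points G R).
     \<forall>R\<in>kalgs k. \<forall>T\<in>kalgs k. \<forall>h\<in>khom k R T. \<forall>x\<in>points F R.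
       f T (on_hom F R T h x) = on_hom G R T h (f R x)}"

definition kiso :: "'u ring \<Rightarrow> ('u, 'x) func \<Rightarrow> ('u, 'y) func \<Rightarrow> ('u alg \<Rightarrow> 'x \<Rightarrow> 'y) \<Rightarrow> bool" where
  "kiso k F G f \<longleftrightarrow>
     f \<in> kmaps k F G \<and> (\<forall>R\<in>kalgs k. bij_betw (f R) (points F R) (points G R))"

definition Spec :: "'u ring \<Rightarrow> 'u alg \<Rightarrow> ('u, 'u \<Rightarrow> 'u) func" where
  "Spec k A = \<lparr> points = (\<lambda>R. khom k A R), on_hom = (\<lambda>R T h g. compose (carrier A) h g) \<rparr>"

definition affine_scheme_of_finite_type :: "'u ring \<Rightarrow> ('u, 'x) func \<Rightarrow> bool" where
  "affine_scheme_of_finite_type k F \<longleftrightarrow>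
     kfunctor k F \<and>
     (\<exists>A\<in>kalgs k. finitely_generated_algebra k A \<and> (\<exists>f. kiso k (Spec k A) F f))"

definition prod_func :: "('u, 'x) func \<Rightarrow> ('u, 'y) func \<Rightarrow> ('u, 'x \<times> 'y) func"
    (infixr \<open>\<times>\<^sub>k\<close> 80) where
  "F \<times>\<^sub>k G = \<lparr> points = (\<lambda>R. points F R \<times> points G R),
              on_hom = (\<lambda>R T h. map_prod (on_hom F R T h) (on_hom G R T h)) \<rparr>"

definition fibre_product ::
  "('u, 'x) func \<Rightarrow> ('u alg \<Rightarrow> 'x \<Rightarrow> 'z) \<Rightarrow> ('u, 'y) func \<Rightarrow> ('u alg \<Rightarrow> 'y \<Rightarrow> 'z) \<Rightarrow>
   ('u, 'x \<times> 'y) func" where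
  "fibre_product F f G g =
     \<lparr> points = (\<lambda>R. {(x, y) \<in> points F R \<times> points G R. f R x = g R y}),
       on_hom = (\<lambda>R T h. map_prod (on_hom F R T h) (on_hom G R T h)) \<rparr>"

text \<open>The morphism \<open>Spec R \<rightarrow> F\<close> given by an \<open>R\<close>-point of \<open>F\<close> (Yoneda).\<close>

definition point_map ::
  "'u ring \<Rightarrow> ('u, 'x) func \<Rightarrow> 'u alg \<Rightarrow> 'x \<Rightarrow> 'u alg \<Rightarrow> ('u \<Rightarrow> 'u) \<Rightarrow> 'x" where
  "point_map k F R x = (\<lambda>T\<in>kalgs k. \<lambda>h\<in>khom k R T. on_hom F R T h x)"

text \<open>
  A morphism \<open>f : F \<rightarrow> Y\<close> is a closed embedding if for every affine scheme \<open>Spec R\<close> over \<open>Y\<close>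
  the projection of the fibre product with \<open>F\<close> to \<open>Spec R\<close> is an isomorphism onto the closed
  subscheme \<open>Spec (R/I)\<close> for some ideal \<open>I\<close>.  The \<open>T\<close>-points of \<open>Spec (R/I)\<close> are the
  homomorphisms \<open>R \<rightarrow> T\<close> that vanish on \<open>I\<close>.
\<close>

definition closed_embedding ::
  "'u ring \<Rightarrow> ('u, 'x) func \<Rightarrow> ('u, 'y) func \<Rightarrow> ('u alg \<Rightarrow> 'x \<Rightarrow> 'y) \<Rightarrow> bool" where
  "closed_embedding k F Y f \<longleftrightarrow>
     kfunctor k F \<and> kfunctor k Y \<and> f \<in> kmaps k F Y \<and>
     (\<forall>R\<in>kalgs k. \<forall>y\<in>points Y R. \<exists>I. ideal I R \<and>
        (\<forall>T\<in>kalgs k.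
           bij_betw snd (points (fibre_product F f (Spec k R) (point_map k Y R y)) T)
             {h \<in> khom k R T. \<forall>a\<in>I. h a = \<zero>\<^bsub>T\<^esub>}))"

section \<open>Affine line and multiplicative group\<close>

definition A1 :: "('u, 'u) func" where
  "A1 = \<lparr> points = carrier, on_hom = (\<lambda>R T h. h) \<rparr>"

definition Gm :: "('u, 'u) func" where
  "Gm = \<lparr> points = Units, on_hom = (\<lambda>R T h. h) \<rparr>"

definition Gm_action ::
  "'u ring \<Rightarrow> ('u, 'z) func \<Rightarrow> ('u alg \<Rightarrow> 'u \<times> 'z \<Rightarrow> 'z) \<Rightarrow> bool" where
  "Gm_action k Z a \<longleftrightarrow> a \<in> kmaps k (Gm \<times>\<^sub>k Z) Z \<and>
     (\<forall>R\<in>kalgs k. \<forall>z\<in>points Z R.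
        a R (\<one>\<^bsub>R\<^esub>, z) = z \<and>
        (\<forall>l\<in>Units R. \<forall>m\<in>Units R. a R (l \<otimes>\<^bsub>R\<^esub> m, z) = a R (l, a R (m, z))))"

section \<open>The family \<open>XX\<close> of hyperbolas over the affine line\<close>

definition XX :: "('u, 'u \<times> 'u) func" where
  "XX = A1 \<times>\<^sub>k A1"

definition X_to_A1 :: "'u ring \<Rightarrow> 'u alg \<Rightarrow> 'u \<times> 'u \<Rightarrow> 'u" where
  "X_to_A1 k = (\<lambda>R\<in>kalgs k. \<lambda>(u, v)\<in>points XX R. u \<otimes>\<^bsub>R\<^esub> v)"

definition X_act :: "'u ring \<Rightarrow> 'u alg \<Rightarrow> 'u \<times> ('u \<times> 'u) \<Rightarrow> 'u \<times> 'u" where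
  "X_act k = (\<lambda>R\<in>kalgs k. \<lambda>(l, (u, v))\<in>points (Gm \<times>\<^sub>k XX) R.
     (l \<otimes>\<^bsub>R\<^esub> u, inv\<^bsub>R\<^esub> l \<otimes>\<^bsub>R\<^esub> v))"

text \<open>\<open>XS\<close> is the base change of \<open>XX\<close> along \<open>p : S \<rightarrow> A1\<close>, with \<open>Gm\<close> acting on the factor \<open>XX\<close> only.\<close>

definition XS :: "'u ring \<Rightarrow> ('u, 's) func \<Rightarrow> ('u alg \<Rightarrow> 's \<Rightarrow> 'u) \<Rightarrow> ('u, ('u \<times> 'u) \<times> 's) func" where
  "XS k S p = fibre_product XX (X_to_A1 k) S p"

definition XS_act ::
  "'u ring \<Rightarrow> ('u, 's) func \<Rightarrow> ('u alg \<Rightarrow> 's \<Rightarrow> 'u) \<Rightarrow>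
   'u alg \<Rightarrow> 'u \<times> (('u \<times> 'u) \<times> 's) \<Rightarrow> ('u \<times> 'u) \<times> 's" where
  "XS_act k S p = (\<lambda>R\<in>kalgs k. \<lambda>(l, (x, s))\<in>points (Gm \<times>\<^sub>k XS k S p) R. (X_act k R (l, x), s))"

definition equivariant_maps ::
  "'u ring \<Rightarrow> ('u, 'x) func \<Rightarrow> ('u alg \<Rightarrow> 'u \<times> 'x \<Rightarrow> 'x) \<Rightarrow>
   ('u, 'z) func \<Rightarrow> ('u alg \<Rightarrow> 'u \<times> 'z \<Rightarrow> 'z) \<Rightarrow> ('u alg \<Rightarrow> 'x \<Rightarrow> 'z) set" where
  "equivariant_maps k F b Z a = {f \<in> kmaps k F Z.
     \<forall>R\<in>kalgs k. \<forall>l\<in>Units R. \<forall>x\<in>points F R. f R (b R (l, x)) = a R (l, f R x)}"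

definition Maps_Gm ::
  "'u ring \<Rightarrow> ('u, 's) func \<Rightarrow> ('u alg \<Rightarrow> 's \<Rightarrow> 'u) \<Rightarrow>
   ('u, 'z) func \<Rightarrow> ('u alg \<Rightarrow> 'u \<times> 'z \<Rightarrow> 'z) \<Rightarrow> ('u alg \<Rightarrow> ('u \<times> 'u) \<times> 's \<Rightarrow> 'z) set" where
  "Maps_Gm k S p Z a = equivariant_maps k (XS k S p) (XS_act k S p) Z a"

section \<open>The space \<open>Ztilde\<close>\<close>

text \<open>
  An \<open>R\<close>-point is a pair of \<open>t : Spec R \<rightarrow> A1\<close> and an equivariant morphism \<open>XS \<rightarrow> Z\<close>, where
  \<open>S\<close> is \<open>Spec R\<close> viewed over \<open>A1\<close> through \<open>t\<close>.  This prescribes the morphisms over \<open>A1\<close> to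
  \<open>Ztilde\<close> from affine \<open>S\<close>; lemma \<open>Maps_Ztilde\<close> below shows that the same description
  then holds for every functor \<open>S\<close> over \<open>A1\<close>, hence for every scheme.
\<close>

abbreviation Spec_over_A1 :: "'u ring \<Rightarrow> 'u alg \<Rightarrow> 'u \<Rightarrow> 'u alg \<Rightarrow> ('u \<Rightarrow> 'u) \<Rightarrow> 'u" where
  "Spec_over_A1 k R t \<equiv> point_map k A1 R t"

definition Ztilde ::
  "'u ring \<Rightarrow> ('u, 'z) func \<Rightarrow> ('u alg \<Rightarrow> 'u \<times> 'z \<Rightarrow> 'z) \<Rightarrow>
   ('u, 'u \<times> ('u alg \<Rightarrow> ('u \<times> 'u) \<times> ('u \<Rightarrow> 'u) \<Rightarrow> 'z)) func" where
  "Ztilde k Z a =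
     \<lparr> points = (\<lambda>R. {(t, f). t \<in> points A1 R \<and> f \<in> Maps_Gm k (Spec k R) (Spec_over_A1 k R t) Z a}),
       on_hom = (\<lambda>R R' h (t, f). (h t,
         \<lambda>T\<in>kalgs k. \<lambda>(x, g)\<in>points (XS k (Spec k R') (Spec_over_A1 k R' (h t))) T.
           f T (x, compose (carrier R) g h))) \<rparr>"

text \<open>
  A section \<open>\<sigma>\<close> of \<open>XX \<rightarrow> A1\<close> gives \<open>S \<rightarrow> XS\<close>; composing with \<open>XS \<rightarrow> Z\<close> gives a morphism
  \<open>S \<rightarrow> Z\<close>.  For \<open>S = Spec R\<close> the latter is the \<open>R\<close>-point of \<open>Z\<close> obtained by evaluation at
  the identity of \<open>R\<close>.
\<close>

definition pi_section ::
  "'u ring \<Rightarrow> ('u, 'z) func \<Rightarrow> ('u alg \<Rightarrow> 'u \<times> 'z \<Rightarrow> 'z) \<Rightarrow> ('u alg \<Rightarrow> 'u \<Rightarrow> 'u \<times> 'u) \<Rightarrow>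
   'u alg \<Rightarrow> 'u \<times> ('u alg \<Rightarrow> ('u \<times> 'u) \<times> ('u \<Rightarrow> 'u) \<Rightarrow> 'z) \<Rightarrow> 'z" where
  "pi_section k Z a \<sigma> =
     (\<lambda>R\<in>kalgs k. \<lambda>(t, f)\<in>points (Ztilde k Z a) R. f R (\<sigma> R t, kid R))"

definition sec1 :: "'u ring \<Rightarrow> 'u alg \<Rightarrow> 'u \<Rightarrow> 'u \<times> 'u" where
  "sec1 k = (\<lambda>R\<in>kalgs k. \<lambda>t\<in>carrier R. (\<one>\<^bsub>R\<^esub>, t))"

definition sec2 :: "'u ring \<Rightarrow> 'u alg \<Rightarrow> 'u \<Rightarrow> 'u \<times> 'u" where
  "sec2 k = (\<lambda>R\<in>kalgs k. \<lambda>t\<in>carrier R. (t, \<one>\<^bsub>R\<^esub>))"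

definition ptilde ::
  "'u ring \<Rightarrow> ('u, 'z) func \<Rightarrow> ('u alg \<Rightarrow> 'u \<times> 'z \<Rightarrow> 'z) \<Rightarrow>
   'u alg \<Rightarrow> 'u \<times> ('u alg \<Rightarrow> ('u \<times> 'u) \<times> ('u \<Rightarrow> 'u) \<Rightarrow> 'z) \<Rightarrow> 'u \<times> 'z \<times> 'z" where
  "ptilde k Z a = (\<lambda>R\<in>kalgs k. \<lambda>q\<in>points (Ztilde k Z a) R.
     (fst q, pi_section k Z a (sec1 k) R q, pi_section k Z a (sec2 k) R q))"

section \<open>Morphisms from a functor over the affine line to \<open>Ztilde\<close>\<close>

lemma khom_kid: "R \<in> kalgs k \<Longrightarrow> kid R \<in> khom k R R"
  unfolding kalgs_def khom_def
  by (auto intro!: ring_hom_memI simp: algebra_def module_def cring_def ring_def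
      abelian_group_def abelian_monoid.a_closed module_axioms_def
      monoid.m_closed monoid.one_closed)

lemma khom_compose:
  assumes "h \<in> khom k R S" "g \<in> khom k S T" "R \<in> kalgs k"
  shows "compose (carrier R) g h \<in> khom k R T"
proof -
  interpret algebra k R using assms(3) by (simp add: kalgs_def)
  show ?thesis
    using assms(1,2) unfolding khom_def ring_hom_def
    by (auto simp: compose_def Pi_iff)
qed

lemma compose_kid_left: "h \<in> khom k R T \<Longrightarrow> compose (carrier R) (kid T) h = h"
  unfolding khom_def ring_hom_def by (auto simp: compose_def Pi_iff extensional_def)

lemma compose_kid_right: "h \<in> khom k R T \<Longrightarrow> compose (carrier R) h (kid R) = h"
  unfolding khom_def ring_hom_def by (auto simp: compose_def Pi_iff extensional_def)

lemma points_XS: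
  assumes "R \<in> kalgs k"
  shows "((u, v), s) \<in> points (XS k S p) R \<longleftrightarrow>
    u \<in> carrier R \<and> v \<in> carrier R \<and> s \<in> points S R \<and> u \<otimes>\<^bsub>R\<^esub> v = p R s"
  using assms by (auto simp: XS_def fibre_product_def XX_def A1_def prod_func_def X_to_A1_def)

lemma X_act_closed:
  assumes "R \<in> kalgs k" "l \<in> Units R" "((u, v), s) \<in> points (XS k S p) R"
  shows "X_act k R (l, (u, v)) = (l \<otimes>\<^bsub>R\<^esub> u, inv\<^bsub>R\<^esub> l \<otimes>\<^bsub>R\<^esub> v)"
    and "XS_act k S p R (l, ((u, v), s)) = ((l \<otimes>\<^bsub>R\<^esub> u, inv\<^bsub>R\<^esub> l \<otimes>\<^bsub>R\<^esub> v), s)"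
    and "((l \<otimes>\<^bsub>R\<^esub> u, inv\<^bsub>R\<^esub> l \<otimes>\<^bsub>R\<^esub> v), s) \<in> points (XS k S p) R"
proof -
  interpret A: cring R using assms(1) by (simp add: kalgs_def algebra_def)
  have uv: "u \<in> carrier R" "v \<in> carrier R" "s \<in> points S R" "u \<otimes>\<^bsub>R\<^esub> v = p R s"
    using assms(3) by (simp_all add: points_XS[OF assms(1)])
  have l: "l \<in> carrier R" "inv\<^bsub>R\<^esub> l \<in> carrier R" using assms(2) by auto
  have "(l \<otimes>\<^bsub>R\<^esub> u) \<otimes>\<^bsub>R\<^esub> (inv\<^bsub>R\<^esub> l \<otimes>\<^bsub>R\<^esub> v) = (l \<otimes>\<^bsub>R\<^esub> inv\<^bsub>R\<^esub> l) \<otimes>\<^bsub>R\<^esub> (u \<otimes>\<^bsub>R\<^esub> v)"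
    using l uv(1,2) by (simp add: A.m_ac)
  then have "(l \<otimes>\<^bsub>R\<^esub> u) \<otimes>\<^bsub>R\<^esub> (inv\<^bsub>R\<^esub> l \<otimes>\<^bsub>R\<^esub> v) = u \<otimes>\<^bsub>R\<^esub> v"
    using uv assms(2) by (metis A.Units_r_inv A.l_one A.m_closed)
  then show "((l \<otimes>\<^bsub>R\<^esub> u, inv\<^bsub>R\<^esub> l \<otimes>\<^bsub>R\<^esub> v), s) \<in> points (XS k S p) R"
    using l uv by (simp add: points_XS[OF assms(1)])
  show X: "X_act k R (l, (u, v)) = (l \<otimes>\<^bsub>R\<^esub> u, inv\<^bsub>R\<^esub> l \<otimes>\<^bsub>R\<^esub> v)"
    using assms(1,2) uv by (simp add: X_act_def prod_func_def Gm_def XX_def A1_def)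
  show "XS_act k S p R (l, ((u, v), s)) = ((l \<otimes>\<^bsub>R\<^esub> u, inv\<^bsub>R\<^esub> l \<otimes>\<^bsub>R\<^esub> v), s)"
    using assms X by (simp add: XS_act_def prod_func_def Gm_def)
qed

lemma Maps_Gm_iff:
  "f \<in> Maps_Gm k S p Z a \<longleftrightarrow>
     f \<in> (\<Pi>\<^sub>E R\<in>kalgs k. points (XS k S p) R \<rightarrow>\<^sub>E points Z R) \<and>
     (\<forall>R\<in>kalgs k. \<forall>T\<in>kalgs k. \<forall>h\<in>khom k R T. \<forall>u v s. ((u, v), s) \<in> points (XS k S p) R \<longrightarrow>
        f T ((h u, h v), on_hom S R T h s) = on_hom Z R T h (f R ((u, v), s))) \<and>
     (\<forall>R\<in>kalgs k. \<forall>l\<in>Units R. \<forall>u v s. ((u, v), s) \<in> points (XS k S p) R \<longrightarrow>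
        f R ((l \<otimes>\<^bsub>R\<^esub> u, inv\<^bsub>R\<^esub> l \<otimes>\<^bsub>R\<^esub> v), s) = a R (l, f R ((u, v), s)))"
proof -
  have 1: "on_hom (XS k S p) R T h ((u, v), s) = ((h u, h v), on_hom S R T h s)" for R T h u v s
    by (simp add: XS_def fibre_product_def XX_def A1_def prod_func_def)
  show ?thesis
    unfolding Maps_Gm_def equivariant_maps_def kmaps_def
    by (auto simp: 1 X_act_closed Ball_def)
qed

lemma PiE2_ext:
  assumes "\<And>i j. i \<in> I \<Longrightarrow> j \<in> J i \<Longrightarrow> f i j = g i j"
    and "g \<in> (\<Pi>\<^sub>E i\<in>I. J i \<rightarrow>\<^sub>E K i)" "f \<in> (\<Pi>\<^sub>E i\<in>I. J i \<rightarrow>\<^sub>E K i)"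
  shows "f = g"
proof (rule PiE_ext[OF assms(3,2)])
  fix i assume i: "i \<in> I"
  show "f i = g i"
    by (rule PiE_ext[OF PiE_mem[OF assms(3) i] PiE_mem[OF assms(2) i]]) (use assms(1) i in blast)
qed

lemma Maps_Gm_PiE:
  "f \<in> Maps_Gm k S p Z a \<Longrightarrow> f \<in> (\<Pi>\<^sub>E R\<in>kalgs k. points (XS k S p) R \<rightarrow>\<^sub>E points Z R)"
  unfolding Maps_Gm_iff by blast

lemma Maps_Gm_closed:
  assumes "f \<in> Maps_Gm k S p Z a" "R \<in> kalgs k" "x \<in> points (XS k S p) R"
  shows "f R x \<in> points Z R"
  using PiE_mem[OF PiE_mem[OF Maps_Gm_PiE[OF assms(1)] assms(2)] assms(3)] .

lemma Maps_Gm_natural: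
  assumes "f \<in> Maps_Gm k S p Z a" "R \<in> kalgs k" "T \<in> kalgs k" "h \<in> khom k R T"
    and "((u, v), s) \<in> points (XS k S p) R"
  shows "f T ((h u, h v), on_hom S R T h s) = on_hom Z R T h (f R ((u, v), s))"
  using assms unfolding Maps_Gm_iff by blast

lemma Maps_Gm_equivariant:
  assumes "f \<in> Maps_Gm k S p Z a" "R \<in> kalgs k" "l \<in> Units R" "((u, v), s) \<in> points (XS k S p) R"
  shows "f R ((l \<otimes>\<^bsub>R\<^esub> u, inv\<^bsub>R\<^esub> l \<otimes>\<^bsub>R\<^esub> v), s) = a R (l, f R ((u, v), s))"
  using assms unfolding Maps_Gm_iff by blast

lemma points_XS_Spec:
  assumes "R \<in> kalgs k" "T \<in> kalgs k"
  shows "((u, v), g) \<in> points (XS k (Spec k R) (Spec_over_A1 k R t)) T \<longleftrightarrow>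
    u \<in> carrier T \<and> v \<in> carrier T \<and> g \<in> khom k R T \<and> u \<otimes>\<^bsub>T\<^esub> v = g t"
  using assms by (auto simp: points_XS Spec_def point_map_def A1_def)

text \<open>
  For every functor \<open>S\<close> over \<open>A1\<close> the morphisms \<open>S \<rightarrow> Ztilde\<close> over \<open>A1\<close> correspond to the
  equivariant morphisms \<open>XS \<rightarrow> Z\<close>.
\<close>

lemma Maps_Ztilde:
  fixes S :: "('u, 's) func" and Z :: "('u, 'z) func"
  assumes S: "kfunctor k S" and p: "p \<in> kmaps k S A1"
  shows "bij_betw
    (\<lambda>F. \<lambda>R\<in>kalgs k. \<lambda>(x, s)\<in>points (XS k S p) R. snd (F R s) R (x, kid R))
    {F \<in> kmaps k S (Ztilde k Z a). \<forall>R\<in>kalgs k. \<forall>s\<in>points S R. fst (F R s) = p R s}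
    (Maps_Gm k S p Z a)"
proof -
  let ?M = "{F \<in> kmaps k S (Ztilde k Z a). \<forall>R\<in>kalgs k. \<forall>s\<in>points S R. fst (F R s) = p R s}"
  define th where "th = (\<lambda>F :: 'u alg \<Rightarrow> 's \<Rightarrow> 'u \<times> ('u alg \<Rightarrow> ('u \<times> 'u) \<times> ('u \<Rightarrow> 'u) \<Rightarrow> 'z).
    \<lambda>R\<in>kalgs k. \<lambda>(x, s)\<in>points (XS k S p) R. snd (F R s) R (x, kid R))"
  let ?P = "\<lambda>R t T. points (XS k (Spec k R) (Spec_over_A1 k R t)) T"
  define ps where "ps = (\<lambda>f :: 'u alg \<Rightarrow> ('u \<times> 'u) \<times> 's \<Rightarrow> 'z. \<lambda>R\<in>kalgs k. \<lambda>s\<in>points S R.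
    (p R s, \<lambda>T\<in>kalgs k. \<lambda>(x, g)\<in>?P R (p R s) T. f T (x, on_hom S R T g s)))"
  have S1: "on_hom S R T h s \<in> points S T"
    if "R \<in> kalgs k" "T \<in> kalgs k" "h \<in> khom k R T" "s \<in> points S R" for R T h s
    using S that unfolding kfunctor_def by blast
  have S2: "on_hom S R R (kid R) s = s" if "R \<in> kalgs k" "s \<in> points S R" for R s
    using S that unfolding kfunctor_def by blast
  have S3: "on_hom S Q T (compose (carrier Q) g h) s = on_hom S R T g (on_hom S Q R h s)"
    if "Q \<in> kalgs k" "R \<in> kalgs k" "T \<in> kalgs k" "h \<in> khom k Q R" "g \<in> khom k R T" "s \<in> points S Q"
    for Q R T g h s
    using S that unfolding kfunctor_def by blast
  have p1: "p R s \<in> carrier R" if "R \<in> kalgs k" "s \<in> points S R" for R s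
    using p that unfolding kmaps_def by (auto simp: A1_def dest!: PiE_mem)
  have p2: "p T (on_hom S R T h s) = h (p R s)"
    if "R \<in> kalgs k" "T \<in> kalgs k" "h \<in> khom k R T" "s \<in> points S R" for R T h s
    using p that unfolding kmaps_def by (auto simp: A1_def)
  have hc: "h u \<in> carrier T" "h (u \<otimes>\<^bsub>R\<^esub> v) = h u \<otimes>\<^bsub>T\<^esub> h v"
    if "h \<in> khom k R T" "u \<in> carrier R" "v \<in> carrier R" for h R T u v
    using that by (auto simp: khom_def ring_hom_def)
  have cc: "compose (carrier R) g h x = g (h x)" if "x \<in> carrier R"
    for R :: "'u alg" and g h :: "'u \<Rightarrow> 'u" and x
    using that by (simp add: compose_def)
  have F1: "fst (F R s) = p R s" "snd (F R s) \<in> Maps_Gm k (Spec k R) (Spec_over_A1 k R (p R s)) Z a"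
    if F: "F \<in> ?M" and R: "R \<in> kalgs k" "s \<in> points S R" for F R s
  proof -
    show 1: "fst (F R s) = p R s" using F R by auto
    have "F R s \<in> points (Ztilde k Z a) R"
      using F R unfolding kmaps_def by (auto dest!: PiE_mem)
    then show "snd (F R s) \<in> Maps_Gm k (Spec k R) (Spec_over_A1 k R (p R s)) Z a"
      using 1 by (auto simp: Ztilde_def split: prod.splits)
  qed
  have F2: "snd (F R' (on_hom S R R' h s)) T ((u, v), g) =
      snd (F R s) T ((u, v), compose (carrier R) g h)"
    if F: "F \<in> ?M" and R: "R \<in> kalgs k" "R' \<in> kalgs k" "T \<in> kalgs k" "h \<in> khom k R R'" "s \<in> points S R"
      and x: "((u, v), g) \<in> ?P R' (h (p R s)) T" for F R R' T h s u v g
  proof -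
    have "F R' (on_hom S R R' h s) = on_hom (Ztilde k Z a) R R' h (F R s)"
      using F R unfolding kmaps_def by auto
    moreover have "F R s = (p R s, snd (F R s))" using F1(1)[OF F R(1,5)] by (simp add: prod_eq_iff)
    ultimately have "F R' (on_hom S R R' h s) = on_hom (Ztilde k Z a) R R' h (p R s, snd (F R s))"
      by simp
    then show ?thesis using R x by (simp add: Ztilde_def)
  qed
  have th_in: "th F \<in> Maps_Gm k S p Z a" if F: "F \<in> ?M" for F
  proof -
    have xk: "((u, v), kid R) \<in> ?P R (p R s) R"
      if "R \<in> kalgs k" "((u, v), s) \<in> points (XS k S p) R" for R u v s
      using that p1[of R s] by (auto simp: points_XS Spec_def point_map_def A1_def khom_kid)
    have th: "th F R ((u, v), s) = snd (F R s) R ((u, v), kid R)"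
      if "R \<in> kalgs k" "((u, v), s) \<in> points (XS k S p) R" for R u v s
      using that by (simp add: th_def)
    have 1: "th F \<in> (\<Pi>\<^sub>E R\<in>kalgs k. points (XS k S p) R \<rightarrow>\<^sub>E points Z R)"
    proof (intro PiE_I)
      fix R and x :: "('u \<times> 'u) \<times> 's" assume R: "R \<in> kalgs k" and x: "x \<in> points (XS k S p) R"
      obtain u v s where xe: "x = ((u, v), s)" by (metis surj_pair)
      have "s \<in> points S R" using x R by (simp add: xe points_XS)
      from Maps_Gm_closed[OF F1(2)[OF F R this] R xk[OF R x[unfolded xe]]]
      have "snd (F R s) R ((u, v), kid R) \<in> points Z R" .
      then show "th F R x \<in> points Z R" using th[OF R x[unfolded xe]] by (simp add: xe)
    qed (auto simp: th_def)
    have 2: "th F T ((h u, h v), on_hom S R T h s) = on_hom Z R T h (th F R ((u, v), s))"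
      if R: "R \<in> kalgs k" "T \<in> kalgs k" "h \<in> khom k R T" and x: "((u, v), s) \<in> points (XS k S p) R"
      for R T h u v s
    proof -
      have uv: "u \<in> carrier R" "v \<in> carrier R" "s \<in> points S R" "u \<otimes>\<^bsub>R\<^esub> v = p R s"
        using x R by (simp_all add: points_XS)
      have y: "((h u, h v), on_hom S R T h s) \<in> points (XS k S p) T"
        using uv R hc[OF R(3) uv(1,2)] hc(1)[OF R(3) uv(2,2)] S1 p2 by (simp add: points_XS)
      have "th F T ((h u, h v), on_hom S R T h s) = snd (F T (on_hom S R T h s)) T ((h u, h v), kid T)"
        using th[OF R(2) y] .
      also have "\<dots> = snd (F R s) T ((h u, h v), compose (carrier R) (kid T) h)"
        using F2[OF F R(1,2,2,3) uv(3)] xk[OF R(2) y] p2[OF R uv(3)] by simp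
      also have "\<dots> = snd (F R s) T ((h u, h v), compose (carrier R) h (kid R))"
        using R(3) by (simp add: compose_kid_left compose_kid_right)
      also have "\<dots> = on_hom Z R T h (snd (F R s) R ((u, v), kid R))"
      proof -
        have "on_hom (Spec k R) R T h (kid R) = compose (carrier R) h (kid R)"
          by (simp add: Spec_def)
        then show ?thesis
          using Maps_Gm_natural[OF F1(2)[OF F R(1) uv(3)] R(1,2,3) xk[OF R(1) x]] by simp
      qed
      finally show ?thesis using th[OF R(1) x] by simp
    qed
    have 3: "th F R ((l \<otimes>\<^bsub>R\<^esub> u, inv\<^bsub>R\<^esub> l \<otimes>\<^bsub>R\<^esub> v), s) = a R (l, th F R ((u, v), s))"
      if R: "R \<in> kalgs k" "l \<in> Units R" and x: "((u, v), s) \<in> points (XS k S p) R" for R l u v s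
    proof -
      have s: "s \<in> points S R" using x R by (simp add: points_XS)
      show ?thesis
        using Maps_Gm_equivariant[OF F1(2)[OF F R(1) s] R xk[OF R(1) x]] th[OF R(1) x]
          th[OF R(1) X_act_closed(3)[OF R x]]
        by simp
    qed
    show ?thesis unfolding Maps_Gm_iff using 1 2 3 by blast
  qed
  have on: "((u, v), on_hom S R T g s) \<in> points (XS k S p) T"
    if "R \<in> kalgs k" "T \<in> kalgs k" "s \<in> points S R" "((u, v), g) \<in> ?P R (p R s) T" for R T s u v g
    using that S1 p2 by (auto simp: points_XS Spec_def point_map_def A1_def)
  have ps_snd: "snd (ps f R s) T ((u, v), g) = f T ((u, v), on_hom S R T g s)"
    if "R \<in> kalgs k" "T \<in> kalgs k" "s \<in> points S R" "((u, v), g) \<in> ?P R (p R s) T" for f R T s u v g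
    using that by (simp add: ps_def)
  have ps_maps: "snd (ps f R s) \<in> Maps_Gm k (Spec k R) (Spec_over_A1 k R (p R s)) Z a"
    if f: "f \<in> Maps_Gm k S p Z a" and R: "R \<in> kalgs k" and s: "s \<in> points S R" for f R s
  proof -
    have 1: "snd (ps f R s) \<in> (\<Pi>\<^sub>E T\<in>kalgs k. ?P R (p R s) T \<rightarrow>\<^sub>E points Z T)"
    proof (intro PiE_I)
      fix T and x :: "('u \<times> 'u) \<times> ('u \<Rightarrow> 'u)" assume T: "T \<in> kalgs k" and x: "x \<in> ?P R (p R s) T"
      obtain u v g where xe: "x = ((u, v), g)" by (metis surj_pair)
      have "f T ((u, v), on_hom S R T g s) \<in> points Z T"
        using Maps_Gm_closed[OF f T on[OF R T s x[unfolded xe]]] .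
      then show "snd (ps f R s) T x \<in> points Z T" using ps_snd[OF R T s x[unfolded xe]] xe by simp
    qed (use R s in \<open>auto simp: ps_def\<close>)
    have 2: "snd (ps f R s) T' ((h u, h v), on_hom (Spec k R) T T' h g) =
        on_hom Z T T' h (snd (ps f R s) T ((u, v), g))"
      if T: "T \<in> kalgs k" "T' \<in> kalgs k" "h \<in> khom k T T'" and x: "((u, v), g) \<in> ?P R (p R s) T"
      for T T' h u v g
    proof -
      have uv: "u \<in> carrier T" "v \<in> carrier T" "g \<in> khom k R T" "u \<otimes>\<^bsub>T\<^esub> v = g (p R s)"
        using x R T by (simp_all add: points_XS_Spec)
      have "((h u, h v), compose (carrier R) h g) \<in> ?P R (p R s) T'"
        using uv T R khom_compose[OF uv(3) T(3) R] hc[OF T(3) uv(1,2)] hc(1)[OF T(3) uv(2,2)]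
          cc[OF p1[OF R s]]
        by (simp add: points_XS_Spec)
      from ps_snd[OF R T(2) s this]
      have "snd (ps f R s) T' ((h u, h v), compose (carrier R) h g) =
          f T' ((h u, h v), on_hom S T T' h (on_hom S R T g s))"
        using S3[OF R T(1,2) uv(3) T(3) s] by simp
      also have "\<dots> = on_hom Z T T' h (f T ((u, v), on_hom S R T g s))"
        using Maps_Gm_natural[OF f T on[OF R T(1) s x]] .
      finally show ?thesis using ps_snd[OF R T(1) s x] by (simp add: Spec_def)
    qed
    have 3: "snd (ps f R s) T ((l \<otimes>\<^bsub>T\<^esub> u, inv\<^bsub>T\<^esub> l \<otimes>\<^bsub>T\<^esub> v), g) = a T (l, snd (ps f R s) T ((u, v), g))"
      if T: "T \<in> kalgs k" "l \<in> Units T" and x: "((u, v), g) \<in> ?P R (p R s) T" for T l u v g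
      using Maps_Gm_equivariant[OF f T on[OF R T(1) s x]] ps_snd[OF R T(1) s x]
        ps_snd[OF R T(1) s X_act_closed(3)[OF T x]]
      by simp
    show ?thesis unfolding Maps_Gm_iff using 1 2 3 by blast
  qed
  have ps_in: "ps f \<in> ?M" if f: "f \<in> Maps_Gm k S p Z a" for f
  proof -
    have fs: "fst (ps f R s) = p R s" if "R \<in> kalgs k" "s \<in> points S R" for R s
      using that by (simp add: ps_def)
    have 1: "ps f \<in> (\<Pi>\<^sub>E R\<in>kalgs k. points S R \<rightarrow>\<^sub>E points (Ztilde k Z a) R)"
    proof (intro PiE_I)
      fix R s assume R: "R \<in> kalgs k" and s: "s \<in> points S R"
      have "(fst (ps f R s), snd (ps f R s)) \<in> points (Ztilde k Z a) R"
        using fs[OF R s] p1[OF R s] ps_maps[OF f R s] by (simp add: Ztilde_def A1_def)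
      then show "ps f R s \<in> points (Ztilde k Z a) R" by simp
    qed (auto simp: ps_def)
    have 2: "ps f R' (on_hom S R R' h s) = on_hom (Ztilde k Z a) R R' h (ps f R s)"
      if R: "R \<in> kalgs k" "R' \<in> kalgs k" "h \<in> khom k R R'" and s: "s \<in> points S R" for R R' h s
    proof -
      note s' = S1[OF R s]
      have eq: "f T (x, on_hom S R' T g (on_hom S R R' h s)) =
          snd (ps f R s) T (x, compose (carrier R) g h)"
        if T: "T \<in> kalgs k" and x: "(x, g) \<in> ?P R' (h (p R s)) T" for T x g
      proof -
        obtain u v where xe: "x = (u, v)" by fastforce
        have uv: "u \<in> carrier T" "v \<in> carrier T" "g \<in> khom k R' T" "u \<otimes>\<^bsub>T\<^esub> v = g (h (p R s))"
          using x R T by (simp_all add: points_XS_Spec xe)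
        have "((u, v), compose (carrier R) g h) \<in> ?P R (p R s) T"
          using uv T R khom_compose[OF R(3) uv(3) R(1)] cc[OF p1[OF R(1) s]]
          by (simp add: points_XS_Spec)
        from ps_snd[OF R(1) T s this] show ?thesis
          using S3[OF R(1,2) T R(3) uv(3) s] xe by simp
      qed
      have "on_hom (Ztilde k Z a) R R' h (ps f R s) =
          on_hom (Ztilde k Z a) R R' h (p R s, snd (ps f R s))"
        using fs[OF R(1) s] by (metis prod.collapse)
      also have "\<dots> = (h (p R s), \<lambda>T\<in>kalgs k. \<lambda>(x, g)\<in>?P R' (h (p R s)) T.
           snd (ps f R s) T (x, compose (carrier R) g h))"
        by (simp add: Ztilde_def)
      also have "\<dots> = (h (p R s), \<lambda>T\<in>kalgs k. \<lambda>(x, g)\<in>?P R' (h (p R s)) T.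
           f T (x, on_hom S R' T g (on_hom S R R' h s)))"
        using eq by (auto intro!: restrict_ext)
      also have "\<dots> = ps f R' (on_hom S R R' h s)"
        using R s' p2[OF R s] by (simp add: ps_def)
      finally show ?thesis by simp
    qed
    show ?thesis using 1 2 fs by (auto simp: kmaps_def)
  qed
  have ps_th: "ps (th F) = F" if F: "F \<in> ?M" for F
  proof -
    have Fe: "F \<in> (\<Pi>\<^sub>E R\<in>kalgs k. points S R \<rightarrow>\<^sub>E points (Ztilde k Z a) R)"
      using F by (simp add: kmaps_def)
    have "ps (th F) R s = F R s" if R: "R \<in> kalgs k" and s: "s \<in> points S R" for R s
    proof (rule prod_eqI)
      show "fst (ps (th F) R s) = fst (F R s)"
        using R s F1(1)[OF F R s] by (simp add: ps_def)
      have "snd (ps (th F) R s) T x = snd (F R s) T x"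
        if T: "T \<in> kalgs k" and x: "x \<in> ?P R (p R s) T" for T x
      proof -
        obtain u v g where xe: "x = ((u, v), g)" by (metis surj_pair)
        have uv: "u \<in> carrier T" "v \<in> carrier T" "g \<in> khom k R T" "u \<otimes>\<^bsub>T\<^esub> v = g (p R s)"
          using x R T by (simp_all add: points_XS_Spec xe)
        note x' = x[unfolded xe]
        have "((u, v), kid T) \<in> ?P T (g (p R s)) T"
          using uv T hc(1)[OF uv(3) p1[OF R s] p1[OF R s]] by (simp add: points_XS_Spec khom_kid)
        from F2[OF F R T T uv(3) s this]
        have "snd (F T (on_hom S R T g s)) T ((u, v), kid T) = snd (F R s) T ((u, v), g)"
          unfolding compose_kid_left[OF uv(3)] .
        moreover have "th F T ((u, v), on_hom S R T g s) =
            snd (F T (on_hom S R T g s)) T ((u, v), kid T)"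
          using T on[OF R T s x'] by (simp add: th_def)
        ultimately show ?thesis using ps_snd[OF R T s x'] xe by simp
      qed
      moreover have "snd (F R s) \<in> (\<Pi>\<^sub>E T\<in>kalgs k. ?P R (p R s) T \<rightarrow>\<^sub>E points Z T)"
        "snd (ps (th F) R s) \<in> (\<Pi>\<^sub>E T\<in>kalgs k. ?P R (p R s) T \<rightarrow>\<^sub>E points Z T)"
        using Maps_Gm_PiE[OF F1(2)[OF F R s]] Maps_Gm_PiE[OF ps_maps[OF th_in[OF F] R s]] .
      ultimately show "snd (ps (th F) R s) = snd (F R s)"
        by (rule PiE2_ext)
    qed
    moreover note Fe
    moreover have "ps (th F) \<in> (\<Pi>\<^sub>E R\<in>kalgs k. points S R \<rightarrow>\<^sub>E points (Ztilde k Z a) R)"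
      using ps_in[OF th_in[OF F]] by (simp add: kmaps_def)
    ultimately show ?thesis
      by (rule PiE2_ext)
  qed
  have th_ps: "th (ps f) = f" if f: "f \<in> Maps_Gm k S p Z a" for f
  proof -
    have "th (ps f) R x = f R x" if R: "R \<in> kalgs k" and x: "x \<in> points (XS k S p) R" for R x
    proof -
      obtain u v s where xe: "x = ((u, v), s)" by (metis surj_pair)
      have uv: "u \<in> carrier R" "v \<in> carrier R" "s \<in> points S R" "u \<otimes>\<^bsub>R\<^esub> v = p R s"
        using x R by (simp_all add: points_XS xe)
      have "((u, v), kid R) \<in> ?P R (p R s) R"
        using uv R p1[OF R uv(3)] by (simp add: points_XS_Spec khom_kid)
      from ps_snd[OF R R uv(3) this, of f] show ?thesis
        using R x S2[OF R uv(3)] by (simp add: th_def xe)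
    qed
    moreover have "f \<in> (\<Pi>\<^sub>E R\<in>kalgs k. points (XS k S p) R \<rightarrow>\<^sub>E points Z R)"
      "th (ps f) \<in> (\<Pi>\<^sub>E R\<in>kalgs k. points (XS k S p) R \<rightarrow>\<^sub>E points Z R)"
      using Maps_Gm_PiE[OF f] Maps_Gm_PiE[OF th_in[OF ps_in[OF f]]] .
    ultimately show ?thesis
      by (rule PiE2_ext)
  qed
  have "bij_betw th ?M (Maps_Gm k S p Z a)"
    by (rule bij_betw_byWitness[where f' = ps]) (use th_in ps_in ps_th th_ps in blast)+
  then show ?thesis unfolding th_def .
qed

end

theory Submission
  imports Defs
begin

text \<open>
  Let \<open>Z = Spec A\<close>.  An action of \<open>Gm\<close> on \<open>Z\<close> amounts to a grading of \<open>A\<close> by the integers: the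
  generic unit \<open>X\<close> sends a function \<open>x\<close> to the sum of the \<open>pr n x \<cdot> X\<^sup>n\<close>, where \<open>pr n x\<close> is the
  component of degree \<open>n\<close>.

  For an algebra \<open>R\<close> and \<open>t \<in> R\<close>, the base change of the family of hyperbolas along \<open>t\<close> is the
  spectrum of \<open>B = R[U, V]/(U V - t)\<close>.  This algebra is free over \<open>R\<close> on the powers of \<open>U\<close> and of
  \<open>V\<close>, and it is graded by giving \<open>U\<close> degree \<open>1\<close> and \<open>V\<close> degree \<open>-1\<close>, so each degree has rank one.
  An equivariant map to \<open>Z\<close> is thus a homomorphism \<open>A \<rightarrow> B\<close> that sends a function \<open>x\<close> of degree \<open>n\<close>
  to \<open>r U\<^sup>n\<close> if \<open>n \<ge> 0\<close> and to \<open>r V\<^sup>-\<^sup>n\<close> if \<open>n \<le> 0\<close>, for some \<open>r \<in> R\<close>.  Let \<open>z1\<close> and \<open>z2\<close> be its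
  restrictions to the sections \<open>(1, t)\<close> and \<open>(t, 1)\<close>.  Then \<open>z1 x = r\<close> and \<open>z2 x = t\<^sup>n r\<close> if \<open>n \<ge> 0\<close>,
  whereas \<open>z1 x = t\<^sup>-\<^sup>n r\<close> and \<open>z2 x = r\<close> if \<open>n \<le> 0\<close>.  Hence \<open>(t, z1, z2)\<close> determines the map, and it
  satisfies equations, called \<open>compatible\<close> below, whose coefficients are powers of \<open>t\<close>
  (\<open>Ztilde_coord\<close>).

  Conversely, a compatible triple defines an \<open>R\<close>-point of \<open>Ztilde\<close> (\<open>Ztilde_point_exists\<close>).  The
  crux is that the map \<open>A \<rightarrow> B\<close> given by the elements \<open>r\<close> is multiplicative.  The algebra \<open>B\<close> embeds
  into the product of two Laurent polynomial rings \<open>R[X, 1/X]\<close> through \<open>(U, V) = (X, t/X)\<close> and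
  \<open>(U, V) = (t X, 1/X)\<close>, and in these two rings the map becomes evaluation at the points \<open>X \<cdot> z1\<close>
  and \<open>X \<cdot> z2\<close> of \<open>Z\<close>, which is a homomorphism (\<open>glue_hom\<close>).

  So \<open>ptilde\<close> identifies \<open>Ztilde\<close> with the locus of compatible triples (\<open>ptilde_bij\<close>).  Over a point
  of the product with values in \<open>R\<close> this locus is cut out by the ideal that the equations generate,
  hence \<open>ptilde\<close> is a closed embedding.  A representing algebra is the subalgebra that the
  coordinates of the universal triple generate inside the product of all test algebras, with one
  factor for each compatible triple (\<open>universal_compatible_triple\<close>).  As \<open>A\<close> is finitely generated,
  so is this subalgebra, and therefore it has a copy in the universe.
\<close>

section \<open>Homomorphisms of algebras and functors of points\<close>

lemma kalgs_cring: "R \<in> kalgs k \<Longrightarrow> cring R"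
  by (auto simp: kalgs_def intro: algebra.M_cring)

lemma khomI:
  assumes "h \<in> ring_hom R T" "h \<in> extensional (carrier R)"
    and "\<And>c x. c \<in> carrier k \<Longrightarrow> x \<in> carrier R \<Longrightarrow> h (c \<odot>\<^bsub>R\<^esub> x) = c \<odot>\<^bsub>T\<^esub> h x"
  shows "h \<in> khom k R T"
  using assms by (auto simp: khom_def)

lemma khom_closed: "h \<in> khom k R T \<Longrightarrow> x \<in> carrier R \<Longrightarrow> h x \<in> carrier T"
  by (auto simp: khom_def ring_hom_def)

lemma khom_one: "h \<in> khom k R T \<Longrightarrow> h \<one>\<^bsub>R\<^esub> = \<one>\<^bsub>T\<^esub>"
  by (auto simp: khom_def ring_hom_def)

lemma khom_mult:
  "h \<in> khom k R T \<Longrightarrow> x \<in> carrier R \<Longrightarrow> y \<in> carrier R \<Longrightarrow> h (x \<otimes>\<^bsub>R\<^esub> y) = h x \<otimes>\<^bsub>T\<^esub> h y"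
  by (auto simp: khom_def ring_hom_def)

lemma khom_add:
  "h \<in> khom k R T \<Longrightarrow> x \<in> carrier R \<Longrightarrow> y \<in> carrier R \<Longrightarrow> h (x \<oplus>\<^bsub>R\<^esub> y) = h x \<oplus>\<^bsub>T\<^esub> h y"
  by (auto simp: khom_def ring_hom_def)

lemma khom_smult:
  assumes "h \<in> khom k R T" "c \<in> carrier k" "x \<in> carrier R"
  shows "h (c \<odot>\<^bsub>R\<^esub> x) = c \<odot>\<^bsub>T\<^esub> h x"
  using assms by (auto simp: khom_def)

lemma khom_ext:
  assumes "g \<in> khom k R T" "h \<in> khom k R T" "\<And>x. x \<in> carrier R \<Longrightarrow> g x = h x"
  shows "g = h"
  using assms by (auto simp: khom_def intro: extensionalityI)

lemma khom_ring_hom_cring: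
  assumes "R \<in> kalgs k" "T \<in> kalgs k" "h \<in> khom k R T"
  shows "ring_hom_cring R T h"
  using assms by (intro ring_hom_cring.intro ring_hom_cring_axioms.intro kalgs_cring) (auto simp: khom_def)

lemma khom_ring_hom_ring:
  assumes "R \<in> kalgs k" "T \<in> kalgs k" "h \<in> khom k R T"
  shows "ring_hom_ring R T h"
  using khom_ring_hom_cring[OF assms] by (simp add: ring_hom_cring_def ring_hom_ring_def
      ring_hom_cring_axioms_def ring_hom_ring_axioms_def cring_def)

lemma khom_zero:
  assumes "R \<in> kalgs k" "T \<in> kalgs k" "h \<in> khom k R T"
  shows "h \<zero>\<^bsub>R\<^esub> = \<zero>\<^bsub>T\<^esub>"
proof -
  interpret ring_hom_ring R T h by (rule khom_ring_hom_ring[OF assms])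
  show ?thesis by (rule hom_zero)
qed

lemma khom_a_inv:
  assumes "R \<in> kalgs k" "T \<in> kalgs k" "h \<in> khom k R T" "x \<in> carrier R"
  shows "h (\<ominus>\<^bsub>R\<^esub> x) = \<ominus>\<^bsub>T\<^esub> h x"
proof -
  interpret ring_hom_ring R T h by (rule khom_ring_hom_ring[OF assms(1-3)])
  show ?thesis by (rule hom_a_inv[OF assms(4)])
qed

text \<open>
  \<open>compose\<close> restricts to the domain of the inner map, so associativity depends on the inner map
  landing in the domain of the middle one.
\<close>

lemma khom_compose_assoc:
  assumes "h \<in> khom k R S"
  shows "compose (carrier R) f (compose (carrier R) g h) = compose (carrier R) (compose (carrier S) f g) h"
  by (rule compose_assoc) (use khom_closed[OF assms] in auto)

lemma khom_eq_on_generators: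
  assumes R: "R \<in> kalgs k" "T \<in> kalgs k" and g: "g \<in> khom k R T" and h: "h \<in> khom k R T"
    and gen: "carrier R = generate_ring R ((\<lambda>c. c \<odot>\<^bsub>R\<^esub> \<one>\<^bsub>R\<^esub>) ` carrier k \<union> G)"
    and eq: "\<And>x. x \<in> G \<Longrightarrow> g x = h x"
  shows "g = h"
proof (rule khom_ext[OF g h])
  interpret R: algebra k R using R by (simp add: kalgs_def)
  interpret g: ring_hom_ring R T g by (rule khom_ring_hom_ring[OF R g])
  interpret h: ring_hom_ring R T h by (rule khom_ring_hom_ring[OF R h])
  let ?H = "(\<lambda>c. c \<odot>\<^bsub>R\<^esub> \<one>\<^bsub>R\<^esub>) ` carrier k \<union> G"
  fix x assume "x \<in> carrier R"
  then have "x \<in> generate_ring R ?H" using gen by simp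
  then show "g x = h x"
  proof induction
    case (incl x)
    then show ?case using eq khom_smult[OF g] khom_smult[OF h] by auto
  qed (use gen in auto)
qed

lemma kfunctor_closed:
  "kfunctor k F \<Longrightarrow> R \<in> kalgs k \<Longrightarrow> T \<in> kalgs k \<Longrightarrow> h \<in> khom k R T \<Longrightarrow> x \<in> points F R \<Longrightarrow>
    on_hom F R T h x \<in> points F T"
  unfolding kfunctor_def by blast

lemma kfunctor_id: "kfunctor k F \<Longrightarrow> R \<in> kalgs k \<Longrightarrow> x \<in> points F R \<Longrightarrow> on_hom F R R (kid R) x = x"
  unfolding kfunctor_def by blast

lemma kfunctor_compose:
  "kfunctor k F \<Longrightarrow> R \<in> kalgs k \<Longrightarrow> S \<in> kalgs k \<Longrightarrow> T \<in> kalgs k \<Longrightarrow>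
    h \<in> khom k R S \<Longrightarrow> g \<in> khom k S T \<Longrightarrow> x \<in> points F R \<Longrightarrow>
    on_hom F R T (compose (carrier R) g h) x = on_hom F S T g (on_hom F R S h x)"
  unfolding kfunctor_def by blast

lemma point_map_kmaps:
  assumes F: "kfunctor k F" and R: "R \<in> kalgs k" and x: "x \<in> points F R"
  shows "point_map k F R x \<in> kmaps k (Spec k R) F"
  unfolding kmaps_def
proof (intro CollectI conjI ballI)
  show "point_map k F R x \<in> (\<Pi>\<^sub>E T\<in>kalgs k. points (Spec k R) T \<rightarrow>\<^sub>E points F T)"
    using kfunctor_closed[OF F R _ _ x] by (auto simp: point_map_def Spec_def)
  fix T T' h g assume T: "T \<in> kalgs k" "T' \<in> kalgs k" "h \<in> khom k T T'" "g \<in> points (Spec k R) T"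
  then show "point_map k F R x T' (on_hom (Spec k R) T T' h g) = on_hom F T T' h (point_map k F R x T g)"
    using kfunctor_compose[OF F R T(1,2) _ T(3) x] khom_compose[of g k R T h T'] R
    by (simp add: Spec_def point_map_def)
qed

section \<open>Copies of algebras inside the universe\<close>

text \<open>
  Terms built from generators by the ring operations.  They bound the size of a generated ring:
  every element is the value of a term, and terms over the universe can be coded by elements of
  the universe.
\<close>

datatype 'h ring_term =
    Term_one | Term_gen 'h | Term_neg "'h ring_term"
  | Term_add "'h ring_term" "'h ring_term" | Term_mult "'h ring_term" "'h ring_term"

fun term_value :: "('q, 'm) ring_scheme \<Rightarrow> ('h \<Rightarrow> 'q) \<Rightarrow> 'h ring_term \<Rightarrow> 'q" where
  "term_value Q \<phi> Term_one = \<one>\<^bsub>Q\<^esub>"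
| "term_value Q \<phi> (Term_gen x) = \<phi> x"
| "term_value Q \<phi> (Term_neg s) = \<ominus>\<^bsub>Q\<^esub> term_value Q \<phi> s"
| "term_value Q \<phi> (Term_add s s') = term_value Q \<phi> s \<oplus>\<^bsub>Q\<^esub> term_value Q \<phi> s'"
| "term_value Q \<phi> (Term_mult s s') = term_value Q \<phi> s \<otimes>\<^bsub>Q\<^esub> term_value Q \<phi> s'"

text \<open>
  The tags \<open>c 0, \<dots>, c 4\<close> record the head symbol, and \<open>b\<close> pairs a tag with the codes of the arguments.
\<close>

fun term_code :: "(nat \<Rightarrow> 'u) \<Rightarrow> ('u \<times> 'u \<Rightarrow> 'u) \<Rightarrow> 'u ring_term \<Rightarrow> 'u" where
  "term_code c b Term_one = b (c 0, c 0)"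
| "term_code c b (Term_gen x) = b (c 1, x)"
| "term_code c b (Term_neg s) = b (c 2, term_code c b s)"
| "term_code c b (Term_add s s') = b (c 3, b (term_code c b s, term_code c b s'))"
| "term_code c b (Term_mult s s') = b (c 4, b (term_code c b s, term_code c b s'))"

lemma term_code_inj:
  assumes "inj c" "inj b"
  shows "inj (term_code c b)"
proof (rule injI)
  fix s s' show "term_code c b s = term_code c b s' \<Longrightarrow> s = s'"
    by (induction s arbitrary: s'; case_tac s') (auto simp: inj_eq[OF assms(1)] inj_eq[OF assms(2)])
qed

text \<open>
  Each element of the generated ring is the value of a term, and choosing one term for each element
  and coding it gives the injection; the map \<open>\<phi>\<close> names the generators by elements of the universe.
\<close>

lemma generate_ring_inj_universe:
  fixes Q :: "('q, 'm) ring_scheme" and \<phi> :: "'u \<Rightarrow> 'q"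
  assumes inf: "infinite (UNIV :: 'u set)" and H: "H \<subseteq> range \<phi>"
  shows "\<exists>e :: 'q \<Rightarrow> 'u. inj_on e (generate_ring Q H)"
proof -
  obtain c :: "nat \<Rightarrow> 'u" where c: "inj c"
    using inf infinite_countable_subset by blast
  obtain b :: "'u \<times> 'u \<Rightarrow> 'u" where b: "inj b"
    using card_of_Times_same_infinite[OF inf] ordIso_imp_ordLeq
    by (metis UNIV_Times_UNIV card_of_ordLeq)
  let ?v = "term_value Q \<phi>"
  have "\<exists>s. x = ?v s" if "x \<in> generate_ring Q H" for x
    using that
  proof induction
    case one show ?case by (rule exI[of _ Term_one]) simp
  next
    case (incl h)
    then obtain u where "h = \<phi> u" using H by auto
    then show ?case by (intro exI[of _ "Term_gen u"]) simp
  next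
    case (a_inv h)
    then obtain s where "h = ?v s" by auto
    then show ?case by (intro exI[of _ "Term_neg s"]) simp
  next
    case (eng_add h h')
    then obtain s s' where "h = ?v s" "h' = ?v s'" by auto
    then show ?case by (intro exI[of _ "Term_add s s'"]) simp
  next
    case (eng_mult h h')
    then obtain s s' where "h = ?v s" "h' = ?v s'" by auto
    then show ?case by (intro exI[of _ "Term_mult s s'"]) simp
  qed
  then have "inj_on (inv_into UNIV ?v) (generate_ring Q H)"
    by (intro inj_on_inv_into) blast
  then have "inj_on (term_code c b \<circ> inv_into UNIV ?v) (generate_ring Q H)"
    by (rule comp_inj_on[OF _ inj_on_subset[OF term_code_inj[OF c b] subset_UNIV]])
  then show ?thesis by blast
qed

text \<open>
  The algebra structure on the image of \<open>e\<close> that makes \<open>e\<close> an isomorphism, provided that \<open>e\<close> is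
  injective on the carrier.
\<close>

definition transport :: "('q \<Rightarrow> 'u) \<Rightarrow> ('c, 'q) module \<Rightarrow> ('c, 'u) module" where
  "transport e M = (let d = inv_into (carrier M) e in
     \<lparr> carrier = e ` carrier M,
       monoid.mult = (\<lambda>x y. e (d x \<otimes>\<^bsub>M\<^esub> d y)), one = e \<one>\<^bsub>M\<^esub>,
       zero = e \<zero>\<^bsub>M\<^esub>, add = (\<lambda>x y. e (d x \<oplus>\<^bsub>M\<^esub> d y)),
       smult = (\<lambda>c x. e (c \<odot>\<^bsub>M\<^esub> d x)) \<rparr>)"

lemma transport_simps:
  assumes "inj_on e (carrier M)"
  shows "carrier (transport e M) = e ` carrier M"
    and "\<one>\<^bsub>transport e M\<^esub> = e \<one>\<^bsub>M\<^esub>" "\<zero>\<^bsub>transport e M\<^esub> = e \<zero>\<^bsub>M\<^esub>"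
    and "\<And>x y. x \<in> carrier M \<Longrightarrow> y \<in> carrier M \<Longrightarrow> e x \<otimes>\<^bsub>transport e M\<^esub> e y = e (x \<otimes>\<^bsub>M\<^esub> y)"
    and "\<And>x y. x \<in> carrier M \<Longrightarrow> y \<in> carrier M \<Longrightarrow> e x \<oplus>\<^bsub>transport e M\<^esub> e y = e (x \<oplus>\<^bsub>M\<^esub> y)"
    and "\<And>c x. x \<in> carrier M \<Longrightarrow> c \<odot>\<^bsub>transport e M\<^esub> e x = e (c \<odot>\<^bsub>M\<^esub> x)"
  using assms by (simp_all add: transport_def Let_def)

lemma transport_algebra:
  assumes M: "algebra k M" and e: "inj_on e (carrier M)"
  shows "algebra k (transport e M)"
proof -
  interpret algebra k M by fact
  note ts = transport_simps[OF e]
  let ?N = "transport e M"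
  show ?thesis
  proof (rule algebraI)
    show "cring k" by (rule R_cring)
    show "cring ?N"
    proof (rule cringI)
      show "abelian_group ?N"
      proof (rule abelian_groupI)
        fix x assume "x \<in> carrier ?N"
        then obtain x' where x: "x = e x'" "x' \<in> carrier M" by (auto simp: ts)
        then have "e (\<ominus>\<^bsub>M\<^esub> x') \<oplus>\<^bsub>?N\<^esub> x = \<zero>\<^bsub>?N\<^esub>" by (simp add: ts M.l_neg)
        then show "\<exists>y\<in>carrier ?N. y \<oplus>\<^bsub>?N\<^esub> x = \<zero>\<^bsub>?N\<^esub>" using x by (auto simp: ts)
      qed (auto simp: ts M.a_ac)
      show "Group.comm_monoid ?N"
        by (rule comm_monoidI) (auto simp: ts m_assoc m_comm m_lcomm)
    qed (auto simp: ts l_distr)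
  qed (auto simp: ts smult_l_distr smult_r_distr smult_assoc1 smult_assoc2)
qed

lemma transport_hom:
  assumes e: "inj_on e (carrier M)"
  shows "e \<in> ring_hom M (transport e M)"
  using e by (auto intro!: ring_hom_memI simp: transport_simps)

text \<open>
  Representing algebras are built on function spaces outside the universe.  This lemma moves a
  finitely generated subalgebra \<open>S\<close> of such an algebra back into the universe; since \<open>k\<close> lies in the
  universe, \<open>S\<close> is not too large.
\<close>

lemma finitely_generated_copy_in_universe:
  fixes k :: "'u ring" and Q :: "('u, 'q) module"
  assumes inf: "infinite (UNIV :: 'u set)" and Q: "algebra k Q" and G: "finite G" "G \<subseteq> carrier Q"
  defines "S \<equiv> generate_ring Q ((\<lambda>c. c \<odot>\<^bsub>Q\<^esub> \<one>\<^bsub>Q\<^esub>) ` carrier k \<union> G)"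
  obtains D and e :: "'q \<Rightarrow> 'u" where "algebra k (Q\<lparr>carrier := S\<rparr>)" "D \<in> kalgs k" "bij_betw e S (carrier D)"
    "e \<in> ring_hom (Q\<lparr>carrier := S\<rparr>) D" "\<And>c x. x \<in> S \<Longrightarrow> e (c \<odot>\<^bsub>Q\<^esub> x) = c \<odot>\<^bsub>D\<^esub> e x"
    "carrier D = generate_ring D ((\<lambda>c. c \<odot>\<^bsub>D\<^esub> \<one>\<^bsub>D\<^esub>) ` carrier k \<union> e ` G)"
proof -
  interpret algebra k Q by fact
  let ?H = "(\<lambda>c. c \<odot>\<^bsub>Q\<^esub> \<one>\<^bsub>Q\<^esub>) ` carrier k \<union> G"
  let ?M = "Q\<lparr>carrier := S\<rparr>"
  have H: "?H \<subseteq> carrier Q" using G by auto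
  have sub: "subring S Q" unfolding S_def by (rule generate_ring_is_subring[OF H])
  note SQ = subringE(1)[OF sub]
  note SQ' = subsetD[OF SQ]
  have "c \<odot>\<^bsub>Q\<^esub> x \<in> S" if "c \<in> carrier k" "x \<in> S" for c x
  proof -
    have "(c \<odot>\<^bsub>Q\<^esub> \<one>\<^bsub>Q\<^esub>) \<otimes>\<^bsub>Q\<^esub> x \<in> S"
      by (rule subringE(6)[OF sub _ that(2)]) (use that(1) in \<open>auto simp: S_def intro: generate_ring.incl\<close>)
    then show ?thesis using that SQ' by (simp add: smult_assoc2)
  qed
  note S_smult = this
  have "cring ?M" using subcring_iff[OF SQ] subcringI'[OF sub] by simp
  then have M: "algebra k ?M"
    by (intro algebraI R_cring)
      (simp_all add: S_smult SQ' smult_l_distr smult_r_distr smult_assoc1 smult_assoc2)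
  have card: "(card_of ?H, card_of (UNIV :: 'u set)) \<in> ordLeq"
  proof (rule card_of_Un_ordLeq_infinite_Field)
    show "\<not> finite (Field (card_of (UNIV :: 'u set)))" "Card_order (card_of (UNIV :: 'u set))"
      by (simp add: Field_card_of inf, rule card_of_Card_order)
    show "(card_of ((\<lambda>c. c \<odot>\<^bsub>Q\<^esub> \<one>\<^bsub>Q\<^esub>) ` carrier k), card_of (UNIV :: 'u set)) \<in> ordLeq"
      by (rule ordLeq_transitive[OF card_of_image card_of_mono1[OF subset_UNIV]])
    show "(card_of G, card_of (UNIV :: 'u set)) \<in> ordLeq"
      by (rule ordLess_imp_ordLeq, rule finite_ordLess_infinite[OF card_of_Well_order card_of_Well_order])
        (use G(1) inf in \<open>simp_all add: Field_card_of\<close>)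
  qed
  have "?H \<noteq> {}" using R.one_closed by blast
  from card_of_ordLeq2[OF this, THEN iffD2, OF card]
  obtain \<phi> :: "'u \<Rightarrow> 'q" where "\<phi> ` UNIV = ?H" by (rule exE)
  then have "?H \<subseteq> range \<phi>" by (simp only: subset_refl)
  from generate_ring_inj_universe[OF inf this, of Q]
  obtain e :: "'q \<Rightarrow> 'u" where "inj_on e S" unfolding S_def by (rule exE)
  then have e: "inj_on e (carrier ?M)" by simp
  define D where "D = transport e ?M"
  have D: "D \<in> kalgs k" using transport_algebra[OF M e] by (simp add: D_def kalgs_def)
  note ts = transport_simps[OF e, folded D_def, simplified]
  interpret D: algebra k D using D by (simp add: kalgs_def)
  interpret eh: ring_hom_ring ?M D e
    using transport_hom[OF e] algebra.M_cring[OF M] D.M_cring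
    by (intro ring_hom_ringI2) (auto simp: D_def cring_def)
  have one: "\<one>\<^bsub>Q\<^esub> \<in> S" by (rule subringE(3)[OF sub])
  let ?HD = "(\<lambda>c. c \<odot>\<^bsub>D\<^esub> \<one>\<^bsub>D\<^esub>) ` carrier k \<union> e ` G"
  have "c \<odot>\<^bsub>D\<^esub> \<one>\<^bsub>D\<^esub> = e (c \<odot>\<^bsub>Q\<^esub> \<one>\<^bsub>Q\<^esub>)" for c using ts(6)[OF one] ts(2) by simp
  then have HD: "?HD = e ` ?H" by (simp only: image_Un image_image)
  have "e x \<in> generate_ring D ?HD" if "x \<in> S" for x
    using that unfolding S_def HD
  proof induction
    case one then show ?case using generate_ring.one[of D "e ` ?H"] by (simp add: ts)
  next
    case (incl h) then show ?case by (intro generate_ring.incl imageI)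
  next
    case (a_inv h)
    have hS: "h \<in> S" using a_inv by (simp add: S_def)
    have "\<ominus>\<^bsub>Q\<^esub> h \<in> S" by (rule subringE(5)[OF sub hS])
    then have "e (\<ominus>\<^bsub>Q\<^esub> h) \<oplus>\<^bsub>D\<^esub> e h = \<zero>\<^bsub>D\<^esub>"
      using hS SQ' by (simp add: ts M.l_neg)
    then have "e (\<ominus>\<^bsub>Q\<^esub> h) = \<ominus>\<^bsub>D\<^esub> e h"
      using \<open>\<ominus>\<^bsub>Q\<^esub> h \<in> S\<close> hS by (intro D.minus_equality[symmetric]) (auto simp: ts)
    then show ?case using generate_ring.a_inv[OF a_inv(2)] by simp
  next
    case (eng_add h h')
    then have "e (h \<oplus>\<^bsub>Q\<^esub> h') = e h \<oplus>\<^bsub>D\<^esub> e h'" by (simp add: ts S_def)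
    then show ?case using generate_ring.eng_add[OF eng_add(3,4)] by simp
  next
    case (eng_mult h h')
    then have "e (h \<otimes>\<^bsub>Q\<^esub> h') = e h \<otimes>\<^bsub>D\<^esub> e h'" by (simp add: ts S_def)
    then show ?case using generate_ring.eng_mult[OF eng_mult(3,4)] by simp
  qed
  moreover have "?HD \<subseteq> carrier D"
    unfolding HD ts(1) S_def by (intro image_mono subsetI generate_ring.incl)
  ultimately have "carrier D = generate_ring D ?HD"
    using D.generate_ring_incl[of ?HD] unfolding ts(1) by blast
  moreover have "bij_betw e S (carrier D)" using e by (simp add: bij_betw_def ts)
  ultimately show ?thesis
    by (intro that[OF M D _ eh.homh ts(6)[symmetric]])
qed

section \<open>Finitely supported families\<close>

text \<open>
  \<open>finsum\<close> over an infinite set has a default value, so the sum runs over the support only.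
\<close>

definition fsum :: "('a, 'm) ring_scheme \<Rightarrow> (int \<Rightarrow> 'a) \<Rightarrow> 'a" where
  "fsum R c = finsum R c {n. c n \<noteq> \<zero>\<^bsub>R\<^esub>}"

definition finsupp :: "('a, 'm) ring_scheme \<Rightarrow> (int \<Rightarrow> 'a) set" where
  "finsupp R = {c. (\<forall>n. c n \<in> carrier R) \<and> finite {n. c n \<noteq> \<zero>\<^bsub>R\<^esub>}}"

definition single :: "('a, 'm) ring_scheme \<Rightarrow> int \<Rightarrow> 'a \<Rightarrow> int \<Rightarrow> 'a" where
  "single R n r = (\<lambda>m. if m = n then r else \<zero>\<^bsub>R\<^esub>)"

lemma finsuppD:
  assumes "c \<in> finsupp R"
  shows "c n \<in> carrier R" "finite {n. c n \<noteq> \<zero>\<^bsub>R\<^esub>}"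
  using assms by (auto simp: finsupp_def)

lemma finsupp_mono:
  assumes "c \<in> finsupp R" "\<And>n. d n \<in> carrier S" "\<And>n. c n = \<zero>\<^bsub>R\<^esub> \<Longrightarrow> d n = \<zero>\<^bsub>S\<^esub>"
  shows "d \<in> finsupp S"
proof -
  have "{n. d n \<noteq> \<zero>\<^bsub>S\<^esub>} \<subseteq> {n. c n \<noteq> \<zero>\<^bsub>R\<^esub>}" using assms(3) by blast
  then show ?thesis using assms(1,2) finite_subset by (auto simp: finsupp_def)
qed

context ring
begin

lemma fsum_eq:
  assumes "finite N" "\<And>n. c n \<in> carrier R" "\<And>n. n \<notin> N \<Longrightarrow> c n = \<zero>"
  shows "fsum R c = (\<Oplus>n\<in>N. c n)"
  unfolding fsum_def
  by (rule add.finprod_mono_neutral_cong_left) (use assms in auto)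

lemma fsum_closed [simp]: "c \<in> finsupp R \<Longrightarrow> fsum R c \<in> carrier R"
  unfolding fsum_def by (rule finsum_closed) (auto simp: finsupp_def)

lemma finsupp_zero: "(\<lambda>n. \<zero>) \<in> finsupp R"
  by (simp add: finsupp_def)

lemma finsupp_single: "r \<in> carrier R \<Longrightarrow> single R n r \<in> finsupp R"
  by (auto simp: finsupp_def single_def)

lemma finsupp_add:
  assumes "c \<in> finsupp R" "d \<in> finsupp R"
  shows "(\<lambda>n. c n \<oplus> d n) \<in> finsupp R"
proof -
  have "{n. c n \<oplus> d n \<noteq> \<zero>} \<subseteq> {n. c n \<noteq> \<zero>} \<union> {n. d n \<noteq> \<zero>}" by auto
  then show ?thesis using assms finite_subset by (fastforce simp: finsupp_def)
qed

lemma fsum_zero: "fsum R (\<lambda>n. \<zero>) = \<zero>"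
  by (simp add: fsum_def)

lemma fsum_add:
  assumes "c \<in> finsupp R" "d \<in> finsupp R"
  shows "fsum R (\<lambda>n. c n \<oplus> d n) = fsum R c \<oplus> fsum R d"
proof -
  let ?N = "{n. c n \<noteq> \<zero>} \<union> {n. d n \<noteq> \<zero>}"
  have N: "finite ?N" and cd: "c n \<in> carrier R" "d n \<in> carrier R" for n
    using assms by (auto simp: finsupp_def)
  have "fsum R (\<lambda>n. c n \<oplus> d n) = (\<Oplus>n\<in>?N. c n \<oplus> d n)"
    by (rule fsum_eq[OF N]) (auto simp: cd)
  also have "\<dots> = (\<Oplus>n\<in>?N. c n) \<oplus> (\<Oplus>n\<in>?N. d n)"
    by (rule finsum_addf) (auto simp: cd)
  also have "(\<Oplus>n\<in>?N. c n) = fsum R c" by (rule fsum_eq[OF N, symmetric]) (auto simp: cd)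
  also have "(\<Oplus>n\<in>?N. d n) = fsum R d" by (rule fsum_eq[OF N, symmetric]) (auto simp: cd)
  finally show ?thesis .
qed

lemma fsum_one_term:
  assumes "c n \<in> carrier R" "\<And>m. m \<noteq> n \<Longrightarrow> c m = \<zero>"
  shows "fsum R c = c n"
proof -
  have "c m \<in> carrier R" for m by (cases "m = n") (simp_all add: assms)
  then have "fsum R c = (\<Oplus>n\<in>{n}. c n)" by (intro fsum_eq) (auto simp: assms)
  then show ?thesis using assms(1) by simp
qed

text \<open>
  Identities between additive expressions in finitely supported families need to be checked for
  families with a single entry only.
\<close>

lemma finsupp_induct [consumes 1, case_names zero add]:
  assumes p: "p \<in> finsupp R"
    and 0: "P (\<lambda>n. \<zero>)"
    and add: "\<And>n r q. r \<in> carrier R \<Longrightarrow> q \<in> finsupp R \<Longrightarrow> P q \<Longrightarrow> P (\<lambda>m. single R n r m \<oplus> q m)"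
  shows "P p"
proof -
  have "\<forall>p. (\<forall>n. p n \<in> carrier R) \<and> {n. p n \<noteq> \<zero>} \<subseteq> N \<longrightarrow> P p" if "finite N" for N
    using that
  proof induction
    case empty
    have "p = (\<lambda>n. \<zero>)" if "{n. p n \<noteq> \<zero>} \<subseteq> {}" for p :: "int \<Rightarrow> 'a" using that by auto
    then show ?case using 0 by blast
  next
    case (insert n N)
    show ?case
    proof (intro allI impI)
      fix p assume p: "(\<forall>n. p n \<in> carrier R) \<and> {n. p n \<noteq> \<zero>} \<subseteq> insert n N"
      define q where "q = p(n := \<zero>)"
      have q: "(\<forall>n. q n \<in> carrier R)" "{m. q m \<noteq> \<zero>} \<subseteq> N" using p by (auto simp: q_def)
      then have "q \<in> finsupp R" using insert(1) finite_subset by (auto simp: finsupp_def)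
      moreover have "P q" using insert q by blast
      ultimately have "P (\<lambda>m. single R n (p n) m \<oplus> q m)" using add p by blast
      moreover have "(\<lambda>m. single R n (p n) m \<oplus> q m) = p" using p by (auto simp: q_def single_def)
      ultimately show "P p" by simp
    qed
  qed
  then show ?thesis using p by (auto simp: finsupp_def)
qed

lemma fsum_mult_left:
  assumes "c \<in> finsupp R" "r \<in> carrier R"
  shows "fsum R (\<lambda>n. r \<otimes> c n) = r \<otimes> fsum R c"
proof -
  have N: "finite {n. c n \<noteq> \<zero>}" and c: "c n \<in> carrier R" for n using assms by (auto simp: finsupp_def)
  have "fsum R (\<lambda>n. r \<otimes> c n) = (\<Oplus>n\<in>{n. c n \<noteq> \<zero>}. r \<otimes> c n)"
    by (rule fsum_eq[OF N]) (auto simp: c assms)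
  also have "\<dots> = r \<otimes> fsum R c"
    unfolding fsum_def by (rule finsum_rdistr[symmetric]) (auto simp: N c assms)
  finally show ?thesis .
qed

end

lemma (in ring_hom_ring) hom_fsum:
  assumes "c \<in> finsupp R"
  shows "h (fsum R c) = fsum S (\<lambda>n. h (c n))"
proof -
  have N: "finite {n. c n \<noteq> \<zero>}" and c: "c n \<in> carrier R" for n using assms by (auto simp: finsupp_def)
  have "h (fsum R c) = (\<Oplus>\<^bsub>S\<^esub>n\<in>{n. c n \<noteq> \<zero>}. h (c n))"
    unfolding fsum_def by (subst hom_finsum) (auto simp: c o_def)
  also have "\<dots> = fsum S (\<lambda>n. h (c n))"
    by (rule S.fsum_eq[symmetric, OF N]) (auto simp: c)
  finally show ?thesis .
qed

section \<open>The hyperbola algebra\<close>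

text \<open>
  The element of degree \<open>n\<close> in the basis of the hyperbola algebra, evaluated at the point \<open>(u, v)\<close>:
  \<open>v\<close> plays the role of the inverse of \<open>u\<close>.
\<close>

definition hyp_pow :: "('a, 'm) ring_scheme \<Rightarrow> 'a \<Rightarrow> 'a \<Rightarrow> int \<Rightarrow> 'a" where
  "hyp_pow R u v n = (if 0 \<le> n then u [^]\<^bsub>R\<^esub> nat n else v [^]\<^bsub>R\<^esub> nat (- n))"

text \<open>
  In the product of the basis elements of degrees \<open>n\<close> and \<open>m\<close> each factor \<open>U\<close> that meets a factor
  \<open>V\<close> gives a factor \<open>U V = t\<close>; \<open>excess n m\<close> is the number of these pairs.  The subtraction does not
  truncate, because the negative part is subadditive.
\<close>

definition excess :: "int \<Rightarrow> int \<Rightarrow> nat" where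
  "excess n m = nat (- n) + nat (- m) - nat (- (n + m))"

lemma excess_assoc: "excess n m + excess (n + m) l = excess m l + excess n (m + l)"
  unfolding excess_def by (simp add: nat_diff_split) linarith

lemma excess_comm: "excess n m = excess m n"
  by (simp add: excess_def add.commute)

lemma excess_0 [simp]: "excess 0 n = 0" "excess n 0 = 0"
  by (simp_all add: excess_def)

context cring
begin

lemma hyp_pow_closed [simp]: "u \<in> carrier R \<Longrightarrow> v \<in> carrier R \<Longrightarrow> hyp_pow R u v n \<in> carrier R"
  by (simp add: hyp_pow_def del: pow_nat)

lemma pow_cancel:
  assumes "u \<in> carrier R" "v \<in> carrier R"
  shows "u [^] (i + j) \<otimes> v [^] (j::nat) = (u \<otimes> v) [^] j \<otimes> u [^] (i::nat)"
  using assms by (simp add: nat_pow_mult[symmetric] pow_mult_distrib[OF m_comm] m_ac)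

lemma hyp_pow_mult:
  assumes uv: "u \<in> carrier R" "v \<in> carrier R"
  shows "hyp_pow R u v n \<otimes> hyp_pow R u v m = (u \<otimes> v) [^] excess n m \<otimes> hyp_pow R u v (n + m)"
proof -
  have opp: "hyp_pow R u v (int i) \<otimes> hyp_pow R u v (- int j) =
      (u \<otimes> v) [^] excess (int i) (- int j) \<otimes> hyp_pow R u v (int i - int j)" for i j
  proof -
    have H: "hyp_pow R u v (int i) = u [^] i" "hyp_pow R u v (- int j) = v [^] j"
      by (auto simp: hyp_pow_def)
    show ?thesis
    proof (cases "j \<le> i")
      case True
      then have e: "excess (int i) (- int j) = j" "hyp_pow R u v (int i - int j) = u [^] (i - j)"
        by (auto simp: excess_def hyp_pow_def nat_diff_distrib)
      show ?thesis unfolding H e using pow_cancel[OF uv, of "i - j" j] True by simp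
    next
      case False
      then have e: "excess (int i) (- int j) = i" "hyp_pow R u v (int i - int j) = v [^] (j - i)"
        by (auto simp: excess_def hyp_pow_def nat_diff_distrib)
      show ?thesis unfolding H e using pow_cancel[OF uv(2,1), of "j - i" i] False uv
        by (simp add: m_comm)
    qed
  qed
  show ?thesis
  proof (cases "0 \<le> n"; cases "0 \<le> m")
    assume "0 \<le> n" "0 \<le> m"
    then show ?thesis using uv by (simp add: hyp_pow_def excess_def nat_pow_mult nat_add_distrib del: pow_nat)
  next
    assume "0 \<le> n" "\<not> 0 \<le> m"
    then show ?thesis using opp[of "nat n" "nat (- m)"] by simp
  next
    assume "\<not> 0 \<le> n" "0 \<le> m"
    then show ?thesis using opp[of "nat m" "nat (- n)"] uv
      by (simp add: m_comm excess_comm[of n] add.commute)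
  next
    assume nm: "\<not> 0 \<le> n" "\<not> 0 \<le> m"
    then have "nat (- (n + m)) = nat (- n) + nat (- m)" by linarith
    then show ?thesis using nm uv by (simp add: hyp_pow_def excess_def nat_pow_mult del: pow_nat)
  qed
qed

end

lemma (in cring) hyp_pow_distrib:
  assumes "u \<in> carrier R" "v \<in> carrier R" "u' \<in> carrier R" "v' \<in> carrier R"
  shows "hyp_pow R (u \<otimes> u') (v \<otimes> v') n = hyp_pow R u v n \<otimes> hyp_pow R u' v' n"
  unfolding hyp_pow_def using assms by (simp only: nat_pow_distrib split: if_split) simp

lemma hyp_pow_hom:
  assumes "ring_hom_ring T S h" "u \<in> carrier T" "v \<in> carrier T"
  shows "h (hyp_pow T u v n) = hyp_pow S (h u) (h v) n"
proof -
  interpret ring_hom_ring T S h by fact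
  show ?thesis using assms(2,3) by (simp only: hyp_pow_def hom_nat_pow if_distrib[of h])
qed

lemma hyp_pow_one_ge: "0 \<le> n \<Longrightarrow> cring R \<Longrightarrow> hyp_pow R \<one>\<^bsub>R\<^esub> t n = \<one>\<^bsub>R\<^esub>"
  by (simp only: hyp_pow_def if_True monoid.nat_pow_one[OF ring.is_monoid[OF cring.axioms(1)]])

lemma hyp_pow_one_le:
  assumes "n \<le> 0" "cring R"
  shows "hyp_pow R t \<one>\<^bsub>R\<^esub> n = \<one>\<^bsub>R\<^esub>"
proof -
  interpret cring R by fact
  show ?thesis
  proof (cases "n = 0")
    case True then show ?thesis by (simp add: hyp_pow_def)
  next
    case False then show ?thesis using assms(1) by (simp only: hyp_pow_def nat_pow_one) simp
  qed
qed

lemma finsupp_scale: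
  assumes "cring R" "r \<in> carrier R" "r' \<in> carrier R" "p \<in> finsupp R"
  shows "(\<lambda>n. hyp_pow R r r' n \<otimes>\<^bsub>R\<^esub> p n) \<in> finsupp R"
proof -
  interpret cring R by fact
  show ?thesis by (rule finsupp_mono[OF assms(4)]) (use assms in \<open>auto simp: finsuppD(1)\<close>)
qed

lemma (in cring) unit_of_inverse:
  assumes "u \<in> carrier R" "v \<in> carrier R" "u \<otimes> v = \<one>"
  shows "u \<in> Units R" "inv u = v"
  using assms comm_inv_char m_comm[OF assms(1,2)] by (auto simp: Units_def)

text \<open>
  The image of \<open>p\<close>, read as the combination of basis elements with coefficients \<open>p n\<close>, under the
  homomorphism that extends \<open>g\<close> and sends \<open>(U, V)\<close> to \<open>(u, v)\<close>.
\<close>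

definition hyp_eval ::
  "('b, 'm) ring_scheme \<Rightarrow> ('a \<Rightarrow> 'b) \<Rightarrow> 'b \<Rightarrow> 'b \<Rightarrow> (int \<Rightarrow> 'a) \<Rightarrow> 'b" where
  "hyp_eval T g u v p = fsum T (\<lambda>n. g (p n) \<otimes>\<^bsub>T\<^esub> hyp_pow T u v n)"

text \<open>
  Convolution twisted by the cocycle \<open>t ^ excess n m\<close>, the structure constants of the basis.
\<close>

definition hyp_mult ::
  "('a, 'm) ring_scheme \<Rightarrow> 'a \<Rightarrow> (int \<Rightarrow> 'a) \<Rightarrow> (int \<Rightarrow> 'a) \<Rightarrow> int \<Rightarrow> 'a" where
  "hyp_mult R t p q s = fsum R (\<lambda>n. t [^]\<^bsub>R\<^esub> excess n (s - n) \<otimes>\<^bsub>R\<^esub> (p n \<otimes>\<^bsub>R\<^esub> q (s - n)))"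

text \<open>
  The algebra \<open>R[U, V]/(U V - t)\<close>, presented by its basis so that coefficients can be read off.  For
  \<open>t = 1\<close> it is the ring of Laurent polynomials over \<open>R\<close>.
\<close>

definition hyp_algebra :: "('c, 'a) module \<Rightarrow> 'a \<Rightarrow> ('c, int \<Rightarrow> 'a) module" where
  "hyp_algebra R t =
     \<lparr> carrier = finsupp R, monoid.mult = hyp_mult R t, one = single R 0 \<one>\<^bsub>R\<^esub>,
       zero = (\<lambda>n. \<zero>\<^bsub>R\<^esub>), add = (\<lambda>p q n. p n \<oplus>\<^bsub>R\<^esub> q n), smult = (\<lambda>c p n. c \<odot>\<^bsub>R\<^esub> p n) \<rparr>"

locale hyperbola = cring +
  fixes t assumes t: "t \<in> carrier R"
begin

abbreviation "conv \<equiv> hyp_mult R t"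

lemma summand_finsupp:
  assumes "p \<in> finsupp R" "q \<in> finsupp R"
  shows "(\<lambda>n. t [^] excess n (s - n) \<otimes> (p n \<otimes> q (s - n))) \<in> finsupp R"
  by (rule finsupp_mono[OF assms(1)]) (use assms t in \<open>auto simp: finsuppD(1)\<close>)

lemma conv_carrier: "p \<in> finsupp R \<Longrightarrow> q \<in> finsupp R \<Longrightarrow> conv p q s \<in> carrier R"
  unfolding hyp_mult_def by (rule fsum_closed[OF summand_finsupp])

lemma conv_single:
  assumes "r \<in> carrier R" "q \<in> finsupp R"
  shows "conv (single R n r) q = (\<lambda>s. t [^] excess n (s - n) \<otimes> (r \<otimes> q (s - n)))"
  unfolding hyp_mult_def
  by (rule ext, subst fsum_one_term[of _ n]) (use assms t in \<open>auto simp: single_def finsuppD(1)\<close>)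

lemma conv_zero:
  assumes "q \<in> finsupp R"
  shows "conv (\<lambda>n. \<zero>) q = (\<lambda>n. \<zero>)" "conv q (\<lambda>n. \<zero>) = (\<lambda>n. \<zero>)"
  using assms t by (simp_all add: hyp_mult_def fun_eq_iff finsuppD(1) fsum_zero)

lemma conv_add_left:
  assumes "p \<in> finsupp R" "p' \<in> finsupp R" "q \<in> finsupp R"
  shows "conv (\<lambda>n. p n \<oplus> p' n) q = (\<lambda>s. conv p q s \<oplus> conv p' q s)"
proof
  fix s
  have "(\<lambda>n. t [^] excess n (s - n) \<otimes> ((p n \<oplus> p' n) \<otimes> q (s - n))) =
      (\<lambda>n. t [^] excess n (s - n) \<otimes> (p n \<otimes> q (s - n)) \<oplus> t [^] excess n (s - n) \<otimes> (p' n \<otimes> q (s - n)))"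
    using assms t by (auto simp: l_distr r_distr finsuppD(1))
  then show "conv (\<lambda>n. p n \<oplus> p' n) q s = conv p q s \<oplus> conv p' q s"
    unfolding hyp_mult_def using fsum_add[OF summand_finsupp summand_finsupp] assms by simp
qed

lemma conv_add_right:
  assumes "p \<in> finsupp R" "q \<in> finsupp R" "q' \<in> finsupp R"
  shows "conv p (\<lambda>n. q n \<oplus> q' n) = (\<lambda>s. conv p q s \<oplus> conv p q' s)"
proof
  fix s
  have "(\<lambda>n. t [^] excess n (s - n) \<otimes> (p n \<otimes> (q (s - n) \<oplus> q' (s - n)))) =
      (\<lambda>n. t [^] excess n (s - n) \<otimes> (p n \<otimes> q (s - n)) \<oplus> t [^] excess n (s - n) \<otimes> (p n \<otimes> q' (s - n)))"
    using assms t by (auto simp: l_distr r_distr finsuppD(1))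
  then show "conv p (\<lambda>n. q n \<oplus> q' n) s = conv p q s \<oplus> conv p q' s"
    unfolding hyp_mult_def using fsum_add[OF summand_finsupp summand_finsupp] assms by simp
qed

lemma conv_single_single:
  assumes "r \<in> carrier R" "r' \<in> carrier R"
  shows "conv (single R n r) (single R m r') = single R (n + m) (t [^] excess n m \<otimes> (r \<otimes> r'))"
  unfolding conv_single[OF assms(1) finsupp_single[OF assms(2)]]
  using assms t by (auto simp: single_def)

lemma conv_finsupp:
  assumes p: "p \<in> finsupp R" and q: "q \<in> finsupp R"
  shows "conv p q \<in> finsupp R"
  using p
proof (induction rule: finsupp_induct)
  case zero
  show ?case by (simp add: conv_zero q finsupp_zero)
next
  case (add n r p)
  have "conv (single R n r) q \<in> finsupp R"
  proof -
    have "{s. conv (single R n r) q s \<noteq> \<zero>} \<subseteq> (\<lambda>m. m + n) ` {m. q m \<noteq> \<zero>}"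
    proof
      fix s assume "s \<in> {s. conv (single R n r) q s \<noteq> \<zero>}"
      then have "q (s - n) \<noteq> \<zero>" using add q t by (auto simp: conv_single)
      then show "s \<in> (\<lambda>m. m + n) ` {m. q m \<noteq> \<zero>}" by (intro image_eqI[of _ _ "s - n"]) auto
    qed
    then have "finite {s. conv (single R n r) q s \<noteq> \<zero>}"
      using finsuppD(2)[OF q] finite_subset by blast
    then show ?thesis using add q conv_carrier finsupp_single by (auto simp: finsupp_def)
  qed
  then show ?case using add q by (simp add: conv_add_left finsupp_single finsupp_add)
qed

lemma conv_comm:
  assumes p: "p \<in> finsupp R" and q: "q \<in> finsupp R"
  shows "conv p q = conv q p"
  using p
proof (induction rule: finsupp_induct)
  case zero
  show ?case by (simp add: conv_zero q)
next
  case (add n r p)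
  have "conv (single R n r) q = conv q (single R n r)"
    using q
  proof (induction rule: finsupp_induct)
    case zero
    show ?case using add by (simp add: conv_zero finsupp_single)
  next
    case (add m r' q)
    then show ?case using \<open>r \<in> carrier R\<close>
      by (simp add: conv_add_left conv_add_right finsupp_single conv_single_single
          excess_comm add.commute m_comm)
  qed
  then show ?case using add q by (simp add: conv_add_left conv_add_right finsupp_single)
qed

text \<open>
  Both products are additive in each argument, so associativity reduces to basis elements, where it
  is the cocycle identity \<open>excess_assoc\<close>.
\<close>

lemma conv_assoc:
  assumes p: "p \<in> finsupp R" and q: "q \<in> finsupp R" and w: "w \<in> finsupp R"
  shows "conv (conv p q) w = conv p (conv q w)"
  using p
proof (induction rule: finsupp_induct)
  case zero
  show ?case by (simp add: conv_zero q w conv_finsupp)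
next
  case (add n r p)
  note r = \<open>r \<in> carrier R\<close>
  have "conv (conv (single R n r) q) w = conv (single R n r) (conv q w)"
    using q
  proof (induction rule: finsupp_induct)
    case zero
    show ?case using add by (simp add: conv_zero finsupp_single w)
  next
    case (add m r' q)
    note r' = \<open>r' \<in> carrier R\<close>
    have "conv (conv (single R n r) (single R m r')) w = conv (single R n r) (conv (single R m r') w)"
      using w
    proof (induction rule: finsupp_induct)
      case zero
      show ?case using r r' by (simp add: conv_zero finsupp_single conv_finsupp)
    next
      case (add l r'' w)
      have "t [^] excess (n + m) l \<otimes> (t [^] excess n m \<otimes> (r \<otimes> r') \<otimes> r'') =
          t [^] (excess n m + excess (n + m) l) \<otimes> (r \<otimes> (r' \<otimes> r''))"
        using r r' add t by (simp add: nat_pow_mult[symmetric] m_ac)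
      also have "\<dots> = t [^] (excess m l + excess n (m + l)) \<otimes> (r \<otimes> (r' \<otimes> r''))"
        by (simp only: excess_assoc)
      also have "\<dots> = t [^] excess n (m + l) \<otimes> (r \<otimes> (t [^] excess m l \<otimes> (r' \<otimes> r'')))"
        using r r' add t by (simp add: nat_pow_mult[symmetric] m_ac)
      finally show ?case using r r' add t
        by (simp add: conv_add_right finsupp_single conv_finsupp conv_single_single add.assoc)
    qed
    then show ?case using add r w
      by (simp add: conv_add_left conv_add_right finsupp_single conv_finsupp)
  qed
  then show ?case using add q w
    by (simp add: conv_add_left conv_add_right finsupp_single conv_finsupp)
qed

lemma conv_one: "p \<in> finsupp R \<Longrightarrow> conv (single R 0 \<one>) p = p"
  using t by (subst conv_single) (auto simp: finsuppD(1))

end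

lemma hyp_algebra_simps [simp]:
  "carrier (hyp_algebra R t) = finsupp R"
  "monoid.mult (hyp_algebra R t) = hyp_mult R t"
  "one (hyp_algebra R t) = single R 0 \<one>\<^bsub>R\<^esub>"
  "zero (hyp_algebra R t) = (\<lambda>n. \<zero>\<^bsub>R\<^esub>)"
  "add (hyp_algebra R t) = (\<lambda>p q n. p n \<oplus>\<^bsub>R\<^esub> q n)"
  "smult (hyp_algebra R t) = (\<lambda>c p n. c \<odot>\<^bsub>R\<^esub> p n)"
  by (simp_all add: hyp_algebra_def)

lemma hyp_algebra_algebra:
  assumes R: "algebra k R" and t: "t \<in> carrier R"
  shows "algebra k (hyp_algebra R t)"
proof -
  interpret algebra k R by fact
  interpret hyperbola R t by unfold_locales (rule t)
  have sm: "(\<lambda>n. c \<odot>\<^bsub>R\<^esub> p n) \<in> finsupp R" if "c \<in> carrier k" "p \<in> finsupp R" for c p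
    by (rule finsupp_mono[OF that(2)]) (use that in \<open>auto simp: finsuppD(1)\<close>)
  have conv_sm: "hyp_mult R t (\<lambda>n. c \<odot>\<^bsub>R\<^esub> p n) q = (\<lambda>n. c \<odot>\<^bsub>R\<^esub> hyp_mult R t p q n)"
    if c: "c \<in> carrier k" and p: "p \<in> finsupp R" and q: "q \<in> finsupp R" for c p q
  proof
    fix s
    let ?d = "\<lambda>n. t [^]\<^bsub>R\<^esub> excess n (s - n) \<otimes>\<^bsub>R\<^esub> (p n \<otimes>\<^bsub>R\<^esub> q (s - n))"
    have mult_sm: "x \<otimes>\<^bsub>R\<^esub> (c \<odot>\<^bsub>R\<^esub> y) = c \<odot>\<^bsub>R\<^esub> (x \<otimes>\<^bsub>R\<^esub> y)" if "x \<in> carrier R" "y \<in> carrier R" for x y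
      using that c smult_assoc2[OF c that(2,1)] by (simp add: m_comm)
    have cs: "c \<odot>\<^bsub>R\<^esub> x = (c \<odot>\<^bsub>R\<^esub> \<one>\<^bsub>R\<^esub>) \<otimes>\<^bsub>R\<^esub> x" if "x \<in> carrier R" for x
      using that c by (simp add: smult_assoc2)
    have "hyp_mult R t (\<lambda>n. c \<odot>\<^bsub>R\<^esub> p n) q s = fsum R (\<lambda>n. (c \<odot>\<^bsub>R\<^esub> \<one>\<^bsub>R\<^esub>) \<otimes>\<^bsub>R\<^esub> ?d n)"
      unfolding hyp_mult_def using p q t c
      by (simp add: cs[symmetric] smult_assoc2 mult_sm finsuppD(1))
    also have "\<dots> = (c \<odot>\<^bsub>R\<^esub> \<one>\<^bsub>R\<^esub>) \<otimes>\<^bsub>R\<^esub> hyp_mult R t p q s"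
      unfolding hyp_mult_def by (rule fsum_mult_left[OF summand_finsupp]) (use p q c in auto)
    also have "\<dots> = c \<odot>\<^bsub>R\<^esub> hyp_mult R t p q s"
      using p q by (simp add: cs[symmetric] conv_carrier)
    finally show "hyp_mult R t (\<lambda>n. c \<odot>\<^bsub>R\<^esub> p n) q s = c \<odot>\<^bsub>R\<^esub> hyp_mult R t p q s" .
  qed
  show ?thesis
  proof (rule algebraI)
    show "cring k" by (rule R_cring)
    show "cring (hyp_algebra R t)"
    proof (rule cringI)
      show "abelian_group (hyp_algebra R t)"
      proof (rule abelian_groupI)
        fix p assume "p \<in> carrier (hyp_algebra R t)"
        then have p: "p \<in> finsupp R" by simp
        have "(\<lambda>n. \<ominus>\<^bsub>R\<^esub> p n) \<in> finsupp R"
          by (rule finsupp_mono[OF p]) (use p in \<open>auto simp: finsuppD(1)\<close>)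
        then show "\<exists>q\<in>carrier (hyp_algebra R t). q \<oplus>\<^bsub>hyp_algebra R t\<^esub> p = \<zero>\<^bsub>hyp_algebra R t\<^esub>"
          using p by (intro bexI[of _ "\<lambda>n. \<ominus>\<^bsub>R\<^esub> p n"]) (auto simp: M.l_neg finsuppD(1))
      qed (auto simp: M.a_ac finsuppD(1) finsupp_add finsupp_zero)
      show "Group.comm_monoid (hyp_algebra R t)"
        by (rule comm_monoidI)
          (auto simp: conv_finsupp finsupp_single conv_assoc conv_one intro: conv_comm)
    qed (auto simp: conv_add_left)
  qed (auto simp: sm conv_sm smult_l_distr smult_r_distr smult_assoc1 finsuppD(1))
qed

text \<open>
  A \<open>T\<close>-valued point \<open>(u, v)\<close> of the hyperbola \<open>U V = t\<close> over \<open>R\<close>.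
\<close>

locale hyp_evaluation = ring_hom_cring R T g for R (structure) and T (structure) and g +
  fixes t u v
  assumes t: "t \<in> carrier R" and u: "u \<in> carrier T" and v: "v \<in> carrier T"
    and uv: "u \<otimes>\<^bsub>T\<^esub> v = g t"
begin

sublocale hyperbola R t by unfold_locales (rule t)

sublocale ring_hom_ring R T g by unfold_locales (rule homh)

abbreviation "ev \<equiv> hyp_eval T g u v"

lemma eval_summand_finsupp:
  assumes "p \<in> finsupp R"
  shows "(\<lambda>n. g (p n) \<otimes>\<^bsub>T\<^esub> hyp_pow T u v n) \<in> finsupp T"
  by (rule finsupp_mono[OF assms]) (use assms u v in \<open>auto simp: finsuppD(1)\<close>)

lemma eval_closed: "p \<in> finsupp R \<Longrightarrow> ev p \<in> carrier T"
  unfolding hyp_eval_def by (rule S.fsum_closed[OF eval_summand_finsupp])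

lemma eval_add:
  assumes "p \<in> finsupp R" "q \<in> finsupp R"
  shows "ev (\<lambda>n. p n \<oplus> q n) = ev p \<oplus>\<^bsub>T\<^esub> ev q"
proof -
  have "(\<lambda>n. g (p n \<oplus> q n) \<otimes>\<^bsub>T\<^esub> hyp_pow T u v n) =
      (\<lambda>n. g (p n) \<otimes>\<^bsub>T\<^esub> hyp_pow T u v n \<oplus>\<^bsub>T\<^esub> g (q n) \<otimes>\<^bsub>T\<^esub> hyp_pow T u v n)"
    using assms u v by (auto simp: finsuppD(1) S.l_distr)
  then show ?thesis
    unfolding hyp_eval_def using S.fsum_add[OF eval_summand_finsupp eval_summand_finsupp] assms by simp
qed

lemma eval_zero: "ev (\<lambda>n. \<zero>) = \<zero>\<^bsub>T\<^esub>"
  using u v by (simp add: hyp_eval_def S.fsum_zero)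

lemma eval_single:
  assumes "r \<in> carrier R"
  shows "ev (single R n r) = g r \<otimes>\<^bsub>T\<^esub> hyp_pow T u v n"
  unfolding hyp_eval_def
  by (subst S.fsum_one_term[of _ n]) (use assms u v in \<open>auto simp: single_def\<close>)

lemma eval_mult:
  assumes p: "p \<in> finsupp R" and q: "q \<in> finsupp R"
  shows "ev (conv p q) = ev p \<otimes>\<^bsub>T\<^esub> ev q"
  using p
proof (induction rule: R.finsupp_induct)
  case zero
  show ?case by (simp add: conv_zero q eval_zero eval_closed)
next
  case (add n r p)
  note r = \<open>r \<in> carrier R\<close>
  have "ev (conv (single R n r) q) = ev (single R n r) \<otimes>\<^bsub>T\<^esub> ev q"
    using q
  proof (induction rule: R.finsupp_induct)
    case zero
    show ?case using r by (simp add: conv_zero R.finsupp_single eval_zero eval_closed)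
  next
    case (add m r' q)
    have "g (t [^] excess n m \<otimes> (r \<otimes> r')) \<otimes>\<^bsub>T\<^esub> hyp_pow T u v (n + m) =
        g r \<otimes>\<^bsub>T\<^esub> g r' \<otimes>\<^bsub>T\<^esub> (g t [^]\<^bsub>T\<^esub> excess n m \<otimes>\<^bsub>T\<^esub> hyp_pow T u v (n + m))"
      using r add t u v by (simp add: S.m_ac hom_nat_pow)
    also have "\<dots> = (g r \<otimes>\<^bsub>T\<^esub> hyp_pow T u v n) \<otimes>\<^bsub>T\<^esub> (g r' \<otimes>\<^bsub>T\<^esub> hyp_pow T u v m)"
      unfolding uv[symmetric] S.hyp_pow_mult[OF u v, symmetric]
      using r add u v by (simp add: S.m_ac)
    finally show ?case using r add t u v
      by (simp add: conv_add_right R.finsupp_single conv_single_single conv_finsupp eval_add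
          eval_single eval_closed S.r_distr)
  qed
  then show ?case using r add q
    by (simp add: conv_add_left R.finsupp_single conv_finsupp eval_add eval_closed S.l_distr)
qed

end

text \<open>
  The map \<open>g'\<close> is arbitrary outside \<open>R\<close>, so that \<open>h \<circ> g\<close> and its extensional version are both covered.
\<close>

lemma (in hyp_evaluation) hom_eval:
  assumes h: "ring_hom_ring T S h" and p: "p \<in> finsupp R"
    and g': "\<And>r. r \<in> carrier R \<Longrightarrow> h (g r) = g' r"
  shows "h (ev p) = hyp_eval S g' (h u) (h v) p"
proof -
  interpret h: ring_hom_ring T S h by fact
  have "h (g (p n) \<otimes>\<^bsub>T\<^esub> hyp_pow T u v n) = g' (p n) \<otimes>\<^bsub>S\<^esub> hyp_pow S (h u) (h v) n" for n
    using u v p by (simp add: hyp_pow_hom[OF h, symmetric] finsuppD(1) g'[symmetric])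
  then show ?thesis
    unfolding hyp_eval_def using h.hom_fsum[OF eval_summand_finsupp[OF p]] by simp
qed

text \<open>
  Multiplying the point \<open>(u, v)\<close> by \<open>(r, r')\<close> coordinatewise can be absorbed into the coefficients:
  the one of degree \<open>n\<close> is multiplied by \<open>r ^ n\<close> if \<open>n \<ge> 0\<close> and by \<open>r' ^ (- n)\<close> otherwise.
\<close>

lemma (in hyp_evaluation) eval_scale:
  assumes "r \<in> carrier R" "r' \<in> carrier R" "p \<in> finsupp R"
  shows "hyp_eval T g (u \<otimes>\<^bsub>T\<^esub> g r) (v \<otimes>\<^bsub>T\<^esub> g r') p = ev (\<lambda>n. hyp_pow R r r' n \<otimes> p n)"
proof -
  have hom: "ring_hom_ring R T g" by unfold_locales
  have "g (p n) \<otimes>\<^bsub>T\<^esub> hyp_pow T (u \<otimes>\<^bsub>T\<^esub> g r) (v \<otimes>\<^bsub>T\<^esub> g r') n =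
      g (hyp_pow R r r' n \<otimes> p n) \<otimes>\<^bsub>T\<^esub> hyp_pow T u v n" for n
    unfolding S.hyp_pow_distrib[OF u v hom_closed[OF assms(1)] hom_closed[OF assms(2)]]
    using assms u v by (simp add: finsuppD(1) S.m_ac hyp_pow_hom[OF hom])
  then show ?thesis by (simp add: hyp_eval_def)
qed

lemma khom_hyp_evaluation:
  assumes "R \<in> kalgs k" "T \<in> kalgs k" "g \<in> khom k R T"
    and "t \<in> carrier R" "u \<in> carrier T" "v \<in> carrier T" "u \<otimes>\<^bsub>T\<^esub> v = g t"
  shows "hyp_evaluation R T g t u v"
  using khom_ring_hom_cring[OF assms(1-3)] assms(4-)
  by (simp add: hyp_evaluation_def hyp_evaluation_axioms_def)

text \<open>
  A copy \<open>B\<close> of the hyperbola algebra inside the universe, described by its freeness over \<open>R\<close>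
  (\<open>bij\<close>) and by its universal property (\<open>extend\<close>): \<open>(U, V)\<close> is the generic point of the base
  change of the hyperbola family along \<open>t\<close>.
\<close>

locale universal_hyperbola =
  fixes k :: "'u ring" and R :: "'u alg" and t :: 'u and B :: "'u alg" and \<iota> U V
  assumes R: "R \<in> kalgs k" and B: "B \<in> kalgs k" and t: "t \<in> carrier R"
    and \<iota>: "\<iota> \<in> khom k R B" and U: "U \<in> carrier B" and V: "V \<in> carrier B"
    and UV: "U \<otimes>\<^bsub>B\<^esub> V = \<iota> t"
    and bij: "bij_betw (hyp_eval B \<iota> U V) (finsupp R) (carrier B)"
    and extend: "\<And>T g u v. T \<in> kalgs k \<Longrightarrow> g \<in> khom k R T \<Longrightarrow> u \<in> carrier T \<Longrightarrow> v \<in> carrier T \<Longrightarrow>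
      u \<otimes>\<^bsub>T\<^esub> v = g t \<Longrightarrow>
      \<exists>h\<in>khom k B T. h U = u \<and> h V = v \<and> compose (carrier R) h \<iota> = g"

lemma (in universal_hyperbola) extend_eval:
  assumes "T \<in> kalgs k" "h \<in> khom k B T" "p \<in> finsupp R"
  shows "h (hyp_eval B \<iota> U V p) = hyp_eval T (compose (carrier R) h \<iota>) (h U) (h V) p"
proof -
  interpret hyp_evaluation R B \<iota> t U V
    using khom_hyp_evaluation[OF R B \<iota> t U V UV] .
  show ?thesis
    by (rule hom_eval[OF khom_ring_hom_ring[OF B assms(1,2)] assms(3)]) (simp add: compose_eq)
qed

text \<open>
  The finitely supported families are generated additively by the families with a single entry,
  of which there are no more than pairs of an integer and an element of the universe.
\<close>

lemma finsupp_inj_universe: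
  fixes R :: "'u alg"
  assumes inf: "infinite (UNIV :: 'u set)" and R: "ring R"
  shows "\<exists>e :: (int \<Rightarrow> 'u) \<Rightarrow> 'u. inj_on e (finsupp R)"
proof -
  interpret ring R by fact
  obtain c :: "nat \<Rightarrow> 'u" where c: "inj c"
    using inf infinite_countable_subset by blast
  obtain b :: "'u \<times> 'u \<Rightarrow> 'u" where b: "inj b"
    using card_of_Times_same_infinite[OF inf] ordIso_imp_ordLeq
    by (metis UNIV_Times_UNIV card_of_ordLeq)
  \<comment> \<open>The pair of \<open>nat n\<close> and \<open>nat (- n)\<close> determines the integer \<open>n\<close>.\<close>
  define J where "J = (\<lambda>(n :: int, r). b (b (c (nat n), c (nat (- n))), r))"
  have J: "inj J"
    by (rule injI) (auto simp: J_def inj_eq[OF b] inj_eq[OF c])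
  define H where "H = {single R n r | n r. r \<in> carrier R}"
  have "single R n r \<in> range (\<lambda>x. case the_inv_into UNIV J x of (n, r) \<Rightarrow> single R n r)" for n r
    by (rule range_eqI[of _ _ "J (n, r)"]) (simp add: the_inv_f_f[OF J])
  then have "H \<subseteq> range (\<lambda>x. case the_inv_into UNIV J x of (n, r) \<Rightarrow> single R n r)"
    by (auto simp: H_def)
  from generate_ring_inj_universe[OF inf this, of "hyp_algebra R \<one>\<^bsub>R\<^esub>"]
  obtain e :: "(int \<Rightarrow> 'u) \<Rightarrow> 'u" where e: "inj_on e (generate_ring (hyp_algebra R \<one>\<^bsub>R\<^esub>) H)" by blast
  have "p \<in> generate_ring (hyp_algebra R \<one>\<^bsub>R\<^esub>) H" if "p \<in> finsupp R" for p
    using that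
  proof (induction rule: finsupp_induct)
    case zero
    have "(\<lambda>n. \<zero>\<^bsub>R\<^esub>) = single R 0 \<zero>\<^bsub>R\<^esub>" by (auto simp: single_def)
    then show ?case by (intro generate_ring.incl) (auto simp: H_def)
  next
    case (add n r q)
    then have "single R n r \<oplus>\<^bsub>hyp_algebra R \<one>\<^bsub>R\<^esub>\<^esub> q \<in> generate_ring (hyp_algebra R \<one>\<^bsub>R\<^esub>) H"
      by (intro generate_ring.eng_add generate_ring.incl[of "single R n r"]) (auto simp: H_def)
    then show ?case by simp
  qed
  then show ?thesis using e inj_on_subset by blast
qed

text \<open>
  Evaluating a family at the point \<open>(U, V)\<close> of the concrete algebra \<open>hyp_algebra R t\<close> itself gives the
  family back (\<open>eval_id\<close>).  This is the freeness, and \<open>hyp_eval\<close> at a point \<open>(u, v)\<close> provides the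
  extension required by the universal property; both carry over to a copy in the universe.
\<close>

lemma universal_hyperbola_exists:
  fixes k :: "'u ring"
  assumes inf: "infinite (UNIV :: 'u set)" and R: "R \<in> kalgs k" and t: "t \<in> carrier R"
  obtains B \<iota> U V where "universal_hyperbola k R t B \<iota> U V"
proof -
  have alg_R: "algebra k R" using R by (simp add: kalgs_def)
  interpret algebra k R by (rule alg_R)
  interpret hyperbola R t by unfold_locales (rule t)
  let ?M = "hyp_algebra R t"
  obtain e :: "(int \<Rightarrow> 'u) \<Rightarrow> 'u" where e: "inj_on e (finsupp R)"
    using finsupp_inj_universe[OF inf ring_axioms] by blast
  then have eM: "inj_on e (carrier ?M)" by simp
  note alg = hyp_algebra_algebra[OF alg_R t]
  define B where "B = transport e ?M"
  note ts = transport_simps[OF eM, folded B_def, simplified]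
  have B: "B \<in> kalgs k" using transport_algebra[OF alg eM] by (simp add: B_def kalgs_def)
  define \<iota>' where "\<iota>' = single R 0"
  define \<iota> where "\<iota> = restrict (\<lambda>r. e (\<iota>' r)) (carrier R)"
  let ?U = "single R 1 \<one>\<^bsub>R\<^esub>" and ?V = "single R (- 1) \<one>\<^bsub>R\<^esub>"
  interpret MR: cring ?M using alg by (rule algebra.M_cring)
  have \<iota>'_hom: "\<iota>' \<in> ring_hom R ?M"
    by (rule ring_hom_memI) (auto simp: \<iota>'_def finsupp_single conv_single_single, auto simp: single_def)
  have UV': "?U \<otimes>\<^bsub>?M\<^esub> ?V = \<iota>' t"
    using t by (simp add: conv_single_single \<iota>'_def excess_def)
  interpret evM: hyp_evaluation R ?M \<iota>' t ?U ?V
    by (intro hyp_evaluation.intro ring_hom_cring.intro ring_hom_cring_axioms.intro hyp_evaluation_axioms.intro)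
      (use UV' t \<iota>'_hom in \<open>simp_all add: finsupp_single MR.is_cring is_cring\<close>)
  have pows: "?U [^]\<^bsub>?M\<^esub> i = single R (int i) \<one>\<^bsub>R\<^esub>" "?V [^]\<^bsub>?M\<^esub> i = single R (- int i) \<one>\<^bsub>R\<^esub>"
    for i :: nat
    by (induction i) (simp_all add: conv_single_single excess_def add.commute)
  have "hyp_pow ?M ?U ?V n = single R n \<one>\<^bsub>R\<^esub>" for n
    by (cases "0 \<le> n") (simp_all only: hyp_pow_def pows if_True if_False, simp_all)
  then have eval_single: "evM.ev (single R n r) = single R n r" if "r \<in> carrier R" for n r
    unfolding evM.eval_single[OF that] using that by (simp add: conv_single_single \<iota>'_def)
  have eval_id: "evM.ev p = p" if "p \<in> finsupp R" for p
    using that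
  proof (induction rule: finsupp_induct)
    case zero show ?case using evM.eval_zero by simp
  next
    case (add n r q)
    then show ?case using evM.eval_add[OF finsupp_single[OF add(1)] add(2)] by (simp add: eval_single)
  qed
  have e_hom: "ring_hom_ring ?M B e"
    using transport_hom[OF eM] kalgs_cring[OF B] MR.ring_axioms
    by (intro ring_hom_ringI2) (auto simp: B_def cring_def)
  have enc: "hyp_eval B \<iota> (e ?U) (e ?V) p = e p" if "p \<in> finsupp R" for p
    using evM.hom_eval[OF e_hom that, of \<iota>] eval_id[OF that] by (simp add: \<iota>_def)
  have \<iota>: "\<iota> \<in> khom k R B"
  proof (rule khomI)
    interpret eh: ring_hom_ring ?M B e by (rule e_hom)
    show "\<iota> \<in> ring_hom R B"
      using ring_hom_trans[OF \<iota>'_hom eh.homh]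
      by (auto simp: \<iota>_def ring_hom_def Pi_iff)
    fix c x assume "c \<in> carrier k" "x \<in> carrier R"
    moreover have "\<iota>' (c \<odot>\<^bsub>R\<^esub> x) = (\<lambda>n. c \<odot>\<^bsub>R\<^esub> \<iota>' x n)" if "c \<in> carrier k" "x \<in> carrier R"
      using that by (auto simp: \<iota>'_def single_def)
    ultimately show "\<iota> (c \<odot>\<^bsub>R\<^esub> x) = c \<odot>\<^bsub>B\<^esub> \<iota> x"
      using ts(6)[of "\<iota>' x" c] by (simp add: \<iota>_def \<iota>'_def finsupp_single)
  qed (simp add: \<iota>_def)
  have "universal_hyperbola k R t B \<iota> (e ?U) (e ?V)"
  proof
    show "e ?U \<in> carrier B" "e ?V \<in> carrier B" by (simp_all add: ts finsupp_single)
    show "e ?U \<otimes>\<^bsub>B\<^esub> e ?V = \<iota> t"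
      using UV' t by (simp add: ts finsupp_single \<iota>_def)
    have "bij_betw e (finsupp R) (carrier B)" using e by (simp add: bij_betw_def ts)
    then show "bij_betw (hyp_eval B \<iota> (e ?U) (e ?V)) (finsupp R) (carrier B)"
      by (subst bij_betw_cong[of _ _ e]) (simp_all add: enc)
    fix T g u v
    assume T: "T \<in> kalgs k" "g \<in> khom k R T" "u \<in> carrier T" "v \<in> carrier T" "u \<otimes>\<^bsub>T\<^esub> v = g t"
    interpret et: hyp_evaluation R T g t u v using khom_hyp_evaluation[OF R T(1,2) t T(3-)] .
    interpret TA: algebra k T using T by (simp add: kalgs_def)
    define h where "h = restrict (\<lambda>x. et.ev (inv_into (finsupp R) e x)) (carrier B)"
    have he: "h (e p) = et.ev p" if "p \<in> finsupp R" for p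
      using that e by (simp add: h_def ts)
    have "h \<in> khom k B T"
    proof (rule khomI)
      show "h \<in> ring_hom B T"
        using T by (intro ring_hom_memI)
          (auto simp: ts he finsupp_single conv_finsupp finsupp_add et.eval_closed et.eval_mult
            et.eval_add et.eval_single hyp_pow_def)
      fix c x assume c: "c \<in> carrier k" and "x \<in> carrier B"
      then obtain p where p: "x = e p" "p \<in> finsupp R" by (auto simp: ts)
      have cp: "(\<lambda>n. c \<odot>\<^bsub>R\<^esub> p n) \<in> finsupp R"
        by (rule finsupp_mono[OF p(2)]) (use c p in \<open>auto simp: finsuppD(1)\<close>)
      have cm: "c \<odot>\<^bsub>T\<^esub> y = (c \<odot>\<^bsub>T\<^esub> \<one>\<^bsub>T\<^esub>) \<otimes>\<^bsub>T\<^esub> y" if "y \<in> carrier T" for y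
        using that c by (simp add: TA.smult_assoc2)
      have "et.ev (\<lambda>n. c \<odot>\<^bsub>R\<^esub> p n) =
          fsum T (\<lambda>n. (c \<odot>\<^bsub>T\<^esub> \<one>\<^bsub>T\<^esub>) \<otimes>\<^bsub>T\<^esub> (g (p n) \<otimes>\<^bsub>T\<^esub> hyp_pow T u v n))"
        unfolding hyp_eval_def using T c p
        by (simp add: cm[symmetric] TA.smult_assoc2 khom_smult[OF T(2)] finsuppD(1))
      also have "\<dots> = c \<odot>\<^bsub>T\<^esub> et.ev p"
        using et.S.fsum_mult_left[OF et.eval_summand_finsupp[OF p(2)]] c et.eval_closed[OF p(2)]
        by (simp add: hyp_eval_def cm[symmetric])
      finally show "h (c \<odot>\<^bsub>B\<^esub> x) = c \<odot>\<^bsub>T\<^esub> h x"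
        using p cp by (simp add: ts he)
    qed (simp add: h_def)
    moreover have "h (e ?U) = u" "h (e ?V) = v"
      using T by (simp_all add: he finsupp_single et.eval_single hyp_pow_def)
    moreover have "compose (carrier R) h \<iota> = g"
    proof (rule khom_ext[OF khom_compose[OF \<iota> \<open>h \<in> khom k B T\<close> R] T(2)])
      fix r assume "r \<in> carrier R"
      then show "compose (carrier R) h \<iota> r = g r"
        by (simp add: compose_eq \<iota>_def \<iota>'_def he finsupp_single et.eval_single hyp_pow_def)
    qed
    ultimately show "\<exists>h\<in>khom k B T. h (e ?U) = u \<and> h (e ?V) = v \<and> compose (carrier R) h \<iota> = g"
      by blast
  qed (use R B t \<iota> in auto)
  then show ?thesis by (rule that)
qed

section \<open>The grading defined by an action\<close>

locale affine_Gm_scheme =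
  fixes k :: "'u ring" and Z :: "('u, 'z) func" and a :: "'u alg \<Rightarrow> 'u \<times> 'z \<Rightarrow> 'z"
    and A :: "'u alg" and \<zeta> :: "'u alg \<Rightarrow> ('u \<Rightarrow> 'u) \<Rightarrow> 'z"
  assumes inf: "infinite (UNIV :: 'u set)"
    and Z: "kfunctor k Z"
    and A: "A \<in> kalgs k"
    and iso: "kiso k (Spec k A) Z \<zeta>"
    and act: "Gm_action k Z a"
begin

text \<open>
  The evaluation of functions at a point: \<open>coord R z x\<close> is the value of \<open>x \<in> A\<close> at \<open>z \<in> Z(R)\<close>.
\<close>

definition coord :: "'u alg \<Rightarrow> 'z \<Rightarrow> 'u \<Rightarrow> 'u" where
  "coord R = inv_into (khom k A R) (\<zeta> R)"

lemma \<zeta>_bij: "R \<in> kalgs k \<Longrightarrow> bij_betw (\<zeta> R) (khom k A R) (points Z R)"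
  using iso by (simp add: kiso_def Spec_def)

lemma coord_khom:
  assumes "R \<in> kalgs k" "z \<in> points Z R"
  shows "coord R z \<in> khom k A R"
  using \<zeta>_bij[OF assms(1)] assms(2) unfolding coord_def
  by (metis bij_betw_imp_surj_on inv_into_into)

lemma coord_\<zeta>:
  assumes "R \<in> kalgs k" "y \<in> khom k A R"
  shows "\<zeta> R y \<in> points Z R" "coord R (\<zeta> R y) = y"
  using \<zeta>_bij[OF assms(1)] assms(2) unfolding coord_def
  by (auto simp: bij_betw_def inv_into_f_f)

lemma \<zeta>_coord:
  assumes "R \<in> kalgs k" "z \<in> points Z R"
  shows "\<zeta> R (coord R z) = z"
  using \<zeta>_bij[OF assms(1)] assms(2) unfolding coord_def
  by (simp add: bij_betw_def f_inv_into_f)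

lemma point_eqI:
  assumes "R \<in> kalgs k" "z \<in> points Z R" "z' \<in> points Z R"
    and "\<And>x. x \<in> carrier A \<Longrightarrow> coord R z x = coord R z' x"
  shows "z = z'"
  using khom_ext[OF coord_khom coord_khom, OF assms(1,2,1,3,4)] \<zeta>_coord[OF assms(1)] assms(2,3)
  by metis

lemma coord_natural:
  assumes R: "R \<in> kalgs k" and T: "T \<in> kalgs k" and h: "h \<in> khom k R T" and z: "z \<in> points Z R"
  shows "coord T (on_hom Z R T h z) = compose (carrier A) h (coord R z)"
proof -
  let ?y = "coord R z"
  have y: "?y \<in> khom k A R" by (rule coord_khom[OF R z])
  have "\<zeta> \<in> kmaps k (Spec k A) Z" using iso by (simp add: kiso_def)
  then have "\<zeta> T (compose (carrier A) h ?y) = on_hom Z R T h (\<zeta> R ?y)"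
    using R T h y by (auto simp: kmaps_def Spec_def)
  then show ?thesis
    using coord_\<zeta>(2)[OF T khom_compose[OF y h A]] \<zeta>_coord[OF R z] by simp
qed

lemma act_closed:
  assumes "R \<in> kalgs k" "l \<in> Units R" "z \<in> points Z R"
  shows "a R (l, z) \<in> points Z R"
proof -
  have "a \<in> (\<Pi>\<^sub>E R\<in>kalgs k. points (Gm \<times>\<^sub>k Z) R \<rightarrow>\<^sub>E points Z R)"
    using act by (simp add: Gm_action_def kmaps_def)
  then have "a R \<in> points (Gm \<times>\<^sub>k Z) R \<rightarrow>\<^sub>E points Z R" using assms(1) by (rule PiE_mem)
  then show ?thesis by (rule PiE_mem) (use assms in \<open>simp add: prod_func_def Gm_def\<close>)
qed

lemma act_natural:
  assumes "R \<in> kalgs k" "T \<in> kalgs k" "h \<in> khom k R T" "l \<in> Units R" "z \<in> points Z R"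
  shows "a T (h l, on_hom Z R T h z) = on_hom Z R T h (a R (l, z))"
  using act assms by (auto simp: Gm_action_def kmaps_def prod_func_def Gm_def)

lemma act_one: "R \<in> kalgs k \<Longrightarrow> z \<in> points Z R \<Longrightarrow> a R (\<one>\<^bsub>R\<^esub>, z) = z"
  using act by (auto simp: Gm_action_def)

lemma act_mult:
  "R \<in> kalgs k \<Longrightarrow> z \<in> points Z R \<Longrightarrow> l \<in> Units R \<Longrightarrow> m \<in> Units R \<Longrightarrow>
    a R (l \<otimes>\<^bsub>R\<^esub> m, z) = a R (l, a R (m, z))"
  using act by (auto simp: Gm_action_def)

text \<open>
  Let the generic unit \<open>U\<close> of the Laurent polynomial ring over \<open>A\<close> act on the generic point of \<open>Z\<close>,
  and let \<open>pr n x\<close> be the coefficient of \<open>U ^ n\<close> in the value of \<open>x\<close> at the resulting point.  Every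
  unit acting on any point is a specialisation of this situation.
\<close>

lemma grading_exists:
  "\<exists>pr :: int \<Rightarrow> 'u \<Rightarrow> 'u. (\<forall>x\<in>carrier A. (\<lambda>n. pr n x) \<in> finsupp A) \<and>
     (\<forall>R\<in>kalgs k. \<forall>z\<in>points Z R. \<forall>l\<in>carrier R. \<forall>l'\<in>carrier R. l \<otimes>\<^bsub>R\<^esub> l' = \<one>\<^bsub>R\<^esub> \<longrightarrow>
        (\<forall>x\<in>carrier A. coord R (a R (l, z)) x = hyp_eval R (coord R z) l l' (\<lambda>n. pr n x)))"
proof -
  interpret A: cring A by (rule kalgs_cring[OF A])
  obtain L \<iota> U V where "universal_hyperbola k A \<one>\<^bsub>A\<^esub> L \<iota> U V"
    using universal_hyperbola_exists[OF inf A A.one_closed] by blast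
  then interpret L: universal_hyperbola k A "\<one>\<^bsub>A\<^esub>" L \<iota> U V .
  interpret Lr: cring L by (rule kalgs_cring[OF L.B])
  have U: "U \<in> Units L"
    using Lr.unit_of_inverse[OF L.U L.V] L.UV khom_one[OF L.\<iota>] by simp
  define z0 where "z0 = \<zeta> L \<iota>"
  note z0 = coord_\<zeta>[OF L.B L.\<iota>, folded z0_def]
  define \<delta> where "\<delta> = coord L (a L (U, z0))"
  have \<delta>: "\<delta> \<in> khom k A L" unfolding \<delta>_def by (rule coord_khom[OF L.B act_closed[OF L.B U z0(1)]])
  define pr where "pr = (\<lambda>n x. inv_into (finsupp A) (hyp_eval L \<iota> U V) (\<delta> x) n)"
  have pr: "(\<lambda>n. pr n x) \<in> finsupp A" "hyp_eval L \<iota> U V (\<lambda>n. pr n x) = \<delta> x" if "x \<in> carrier A" for x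
    using L.bij khom_closed[OF \<delta> that] unfolding pr_def bij_betw_def
    by (auto intro: inv_into_into simp: f_inv_into_f)
  have "coord R (a R (l, z)) x = hyp_eval R (coord R z) l l' (\<lambda>n. pr n x)"
    if R: "R \<in> kalgs k" and z: "z \<in> points Z R"
      and l: "l \<in> carrier R" "l' \<in> carrier R" "l \<otimes>\<^bsub>R\<^esub> l' = \<one>\<^bsub>R\<^esub>" and x: "x \<in> carrier A"
    for R z l l' x
  proof -
    note c = coord_khom[OF R z]
    obtain h where h: "h \<in> khom k L R" "h U = l" "h V = l'" "compose (carrier A) h \<iota> = coord R z"
      using L.extend[OF R c l(1,2)] l(3) khom_one[OF c] by auto
    have "on_hom Z L R h z0 = z"
      by (rule point_eqI[OF R kfunctor_closed[OF Z L.B R h(1) z0(1)] z])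
        (simp add: coord_natural[OF L.B R h(1) z0(1)] z0(2) h(4))
    then have "coord R (a R (l, z)) = compose (carrier A) h \<delta>"
      using act_natural[OF L.B R h(1) U z0(1)] h(2)
        coord_natural[OF L.B R h(1) act_closed[OF L.B U z0(1)]]
      by (simp add: \<delta>_def)
    then show ?thesis
      using x L.extend_eval[OF R h(1) pr(1)[OF x]] pr(2)[OF x] h by (simp add: compose_eq)
  qed
  then show ?thesis using pr(1) by blast
qed

text \<open>
  The homogeneous component of degree \<open>n\<close> of a function.
\<close>

definition pr :: "int \<Rightarrow> 'u \<Rightarrow> 'u" where
  "pr = (SOME pr. (\<forall>x\<in>carrier A. (\<lambda>n. pr n x) \<in> finsupp A) \<and>
     (\<forall>R\<in>kalgs k. \<forall>z\<in>points Z R. \<forall>l\<in>carrier R. \<forall>l'\<in>carrier R. l \<otimes>\<^bsub>R\<^esub> l' = \<one>\<^bsub>R\<^esub> \<longrightarrow>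
        (\<forall>x\<in>carrier A. coord R (a R (l, z)) x = hyp_eval R (coord R z) l l' (\<lambda>n. pr n x))))"

lemma pr_finsupp: "x \<in> carrier A \<Longrightarrow> (\<lambda>n. pr n x) \<in> finsupp A"
  using someI_ex[OF grading_exists, folded pr_def] by blast

lemma pr_closed: "x \<in> carrier A \<Longrightarrow> pr n x \<in> carrier A"
  using finsuppD(1)[OF pr_finsupp] .

lemma coord_act:
  assumes "R \<in> kalgs k" "z \<in> points Z R" "l \<in> carrier R" "l' \<in> carrier R" "l \<otimes>\<^bsub>R\<^esub> l' = \<one>\<^bsub>R\<^esub>"
    and "x \<in> carrier A"
  shows "coord R (a R (l, z)) x = hyp_eval R (coord R z) l l' (\<lambda>n. pr n x)"
  using someI_ex[OF grading_exists, folded pr_def] assms by blast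

lemma coord_pr_finsupp:
  assumes "R \<in> kalgs k" "z \<in> points Z R" "x \<in> carrier A"
  shows "(\<lambda>n. coord R z (pr n x)) \<in> finsupp R"
  by (rule finsupp_mono[OF pr_finsupp[OF assms(3)]])
    (use assms coord_khom in \<open>auto intro: khom_closed pr_closed simp: khom_zero[OF A]\<close>)

text \<open>
  The unit \<open>1\<close> acts trivially, so a function is the sum of its components.
\<close>

lemma fsum_pr:
  assumes R: "R \<in> kalgs k" and z: "z \<in> points Z R" and x: "x \<in> carrier A"
  shows "fsum R (\<lambda>n. coord R z (pr n x)) = coord R z x"
proof -
  interpret R: cring R by (rule kalgs_cring[OF R])
  have "hyp_pow R \<one>\<^bsub>R\<^esub> \<one>\<^bsub>R\<^esub> n = \<one>\<^bsub>R\<^esub>" for n by (simp only: hyp_pow_def R.nat_pow_one if_cancel)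
  then have "fsum R (\<lambda>n. coord R z (pr n x)) = hyp_eval R (coord R z) \<one>\<^bsub>R\<^esub> \<one>\<^bsub>R\<^esub> (\<lambda>n. pr n x)"
    unfolding hyp_eval_def using finsuppD(1)[OF coord_pr_finsupp[OF R z x]] by simp
  then show ?thesis using coord_act[OF R z _ _ _ x, of "\<one>\<^bsub>R\<^esub>" "\<one>\<^bsub>R\<^esub>"] act_one[OF R z] by simp
qed

text \<open>
  The projections onto the components are orthogonal idempotents.  This is associativity of the
  action for two independent generic units \<open>\<kappa> U\<close> and \<open>X\<close>: the point \<open>X \<cdot> (\<kappa> U \<cdot> z)\<close> involves iterated
  components, whereas \<open>(X \<otimes> \<kappa> U) \<cdot> z\<close> only involves equal powers of both units.
\<close>

lemma pr_pr:
  assumes x: "x \<in> carrier A"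
  shows "(\<lambda>m. pr m (pr n x)) = single A n (pr n x)"
proof -
  interpret A: cring A by (rule kalgs_cring[OF A])
  obtain L \<iota> U V where "universal_hyperbola k A \<one>\<^bsub>A\<^esub> L \<iota> U V"
    using universal_hyperbola_exists[OF inf A A.one_closed] by blast
  then interpret L: universal_hyperbola k A "\<one>\<^bsub>A\<^esub>" L \<iota> U V .
  interpret Lr: cring L by (rule kalgs_cring[OF L.B])
  obtain M \<kappa> X Y where "universal_hyperbola k L \<one>\<^bsub>L\<^esub> M \<kappa> X Y"
    using universal_hyperbola_exists[OF inf L.B Lr.one_closed] by blast
  then interpret M: universal_hyperbola k L "\<one>\<^bsub>L\<^esub>" M \<kappa> X Y .
  interpret Mr: cring M by (rule kalgs_cring[OF M.B])
  interpret LA: hyp_evaluation A L \<iota> "\<one>\<^bsub>A\<^esub>" U V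
    using khom_hyp_evaluation[OF A L.B L.\<iota> _ L.U L.V L.UV] by simp
  interpret \<kappa>: ring_hom_cring L M \<kappa> by (rule khom_ring_hom_cring[OF L.B M.B M.\<iota>])
  have UV: "U \<otimes>\<^bsub>L\<^esub> V = \<one>\<^bsub>L\<^esub>" using L.UV khom_one[OF L.\<iota>] by simp
  have XY: "X \<otimes>\<^bsub>M\<^esub> Y = \<one>\<^bsub>M\<^esub>" using M.UV khom_one[OF M.\<iota>] by simp
  have \<kappa>UV: "\<kappa> U \<otimes>\<^bsub>M\<^esub> \<kappa> V = \<one>\<^bsub>M\<^esub>" using UV L.U L.V by (metis \<kappa>.hom_mult \<kappa>.hom_one)
  have U: "U \<in> Units L" using Lr.unit_of_inverse[OF L.U L.V UV] by simp
  have units: "X \<in> Units M" "\<kappa> U \<in> Units M"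
    using Mr.unit_of_inverse[OF M.U M.V XY] Mr.unit_of_inverse[OF _ _ \<kappa>UV] L.U L.V by auto
  define z0 where "z0 = \<zeta> L \<iota>"
  note z0 = coord_\<zeta>[OF L.B L.\<iota>, folded z0_def]
  define zM where "zM = on_hom Z L M \<kappa> z0"
  have zM: "zM \<in> points Z M" unfolding zM_def by (rule kfunctor_closed[OF Z L.B M.B M.\<iota> z0(1)])
  have czM: "coord M zM y = \<kappa> (\<iota> y)" if "y \<in> carrier A" for y
    using coord_natural[OF L.B M.B M.\<iota> z0(1)] z0(2) that by (simp add: zM_def compose_eq)
  define \<delta> where "\<delta> = coord L (a L (U, z0))"
  have zU: "a L (U, z0) \<in> points Z L" by (rule act_closed[OF L.B U z0(1)])
  have \<delta>: "\<delta> y = hyp_eval L \<iota> U V (\<lambda>n. pr n y)" if "y \<in> carrier A" for y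
    unfolding \<delta>_def using coord_act[OF L.B z0(1) L.U L.V UV that] z0(2) by simp
  have \<delta>_khom: "\<delta> \<in> khom k A L" unfolding \<delta>_def by (rule coord_khom[OF L.B zU])
  have zUM: "a M (\<kappa> U, zM) \<in> points Z M" by (rule act_closed[OF M.B units(2) zM])
  have cU: "coord M (a M (\<kappa> U, zM)) y = \<kappa> (\<delta> y)" if "y \<in> carrier A" for y
    using act_natural[OF L.B M.B M.\<iota> U z0(1)] coord_natural[OF L.B M.B M.\<iota> zU] that
    by (simp add: zM_def \<delta>_def compose_eq)
  have f1: "(\<lambda>n. \<delta> (pr n x)) \<in> finsupp L"
    by (rule finsupp_mono[OF pr_finsupp[OF x]])
      (use khom_closed[OF \<delta>_khom] pr_closed[OF x] khom_zero[OF A L.B \<delta>_khom] in auto)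
  have f2: "(\<lambda>n. \<iota> (pr n x) \<otimes>\<^bsub>L\<^esub> hyp_pow L U V n) \<in> finsupp L"
    by (rule LA.eval_summand_finsupp[OF pr_finsupp[OF x]])
  have "hyp_eval M \<kappa> X Y (\<lambda>n. \<delta> (pr n x)) = coord M (a M (X, a M (\<kappa> U, zM))) x"
    using coord_act[OF M.B zUM M.U M.V XY x] cU[OF pr_closed[OF x]] by (simp add: hyp_eval_def)
  also have "\<dots> = coord M (a M (X \<otimes>\<^bsub>M\<^esub> \<kappa> U, zM)) x"
    using act_mult[OF M.B zM units] by simp
  also have "\<dots> = hyp_eval M (coord M zM) (X \<otimes>\<^bsub>M\<^esub> \<kappa> U) (Y \<otimes>\<^bsub>M\<^esub> \<kappa> V) (\<lambda>n. pr n x)"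
  proof (rule coord_act[OF M.B zM _ _ _ x])
    have "X \<otimes>\<^bsub>M\<^esub> \<kappa> U \<otimes>\<^bsub>M\<^esub> (Y \<otimes>\<^bsub>M\<^esub> \<kappa> V) = (X \<otimes>\<^bsub>M\<^esub> Y) \<otimes>\<^bsub>M\<^esub> (\<kappa> U \<otimes>\<^bsub>M\<^esub> \<kappa> V)"
      using M.U M.V L.U L.V by (simp add: Mr.m_ac)
    then show "X \<otimes>\<^bsub>M\<^esub> \<kappa> U \<otimes>\<^bsub>M\<^esub> (Y \<otimes>\<^bsub>M\<^esub> \<kappa> V) = \<one>\<^bsub>M\<^esub>" using XY \<kappa>UV by simp
  qed (use M.U M.V L.U L.V in auto)
  also have "\<dots> = hyp_eval M \<kappa> X Y (\<lambda>n. \<iota> (pr n x) \<otimes>\<^bsub>L\<^esub> hyp_pow L U V n)"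
    unfolding hyp_eval_def
    using M.U M.V L.U L.V pr_closed[OF x] khom_closed[OF L.\<iota>]
    by (simp add: czM Mr.hyp_pow_distrib Mr.m_ac
        hyp_pow_hom[OF khom_ring_hom_ring[OF L.B M.B M.\<iota>]])
  finally have "\<delta> (pr n x) = \<iota> (pr n x) \<otimes>\<^bsub>L\<^esub> hyp_pow L U V n"
    using inj_onD[OF bij_betw_imp_inj_on[OF M.bij] _ f1 f2] by (simp add: fun_eq_iff)
  then have "hyp_eval L \<iota> U V (\<lambda>m. pr m (pr n x)) = hyp_eval L \<iota> U V (single A n (pr n x))"
    using \<delta>[OF pr_closed[OF x]] LA.eval_single[OF pr_closed[OF x]] by simp
  then show ?thesis
    by (rule inj_onD[OF bij_betw_imp_inj_on[OF L.bij]])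
      (use pr_finsupp[OF pr_closed[OF x]] A.finsupp_single pr_closed[OF x] in auto)
qed

end

section \<open>The space of equivariant maps as a functor\<close>

lemma points_Ztilde:
  "(t, f) \<in> points (Ztilde k Z a) R \<longleftrightarrow>
    t \<in> carrier R \<and> f \<in> Maps_Gm k (Spec k R) (Spec_over_A1 k R t) Z a"
  by (simp add: Ztilde_def A1_def)

lemma XS_Spec_pull:
  assumes "R \<in> kalgs k" "R' \<in> kalgs k" "T \<in> kalgs k" "h \<in> khom k R R'" "t \<in> carrier R"
    and "((u, v), g) \<in> points (XS k (Spec k R') (Spec_over_A1 k R' (h t))) T"
  shows "((u, v), compose (carrier R) g h) \<in> points (XS k (Spec k R) (Spec_over_A1 k R t)) T"
  using assms khom_compose[of h k R R' g T] by (simp add: points_XS_Spec compose_eq)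

lemma XS_Spec_push:
  assumes "R \<in> kalgs k" "T \<in> kalgs k" "T' \<in> kalgs k" "h \<in> khom k T T'" "t \<in> carrier R"
    and "((u, v), g) \<in> points (XS k (Spec k R) (Spec_over_A1 k R t)) T"
  shows "((h u, h v), compose (carrier R) h g) \<in> points (XS k (Spec k R) (Spec_over_A1 k R t)) T'"
  using assms khom_compose[of g k R T h T']
  by (auto simp: points_XS_Spec compose_eq khom_closed khom_mult[symmetric])

lemma Ztilde_on_hom:
  "fst (on_hom (Ztilde k Z a) R R' h (t, f)) = h t"
  "snd (on_hom (Ztilde k Z a) R R' h (t, f)) =
    (\<lambda>T\<in>kalgs k. \<lambda>(x, g)\<in>points (XS k (Spec k R') (Spec_over_A1 k R' (h t))) T.
           f T (x, compose (carrier R) g h))"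
  by (simp_all add: Ztilde_def)

lemma Ztilde_on_hom_apply:
  assumes "T \<in> kalgs k" "((u, v), g) \<in> points (XS k (Spec k R') (Spec_over_A1 k R' (h t))) T"
  shows "snd (on_hom (Ztilde k Z a) R R' h (t, f)) T ((u, v), g) = f T ((u, v), compose (carrier R) g h)"
  using assms by (simp add: Ztilde_on_hom)

lemma Ztilde_closed:
  assumes R: "R \<in> kalgs k" "R' \<in> kalgs k" and h: "h \<in> khom k R R'"
    and q: "(t, f) \<in> points (Ztilde k Z a) R"
  shows "on_hom (Ztilde k Z a) R R' h (t, f) \<in> points (Ztilde k Z a) R'"
proof -
  let ?F = "snd (on_hom (Ztilde k Z a) R R' h (t, f))"
  let ?P = "points (XS k (Spec k R') (Spec_over_A1 k R' (h t)))"
  have t: "t \<in> carrier R" and f: "f \<in> Maps_Gm k (Spec k R) (Spec_over_A1 k R t) Z a"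
    using q by (simp_all add: points_Ztilde)
  note pull = XS_Spec_pull[OF R _ h t] and app = Ztilde_on_hom_apply[where f = f and h = h]
  have "?F \<in> Maps_Gm k (Spec k R') (Spec_over_A1 k R' (h t)) Z a"
    unfolding Maps_Gm_iff
  proof (intro conjI ballI allI impI)
    show "?F \<in> (\<Pi>\<^sub>E T\<in>kalgs k. ?P T \<rightarrow>\<^sub>E points Z T)"
    proof (intro PiE_I)
      fix T x assume T: "T \<in> kalgs k" and x: "x \<in> ?P T"
      obtain u v g where xe: "x = ((u, v), g)" by (metis surj_pair)
      show "?F T x \<in> points Z T"
        using app[OF T x[unfolded xe], of Z a R] Maps_Gm_closed[OF f T pull[OF T x[unfolded xe]]] xe by simp
    qed (auto simp: Ztilde_on_hom)
  next
    fix T T' h' u v g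
    assume T: "T \<in> kalgs k" "T' \<in> kalgs k" "h' \<in> khom k T T'" and x: "((u, v), g) \<in> ?P T"
    have ht: "h t \<in> carrier R'" by (rule khom_closed[OF h t])
    show "?F T' ((h' u, h' v), on_hom (Spec k R') T T' h' g) = on_hom Z T T' h' (?F T ((u, v), g))"
      using app[OF T(2) XS_Spec_push[OF R(2) T ht x], of Z a R]
        app[OF T(1) x, of Z a R] Maps_Gm_natural[OF f T pull[OF T(1) x]]
      by (simp add: Spec_def khom_compose_assoc[OF h])
  next
    fix T l u v g
    assume T: "T \<in> kalgs k" "l \<in> Units T" and x: "((u, v), g) \<in> ?P T"
    show "?F T ((l \<otimes>\<^bsub>T\<^esub> u, inv\<^bsub>T\<^esub> l \<otimes>\<^bsub>T\<^esub> v), g) = a T (l, ?F T ((u, v), g))"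
      using app[OF T(1) X_act_closed(3)[OF T x], of Z a R]
        app[OF T(1) x, of Z a R] Maps_Gm_equivariant[OF f T pull[OF T(1) x]]
      by simp
  qed
  then show ?thesis
    using khom_closed[OF h t] points_Ztilde[of "h t" ?F k Z a R'] Ztilde_on_hom(1)[of k Z a R R' h t f]
    by (metis prod.collapse)
qed

lemma Ztilde_point_eqI:
  assumes "(t, f) \<in> points (Ztilde k Z a) R" "(t, f') \<in> points (Ztilde k Z a) R"
    and "\<And>T u v g. T \<in> kalgs k \<Longrightarrow> ((u, v), g) \<in> points (XS k (Spec k R) (Spec_over_A1 k R t)) T \<Longrightarrow>
      f T ((u, v), g) = f' T ((u, v), g)"
  shows "f = f'"
proof (rule PiE2_ext)
  show "f' \<in> (\<Pi>\<^sub>E T\<in>kalgs k. points (XS k (Spec k R) (Spec_over_A1 k R t)) T \<rightarrow>\<^sub>E points Z T)"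
    "f \<in> (\<Pi>\<^sub>E T\<in>kalgs k. points (XS k (Spec k R) (Spec_over_A1 k R t)) T \<rightarrow>\<^sub>E points Z T)"
    using assms(1,2)[unfolded points_Ztilde] Maps_Gm_PiE[of _ k "Spec k R" "Spec_over_A1 k R t" Z a]
    by blast+
qed (use assms(3) in auto)

lemma kfunctor_Ztilde: "kfunctor k (Ztilde k Z a)"
  unfolding kfunctor_def
proof (intro conjI ballI)
  fix R T h assume R: "R \<in> kalgs k" "T \<in> kalgs k" "h \<in> khom k R T"
  show "on_hom (Ztilde k Z a) R T h \<in> points (Ztilde k Z a) R \<rightarrow> points (Ztilde k Z a) T"
    using Ztilde_closed[OF R] by auto
next
  fix R q assume R: "R \<in> kalgs k" and q: "q \<in> points (Ztilde k Z a) R"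
  obtain t f where qe: "q = (t, f)" by (metis surj_pair)
  have q': "(t, f) \<in> points (Ztilde k Z a) R" using q qe by simp
  have t: "t \<in> carrier R" using q' by (simp add: points_Ztilde)
  let ?q = "on_hom (Ztilde k Z a) R R (kid R) (t, f)"
  have 1: "fst ?q = t" using t by (simp add: Ztilde_on_hom)
  have "(t, snd ?q) \<in> points (Ztilde k Z a) R"
    using Ztilde_closed[OF R R khom_kid[OF R] q'] 1 by (metis prod.collapse)
  then have "snd ?q = f"
  proof (rule Ztilde_point_eqI[OF _ q'])
    fix T u v g assume T: "T \<in> kalgs k" and x: "((u, v), g) \<in> points (XS k (Spec k R) (Spec_over_A1 k R t)) T"
    have g: "g \<in> khom k R T" using x R T by (simp add: points_XS_Spec)
    have "snd ?q T ((u, v), g) = f T ((u, v), compose (carrier R) g (kid R))"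
      by (rule Ztilde_on_hom_apply[OF T]) (use x t in simp)
    then show "snd ?q T ((u, v), g) = f T ((u, v), g)" unfolding compose_kid_right[OF g] .
  qed
  then show "on_hom (Ztilde k Z a) R R (kid R) q = q" using 1 qe by (metis prod.collapse)
next
  fix R S T h g q
  assume R: "R \<in> kalgs k" "S \<in> kalgs k" "T \<in> kalgs k" and h: "h \<in> khom k R S" and g: "g \<in> khom k S T"
    and q: "q \<in> points (Ztilde k Z a) R"
  obtain t f where qe: "q = (t, f)" by (metis surj_pair)
  have q': "(t, f) \<in> points (Ztilde k Z a) R" using q qe by simp
  have t: "t \<in> carrier R" using q' by (simp add: points_Ztilde)
  note gh = khom_compose[OF h g R(1)]
  let ?q1 = "on_hom (Ztilde k Z a) R T (compose (carrier R) g h) (t, f)"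
  let ?q2 = "on_hom (Ztilde k Z a) R S h (t, f)"
  let ?q3 = "on_hom (Ztilde k Z a) S T g (h t, snd ?q2)"
  have f1: "fst ?q1 = g (h t)" using t by (simp add: Ztilde_on_hom compose_eq)
  have q2: "?q2 = (h t, snd ?q2)" by (simp add: prod_eq_iff Ztilde_on_hom)
  have f3: "fst ?q3 = g (h t)" by (simp only: Ztilde_on_hom)
  have "(h t, snd ?q2) \<in> points (Ztilde k Z a) S" using Ztilde_closed[OF R(1,2) h q'] q2 by simp
  then have m3: "(g (h t), snd ?q3) \<in> points (Ztilde k Z a) T"
    using Ztilde_closed[OF R(2,3) g] f3 by (metis prod.collapse)
  have m1: "(g (h t), snd ?q1) \<in> points (Ztilde k Z a) T"
    using Ztilde_closed[OF R(1,3) gh q'] f1 by (metis prod.collapse)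
  have "snd ?q1 = snd ?q3"
  proof (rule Ztilde_point_eqI[OF m1 m3])
    fix T' u v w
    assume T': "T' \<in> kalgs k"
      and x: "((u, v), w) \<in> points (XS k (Spec k T) (Spec_over_A1 k T (g (h t)))) T'"
    have x1: "((u, v), w) \<in> points (XS k (Spec k T) (Spec_over_A1 k T (compose (carrier R) g h t))) T'"
      using x t by (simp add: compose_eq)
    have x2: "((u, v), compose (carrier S) w g) \<in> points (XS k (Spec k S) (Spec_over_A1 k S (h t))) T'"
      by (rule XS_Spec_pull[OF R(2,3) T' g khom_closed[OF h t] x])
    have "snd ?q1 T' ((u, v), w) = f T' ((u, v), compose (carrier R) w (compose (carrier R) g h))"
      by (rule Ztilde_on_hom_apply[OF T']) (rule x1)
    moreover have "snd ?q3 T' ((u, v), w) = snd ?q2 T' ((u, v), compose (carrier S) w g)"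
      by (rule Ztilde_on_hom_apply[OF T']) (rule x)
    moreover have "\<dots> = f T' ((u, v), compose (carrier R) (compose (carrier S) w g) h)"
      by (rule Ztilde_on_hom_apply[OF T']) (rule x2)
    ultimately show "snd ?q1 T' ((u, v), w) = snd ?q3 T' ((u, v), w)"
      by (simp add: khom_compose_assoc[OF h])
  qed
  then have "?q1 = ?q3" using f1 f3 by (simp add: prod_eq_iff)
  then show "on_hom (Ztilde k Z a) R T (compose (carrier R) g h) q =
      on_hom (Ztilde k Z a) S T g (on_hom (Ztilde k Z a) R S h q)"
    using q2 qe by simp
qed

lemma section_points:
  assumes R: "R \<in> kalgs k" and t: "t \<in> carrier R"
  shows "((\<one>\<^bsub>R\<^esub>, t), kid R) \<in> points (XS k (Spec k R) (Spec_over_A1 k R t)) R"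
    and "((t, \<one>\<^bsub>R\<^esub>), kid R) \<in> points (XS k (Spec k R) (Spec_over_A1 k R t)) R"
proof -
  interpret cring R by (rule kalgs_cring[OF R])
  show "((\<one>\<^bsub>R\<^esub>, t), kid R) \<in> points (XS k (Spec k R) (Spec_over_A1 k R t)) R"
    "((t, \<one>\<^bsub>R\<^esub>), kid R) \<in> points (XS k (Spec k R) (Spec_over_A1 k R t)) R"
    using R t khom_kid[OF R] by (simp_all add: points_XS_Spec)
qed

lemma ptilde_apply:
  assumes "R \<in> kalgs k" "(t, f) \<in> points (Ztilde k Z a) R"
  shows "ptilde k Z a R (t, f) = (t, f R ((\<one>\<^bsub>R\<^esub>, t), kid R), f R ((t, \<one>\<^bsub>R\<^esub>), kid R))"
  using assms by (simp add: ptilde_def pi_section_def sec1_def sec2_def points_Ztilde)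

lemma ptilde_closed:
  assumes R: "R \<in> kalgs k" and q: "(t, f) \<in> points (Ztilde k Z a) R"
  shows "t \<in> carrier R" "f R ((\<one>\<^bsub>R\<^esub>, t), kid R) \<in> points Z R" "f R ((t, \<one>\<^bsub>R\<^esub>), kid R) \<in> points Z R"
proof -
  have t: "t \<in> carrier R" and f: "f \<in> Maps_Gm k (Spec k R) (Spec_over_A1 k R t) Z a"
    using q by (simp_all add: points_Ztilde)
  note sp = section_points[OF R t]
  show "t \<in> carrier R" by (rule t)
  show "f R ((\<one>\<^bsub>R\<^esub>, t), kid R) \<in> points Z R" "f R ((t, \<one>\<^bsub>R\<^esub>), kid R) \<in> points Z R"
    using Maps_Gm_closed[OF f R sp(1)] Maps_Gm_closed[OF f R sp(2)] .
qed

lemma A1ZZ_simps: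
  "points (A1 \<times>\<^sub>k Z \<times>\<^sub>k Z) R = carrier R \<times> points Z R \<times> points Z R"
  "on_hom (A1 \<times>\<^sub>k Z \<times>\<^sub>k Z) R T h (t, z1, z2) = (h t, on_hom Z R T h z1, on_hom Z R T h z2)"
  by (simp_all add: prod_func_def A1_def)

lemma kfunctor_A1ZZ:
  assumes Z: "kfunctor k Z"
  shows "kfunctor k (A1 \<times>\<^sub>k Z \<times>\<^sub>k Z)"
  unfolding kfunctor_def
  by (auto simp: A1ZZ_simps khom_closed kfunctor_closed[OF Z] kfunctor_id[OF Z] kfunctor_compose[OF Z]
      compose_eq)

lemma Maps_Gm_section_natural:
  assumes R: "R \<in> kalgs k" "T \<in> kalgs k" and g: "g \<in> khom k R T" and t: "t \<in> carrier R"
    and f: "f \<in> Maps_Gm k (Spec k R) (Spec_over_A1 k R t) Z a"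
  shows "f T ((\<one>\<^bsub>T\<^esub>, g t), g) = on_hom Z R T g (f R ((\<one>\<^bsub>R\<^esub>, t), kid R))"
    and "f T ((g t, \<one>\<^bsub>T\<^esub>), g) = on_hom Z R T g (f R ((t, \<one>\<^bsub>R\<^esub>), kid R))"
  using Maps_Gm_natural[OF f R(1,2) g section_points(1)[OF R(1) t]]
    Maps_Gm_natural[OF f R(1,2) g section_points(2)[OF R(1) t]]
  by (simp_all add: Spec_def compose_kid_right[OF g] khom_one[OF g])

lemma ptilde_kmaps: "ptilde k Z a \<in> kmaps k (Ztilde k Z a) (A1 \<times>\<^sub>k Z \<times>\<^sub>k Z)"
  unfolding kmaps_def
proof (intro CollectI conjI ballI)
  show "ptilde k Z a \<in> (\<Pi>\<^sub>E R\<in>kalgs k. points (Ztilde k Z a) R \<rightarrow>\<^sub>E points (A1 \<times>\<^sub>k Z \<times>\<^sub>k Z) R)"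
  proof (intro PiE_I)
    fix R q assume R: "R \<in> kalgs k" and q: "q \<in> points (Ztilde k Z a) R"
    obtain t f where qe: "q = (t, f)" by (metis surj_pair)
    show "ptilde k Z a R q \<in> points (A1 \<times>\<^sub>k Z \<times>\<^sub>k Z) R"
      using ptilde_closed[OF R q[unfolded qe]] ptilde_apply[OF R q[unfolded qe]] qe
      by (simp add: A1ZZ_simps)
  qed (auto simp: ptilde_def)
next
  fix R T h q
  assume R: "R \<in> kalgs k" "T \<in> kalgs k" "h \<in> khom k R T" and q: "q \<in> points (Ztilde k Z a) R"
  obtain t f where qe: "q = (t, f)" by (metis surj_pair)
  have q': "(t, f) \<in> points (Ztilde k Z a) R" using q qe by simp
  have t: "t \<in> carrier R" and f: "f \<in> Maps_Gm k (Spec k R) (Spec_over_A1 k R t) Z a"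
    using q' by (simp_all add: points_Ztilde)
  let ?q = "on_hom (Ztilde k Z a) R T h (t, f)"
  have qq: "?q = (h t, snd ?q)" by (simp add: prod_eq_iff Ztilde_on_hom)
  have q2: "(h t, snd ?q) \<in> points (Ztilde k Z a) T" using Ztilde_closed[OF R q'] qq by simp
  note sp = section_points[OF R(2) khom_closed[OF R(3) t]]
    and app = Ztilde_on_hom_apply[OF R(2), where R' = T and h = h and t = t and R = R and f = f and Z = Z and a = a]
  have "ptilde k Z a T (h t, snd ?q) = on_hom (A1 \<times>\<^sub>k Z \<times>\<^sub>k Z) R T h (ptilde k Z a R (t, f))"
    unfolding ptilde_apply[OF R(2) q2] ptilde_apply[OF R(1) q'] A1ZZ_simps
      app[OF sp(1)] app[OF sp(2)]
      compose_kid_left[OF R(3)] Maps_Gm_section_natural[OF R t f] ..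
  then show "ptilde k Z a T (on_hom (Ztilde k Z a) R T h q) =
      on_hom (A1 \<times>\<^sub>k Z \<times>\<^sub>k Z) R T h (ptilde k Z a R q)"
    using qq qe by simp
qed

section \<open>The image of the map to the product\<close>

context affine_Gm_scheme
begin

text \<open>
  The coefficient \<open>r\<close> in degree \<open>n\<close> of the homomorphism \<open>A \<rightarrow> R[U, V]/(U V - t)\<close> that restricts to \<open>z1\<close>
  and \<open>z2\<close> on the sections \<open>(1, t)\<close> and \<open>(t, 1)\<close>.
\<close>

definition glue :: "'u alg \<Rightarrow> 'z \<Rightarrow> 'z \<Rightarrow> 'u \<Rightarrow> int \<Rightarrow> 'u" where
  "glue R z1 z2 x n = (if 0 \<le> n then coord R z1 (pr n x) else coord R z2 (pr n x))"

text \<open>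
  As \<open>hyp_pow R 1 t n\<close> is \<open>1\<close> for \<open>n \<ge> 0\<close> and \<open>t ^ (- n)\<close> for \<open>n \<le> 0\<close>, whereas \<open>hyp_pow R t 1 n\<close>
  is \<open>t ^ n\<close> for \<open>n \<ge> 0\<close> and \<open>1\<close> for \<open>n \<le> 0\<close>, the equations say that \<open>z2 = t ^ n \<cdot> z1\<close> in degrees \<open>n \<ge> 0\<close> and that
  \<open>z1 = t ^ (- n) \<cdot> z2\<close> in degrees \<open>n \<le> 0\<close>.
\<close>

definition compatible :: "'u alg \<Rightarrow> 'u \<Rightarrow> 'z \<Rightarrow> 'z \<Rightarrow> bool" where
  "compatible R t z1 z2 \<longleftrightarrow> (\<forall>x\<in>carrier A. \<forall>n.
     coord R z1 (pr n x) = hyp_pow R \<one>\<^bsub>R\<^esub> t n \<otimes>\<^bsub>R\<^esub> glue R z1 z2 x n \<and>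
     coord R z2 (pr n x) = hyp_pow R t \<one>\<^bsub>R\<^esub> n \<otimes>\<^bsub>R\<^esub> glue R z1 z2 x n)"

lemma glue_finsupp:
  assumes "R \<in> kalgs k" "z1 \<in> points Z R" "z2 \<in> points Z R" "x \<in> carrier A"
  shows "glue R z1 z2 x \<in> finsupp R"
  unfolding glue_def
  by (rule finsupp_mono[OF pr_finsupp[OF assms(4)]])
    (use assms coord_khom in \<open>auto intro: khom_closed pr_closed simp: khom_zero[OF A]\<close>)

lemma glue_pr:
  assumes R: "R \<in> kalgs k" and z: "z1 \<in> points Z R" "z2 \<in> points Z R" and x: "x \<in> carrier A"
  shows "glue R z1 z2 (pr m x) = single R m (glue R z1 z2 x m)"
proof
  fix n
  have "pr n (pr m x) = (if n = m then pr m x else \<zero>\<^bsub>A\<^esub>)"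
    using fun_cong[OF pr_pr[OF x, of m], of n] by (simp add: single_def)
  then show "glue R z1 z2 (pr m x) n = single R m (glue R z1 z2 x m) n"
    using khom_zero[OF A R coord_khom[OF R z(1)]] khom_zero[OF A R coord_khom[OF R z(2)]]
    by (cases "n = m") (simp_all add: glue_def single_def)
qed

text \<open>
  Over the Laurent polynomial ring the point \<open>X \<cdot> z\<close> displays the values at \<open>z\<close> of all the components
  as coefficients.
\<close>

lemma coord_act_generic:
  assumes L: "universal_hyperbola k R \<one>\<^bsub>R\<^esub> L \<kappa> X Y" and z: "z \<in> points Z R" and x: "x \<in> carrier A"
  shows "coord L (a L (X, on_hom Z R L \<kappa> z)) x = hyp_eval L \<kappa> X Y (\<lambda>n. coord R z (pr n x))"
proof -
  interpret L: universal_hyperbola k R "\<one>\<^bsub>R\<^esub>" L \<kappa> X Y by fact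
  have XY: "X \<otimes>\<^bsub>L\<^esub> Y = \<one>\<^bsub>L\<^esub>" using L.UV khom_one[OF L.\<iota>] by simp
  show ?thesis
    using coord_act[OF L.B kfunctor_closed[OF Z L.R L.B L.\<iota> z] L.U L.V XY x] pr_closed[OF x]
    by (simp add: hyp_eval_def coord_natural[OF L.R L.B L.\<iota> z] compose_eq)
qed

text \<open>
  The map \<open>f\<close> is determined by its value \<open>w\<close> at the generic point \<open>(U, V)\<close> of the hyperbola, that is,
  by the coefficients \<open>p x\<close> of the functions \<open>x\<close> at \<open>w\<close>.  The points \<open>(X, t/X) = X \<cdot> (1, t)\<close> and
  \<open>(t X, 1/X) = X \<cdot> (t, 1)\<close> over the Laurent polynomial ring compare these coefficients with the
  values of the components of \<open>x\<close> at \<open>z1\<close> and \<open>z2\<close>.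
\<close>

lemma Ztilde_coord:
  assumes R: "R \<in> kalgs k" and q: "(t, f) \<in> points (Ztilde k Z a) R"
    and z1: "z1 = f R ((\<one>\<^bsub>R\<^esub>, t), kid R)" and z2: "z2 = f R ((t, \<one>\<^bsub>R\<^esub>), kid R)"
  shows "compatible R t z1 z2"
    and "\<And>T u v g x. T \<in> kalgs k \<Longrightarrow>
      ((u, v), g) \<in> points (XS k (Spec k R) (Spec_over_A1 k R t)) T \<Longrightarrow> x \<in> carrier A \<Longrightarrow>
      coord T (f T ((u, v), g)) x = hyp_eval T g u v (glue R z1 z2 x)"
proof -
  have t: "t \<in> carrier R" and f: "f \<in> Maps_Gm k (Spec k R) (Spec_over_A1 k R t) Z a"
    using q by (simp_all add: points_Ztilde)
  interpret R: cring R by (rule kalgs_cring[OF R])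
  have zZ: "z1 \<in> points Z R" "z2 \<in> points Z R"
    using ptilde_closed[OF R q] by (simp_all only: z1 z2)
  let ?P = "\<lambda>T. points (XS k (Spec k R) (Spec_over_A1 k R t)) T"
  obtain B \<iota> U V where "universal_hyperbola k R t B \<iota> U V"
    using universal_hyperbola_exists[OF inf R t] by blast
  then interpret B: universal_hyperbola k R t B \<iota> U V .
  have UP: "((U, V), \<iota>) \<in> ?P B" using R B.B B.U B.V B.\<iota> B.UV by (simp add: points_XS_Spec)
  define w where "w = f B ((U, V), \<iota>)"
  have w: "w \<in> points Z B" unfolding w_def by (rule Maps_Gm_closed[OF f B.B UP])
  define p where "p = (\<lambda>x. inv_into (finsupp R) (hyp_eval B \<iota> U V) (coord B w x))"
  have p: "p x \<in> finsupp R" "hyp_eval B \<iota> U V (p x) = coord B w x" if "x \<in> carrier A" for x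
    using B.bij khom_closed[OF coord_khom[OF B.B w] that] unfolding p_def bij_betw_def
    by (auto intro: inv_into_into simp: f_inv_into_f)
  \<comment> \<open>Every point of the base change is a specialisation of the generic point \<open>(U, V)\<close>.\<close>
  have coord_f: "coord T (f T ((u, v), g)) x = hyp_eval T g u v (p x)"
    if T: "T \<in> kalgs k" and x: "x \<in> carrier A" and P: "((u, v), g) \<in> ?P T" for T u v g x
  proof -
    have "g \<in> khom k R T" "u \<in> carrier T" "v \<in> carrier T" "u \<otimes>\<^bsub>T\<^esub> v = g t"
      using P R T by (simp_all add: points_XS_Spec)
    then obtain h where h: "h \<in> khom k B T" "h U = u" "h V = v" "compose (carrier R) h \<iota> = g"
      using B.extend[OF T] by blast
    have "f T ((u, v), g) = on_hom Z B T h w"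
      using Maps_Gm_natural[OF f B.B T h(1) UP] h by (simp add: Spec_def w_def)
    then show ?thesis
      using coord_natural[OF B.B T h(1) w] B.extend_eval[OF T h(1) p(1)[OF x]] p(2)[OF x] h x
      by (simp add: compose_eq)
  qed
  obtain L \<kappa> X Y where LU: "universal_hyperbola k R \<one>\<^bsub>R\<^esub> L \<kappa> X Y"
    using universal_hyperbola_exists[OF inf R R.one_closed] by blast
  then interpret L: universal_hyperbola k R "\<one>\<^bsub>R\<^esub>" L \<kappa> X Y .
  interpret Lr: cring L by (rule kalgs_cring[OF L.B])
  interpret RL: hyp_evaluation R L \<kappa> "\<one>\<^bsub>R\<^esub>" X Y
    using khom_hyp_evaluation[OF R L.B L.\<iota> _ L.U L.V L.UV] by simp
  have XY: "X \<otimes>\<^bsub>L\<^esub> Y = \<one>\<^bsub>L\<^esub>" using L.UV by simp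
  note X = Lr.unit_of_inverse[OF L.U L.V XY]
  have s: "\<kappa> t \<in> carrier L" by (rule khom_closed[OF L.\<iota> t])
  have P1: "((\<one>\<^bsub>L\<^esub>, \<kappa> t), \<kappa>) \<in> ?P L" "((\<kappa> t, \<one>\<^bsub>L\<^esub>), \<kappa>) \<in> ?P L"
    using R L.B L.\<iota> s by (simp_all add: points_XS_Spec)
  note eq1 = Maps_Gm_equivariant[OF f L.B X(1) P1(1)]
    and eq2 = Maps_Gm_equivariant[OF f L.B X(1) P1(2)]
  note sec = Maps_Gm_section_natural[OF R L.B L.\<iota> t f, folded z1 z2]
  have P2: "((X \<otimes>\<^bsub>L\<^esub> \<kappa> \<one>\<^bsub>R\<^esub>, Y \<otimes>\<^bsub>L\<^esub> \<kappa> t), \<kappa>) \<in> ?P L" "((X \<otimes>\<^bsub>L\<^esub> \<kappa> t, Y \<otimes>\<^bsub>L\<^esub> \<kappa> \<one>\<^bsub>R\<^esub>), \<kappa>) \<in> ?P L"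
    using X_act_closed(3)[OF L.B X(1) P1(1)] X_act_closed(3)[OF L.B X(1) P1(2)] X(2) by simp_all
  \<comment> \<open>Equivariance under \<open>X\<close> at the two sections; both sides are compared coefficientwise.\<close>
  have cp: "coord R z1 (pr n x) = hyp_pow R \<one>\<^bsub>R\<^esub> t n \<otimes>\<^bsub>R\<^esub> p x n"
    "coord R z2 (pr n x) = hyp_pow R t \<one>\<^bsub>R\<^esub> n \<otimes>\<^bsub>R\<^esub> p x n" if x: "x \<in> carrier A" for x n
  proof -
    note px = p(1)[OF x]
    note inj = inj_onD[OF bij_betw_imp_inj_on[OF L.bij]]
    have "hyp_eval L \<kappa> X Y (\<lambda>n. coord R z1 (pr n x)) = coord L (a L (X, on_hom Z R L \<kappa> z1)) x"
      by (rule coord_act_generic[OF LU zZ(1) x, symmetric])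
    also have "\<dots> = hyp_eval L \<kappa> (X \<otimes>\<^bsub>L\<^esub> \<kappa> \<one>\<^bsub>R\<^esub>) (Y \<otimes>\<^bsub>L\<^esub> \<kappa> t) (p x)"
      using coord_f[OF L.B x P2(1)] eq1 sec(1) X(2) by simp
    also have "\<dots> = hyp_eval L \<kappa> X Y (\<lambda>n. hyp_pow R \<one>\<^bsub>R\<^esub> t n \<otimes>\<^bsub>R\<^esub> p x n)"
      by (rule RL.eval_scale[OF R.one_closed t px])
    finally show "coord R z1 (pr n x) = hyp_pow R \<one>\<^bsub>R\<^esub> t n \<otimes>\<^bsub>R\<^esub> p x n"
      using inj[OF _ coord_pr_finsupp[OF R zZ(1) x] finsupp_scale[OF R.is_cring R.one_closed t px]]
      by (simp add: fun_eq_iff)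
    have "hyp_eval L \<kappa> X Y (\<lambda>n. coord R z2 (pr n x)) = coord L (a L (X, on_hom Z R L \<kappa> z2)) x"
      by (rule coord_act_generic[OF LU zZ(2) x, symmetric])
    also have "\<dots> = hyp_eval L \<kappa> (X \<otimes>\<^bsub>L\<^esub> \<kappa> t) (Y \<otimes>\<^bsub>L\<^esub> \<kappa> \<one>\<^bsub>R\<^esub>) (p x)"
      using coord_f[OF L.B x P2(2)] eq2 sec(2) X(2) by simp
    also have "\<dots> = hyp_eval L \<kappa> X Y (\<lambda>n. hyp_pow R t \<one>\<^bsub>R\<^esub> n \<otimes>\<^bsub>R\<^esub> p x n)"
      by (rule RL.eval_scale[OF t R.one_closed px])
    finally show "coord R z2 (pr n x) = hyp_pow R t \<one>\<^bsub>R\<^esub> n \<otimes>\<^bsub>R\<^esub> p x n"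
      using inj[OF _ coord_pr_finsupp[OF R zZ(2) x] finsupp_scale[OF R.is_cring t R.one_closed px]]
      by (simp add: fun_eq_iff)
  qed
  have pg: "p x = glue R z1 z2 x" if x: "x \<in> carrier A" for x
  proof
    fix n
    show "p x n = glue R z1 z2 x n"
      using cp[OF x, of n] finsuppD(1)[OF p(1)[OF x], of n]
        hyp_pow_one_ge[of n R t] hyp_pow_one_le[of n R t] R.is_cring
      by (auto simp: glue_def)
  qed
  show "compatible R t z1 z2" unfolding compatible_def using cp pg by simp
  show "coord T (f T ((u, v), g)) x = hyp_eval T g u v (glue R z1 z2 x)"
    if "T \<in> kalgs k" "((u, v), g) \<in> ?P T" "x \<in> carrier A" for T u v g x
    using coord_f[OF that(1,3,2)] pg[OF that(3)] by simp
qed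

text \<open>
  The hyperbola algebra embeds into two Laurent polynomial rings through \<open>\<rho>1\<close>, given by \<open>(X, t/X)\<close>,
  and \<open>\<rho>2\<close>, given by \<open>(t X, 1/X)\<close>: the former keeps the coefficients of degree \<open>n \<ge> 0\<close> and the latter
  those of degree \<open>n \<le> 0\<close>.  Compatibility says that \<open>\<rho>1\<close> and \<open>\<rho>2\<close> turn the glued map into \<open>X \<cdot> z1\<close> and
  \<open>X \<cdot> z2\<close>.  Since the latter are homomorphisms, so is the glued map.
\<close>

lemma glue_hom:
  assumes R: "R \<in> kalgs k" and t: "t \<in> carrier R" and z1: "z1 \<in> points Z R" and z2: "z2 \<in> points Z R"
    and comp: "compatible R t z1 z2" and BU: "universal_hyperbola k R t B \<iota> U V"
  shows "(\<lambda>x\<in>carrier A. hyp_eval B \<iota> U V (glue R z1 z2 x)) \<in> khom k A B"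
proof -
  interpret R: cring R by (rule kalgs_cring[OF R])
  interpret AA: algebra k A using A by (simp add: kalgs_def)
  interpret B: universal_hyperbola k R t B \<iota> U V by fact
  interpret BA: algebra k B using B.B by (simp add: kalgs_def)
  interpret RB: hyp_evaluation R B \<iota> t U V
    using khom_hyp_evaluation[OF R B.B B.\<iota> t B.U B.V B.UV] .
  obtain L \<kappa> X Y where LU: "universal_hyperbola k R \<one>\<^bsub>R\<^esub> L \<kappa> X Y"
    using universal_hyperbola_exists[OF inf R R.one_closed] by blast
  then interpret L: universal_hyperbola k R "\<one>\<^bsub>R\<^esub>" L \<kappa> X Y .
  interpret Lr: cring L by (rule kalgs_cring[OF L.B])
  interpret RL: hyp_evaluation R L \<kappa> "\<one>\<^bsub>R\<^esub>" X Y
    using khom_hyp_evaluation[OF R L.B L.\<iota> _ L.U L.V L.UV] by simp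
  have XY: "X \<otimes>\<^bsub>L\<^esub> Y = \<one>\<^bsub>L\<^esub>" using L.UV by simp
  note X = Lr.unit_of_inverse[OF L.U L.V XY]
  define \<theta> where "\<theta> = (\<lambda>x\<in>carrier A. hyp_eval B \<iota> U V (glue R z1 z2 x))"
  have \<theta>: "\<theta> x = hyp_eval B \<iota> U V (glue R z1 z2 x)" if "x \<in> carrier A" for x
    using that by (simp add: \<theta>_def)
  have \<theta>_closed: "\<theta> x \<in> carrier B" if "x \<in> carrier A" for x
    using RB.eval_closed[OF glue_finsupp[OF R z1 z2 that]] \<theta>[OF that] by simp
  \<comment> \<open>The factors \<open>(r, r') = (1, t)\<close> and \<open>(r, r') = (t, 1)\<close> yield \<open>\<rho>1\<close> and \<open>\<rho>2\<close>.\<close>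
  have rho: "\<exists>\<rho>\<in>khom k B L. \<forall>p\<in>finsupp R. \<rho> (hyp_eval B \<iota> U V p) =
      hyp_eval L \<kappa> X Y (\<lambda>n. hyp_pow R r r' n \<otimes>\<^bsub>R\<^esub> p n)"
    if r: "r \<in> carrier R" "r' \<in> carrier R" "r \<otimes>\<^bsub>R\<^esub> r' = t" for r r'
  proof -
    have c: "X \<otimes>\<^bsub>L\<^esub> \<kappa> r \<in> carrier L" "Y \<otimes>\<^bsub>L\<^esub> \<kappa> r' \<in> carrier L" using r L.U L.V by auto
    have "X \<otimes>\<^bsub>L\<^esub> \<kappa> r \<otimes>\<^bsub>L\<^esub> (Y \<otimes>\<^bsub>L\<^esub> \<kappa> r') = X \<otimes>\<^bsub>L\<^esub> Y \<otimes>\<^bsub>L\<^esub> (\<kappa> r \<otimes>\<^bsub>L\<^esub> \<kappa> r')"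
      using r L.U L.V by (simp add: Lr.m_ac)
    also have "\<dots> = \<kappa> t" using r XY by (simp flip: r(3))
    finally obtain \<rho> where \<rho>: "\<rho> \<in> khom k B L" "\<rho> U = X \<otimes>\<^bsub>L\<^esub> \<kappa> r" "\<rho> V = Y \<otimes>\<^bsub>L\<^esub> \<kappa> r'"
        "compose (carrier R) \<rho> \<iota> = \<kappa>"
      using B.extend[OF L.B L.\<iota> c] by blast
    show ?thesis
      by (rule bexI[OF _ \<rho>(1)])
        (use B.extend_eval[OF L.B \<rho>(1)] RL.eval_scale[OF r(1,2)] \<rho> in simp)
  qed
  obtain \<rho>1 where \<rho>1: "\<rho>1 \<in> khom k B L" "\<And>p. p \<in> finsupp R \<Longrightarrow> \<rho>1 (hyp_eval B \<iota> U V p) =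
      hyp_eval L \<kappa> X Y (\<lambda>n. hyp_pow R \<one>\<^bsub>R\<^esub> t n \<otimes>\<^bsub>R\<^esub> p n)"
    using rho[OF R.one_closed t] t by auto
  obtain \<rho>2 where \<rho>2: "\<rho>2 \<in> khom k B L" "\<And>p. p \<in> finsupp R \<Longrightarrow> \<rho>2 (hyp_eval B \<iota> U V p) =
      hyp_eval L \<kappa> X Y (\<lambda>n. hyp_pow R t \<one>\<^bsub>R\<^esub> n \<otimes>\<^bsub>R\<^esub> p n)"
    using rho[OF t R.one_closed] t by auto
  have joint: "b = b'" if b: "b \<in> carrier B" "b' \<in> carrier B" and eq: "\<rho>1 b = \<rho>1 b'" "\<rho>2 b = \<rho>2 b'" for b b'
  proof -
    obtain p p' where p: "p \<in> finsupp R" "b = hyp_eval B \<iota> U V p" "p' \<in> finsupp R" "b' = hyp_eval B \<iota> U V p'"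
      using B.bij b unfolding bij_betw_def by blast
    note inj = inj_onD[OF bij_betw_imp_inj_on[OF L.bij]]
    have "hyp_pow R \<one>\<^bsub>R\<^esub> t n \<otimes>\<^bsub>R\<^esub> p n = hyp_pow R \<one>\<^bsub>R\<^esub> t n \<otimes>\<^bsub>R\<^esub> p' n"
      "hyp_pow R t \<one>\<^bsub>R\<^esub> n \<otimes>\<^bsub>R\<^esub> p n = hyp_pow R t \<one>\<^bsub>R\<^esub> n \<otimes>\<^bsub>R\<^esub> p' n" for n
      using eq p \<rho>1(2) \<rho>2(2)
        inj[OF _ finsupp_scale[OF R.is_cring R.one_closed t p(1)] finsupp_scale[OF R.is_cring R.one_closed t p(3)]]
        inj[OF _ finsupp_scale[OF R.is_cring t R.one_closed p(1)] finsupp_scale[OF R.is_cring t R.one_closed p(3)]]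
      by (simp_all add: fun_eq_iff)
    note e = this
    have "p = p'"
    proof
      fix n
      show "p n = p' n"
        using e[of n] finsuppD(1)[OF p(1), of n] finsuppD(1)[OF p(3), of n]
        hyp_pow_one_ge[of n R t] hyp_pow_one_le[of n R t] R.is_cring
        by (cases "0 \<le> n") auto
    qed
    then show ?thesis using p by simp
  qed
  define y1 where "y1 = coord L (a L (X, on_hom Z R L \<kappa> z1))"
  define y2 where "y2 = coord L (a L (X, on_hom Z R L \<kappa> z2))"
  have y: "y1 \<in> khom k A L" "y2 \<in> khom k A L"
    unfolding y1_def y2_def
    by (intro coord_khom[OF L.B] act_closed[OF L.B X(1)] kfunctor_closed[OF Z R L.B L.\<iota>] z1 z2)+
  have \<rho>\<theta>: "\<rho>1 (\<theta> x) = y1 x" "\<rho>2 (\<theta> x) = y2 x" if x: "x \<in> carrier A" for x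
    using comp x \<rho>1(2) \<rho>2(2) glue_finsupp[OF R z1 z2 x]
    by (simp_all add: \<theta>[OF x] y1_def y2_def coord_act_generic[OF LU _ x] z1 z2 compatible_def)
  have "\<theta> \<in> khom k A B"
  proof (rule khomI)
    show "\<theta> \<in> ring_hom A B"
    proof (rule ring_hom_memI)
      fix x x' assume x: "x \<in> carrier A" "x' \<in> carrier A"
      note c = \<theta>_closed[OF x(1)] \<theta>_closed[OF x(2)]
      show "\<theta> (x \<otimes>\<^bsub>A\<^esub> x') = \<theta> x \<otimes>\<^bsub>B\<^esub> \<theta> x'"
        by (rule joint) (use x c \<theta>_closed in \<open>simp_all add: \<rho>\<theta> khom_mult[OF \<rho>1(1)] khom_mult[OF \<rho>2(1)]
          khom_mult[OF y(1)] khom_mult[OF y(2)]\<close>)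
      show "\<theta> (x \<oplus>\<^bsub>A\<^esub> x') = \<theta> x \<oplus>\<^bsub>B\<^esub> \<theta> x'"
        by (rule joint) (use x c \<theta>_closed in \<open>simp_all add: \<rho>\<theta> khom_add[OF \<rho>1(1)] khom_add[OF \<rho>2(1)]
          khom_add[OF y(1)] khom_add[OF y(2)]\<close>)
    next
      show "\<theta> \<one>\<^bsub>A\<^esub> = \<one>\<^bsub>B\<^esub>"
        by (rule joint) (use \<theta>_closed in \<open>simp_all add: \<rho>\<theta> khom_one[OF \<rho>1(1)] khom_one[OF \<rho>2(1)]
          khom_one[OF y(1)] khom_one[OF y(2)]\<close>)
    qed (rule \<theta>_closed)
    fix c x assume c: "c \<in> carrier k" and x: "x \<in> carrier A"
    show "\<theta> (c \<odot>\<^bsub>A\<^esub> x) = c \<odot>\<^bsub>B\<^esub> \<theta> x"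
      by (rule joint) (use c x \<theta>_closed in \<open>simp_all add: \<rho>\<theta> khom_smult[OF \<rho>1(1)] khom_smult[OF \<rho>2(1)]
          khom_smult[OF y(1)] khom_smult[OF y(2)]\<close>)
  qed (simp add: \<theta>_def)
  then show ?thesis by (simp only: \<theta>_def)
qed

text \<open>
  The glued homomorphism of \<open>glue_hom\<close> is a point of \<open>Z\<close> with values in the hyperbola algebra, and
  its specialisations form a morphism from the base change of the hyperbola family to \<open>Z\<close>.
  Equivariance holds because the glued map preserves degrees (\<open>glue_pr\<close>).
\<close>

lemma Ztilde_point_exists:
  assumes R: "R \<in> kalgs k" and t: "t \<in> carrier R" and z1: "z1 \<in> points Z R" and z2: "z2 \<in> points Z R"
    and comp: "compatible R t z1 z2"
  shows "\<exists>f. (t, f) \<in> points (Ztilde k Z a) R \<and> f R ((\<one>\<^bsub>R\<^esub>, t), kid R) = z1 \<and>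
    f R ((t, \<one>\<^bsub>R\<^esub>), kid R) = z2"
proof -
  interpret R: cring R by (rule kalgs_cring[OF R])
  let ?P = "\<lambda>T. points (XS k (Spec k R) (Spec_over_A1 k R t)) T"
  obtain B \<iota> U V where BU: "universal_hyperbola k R t B \<iota> U V"
    using universal_hyperbola_exists[OF inf R t] by blast
  then interpret B: universal_hyperbola k R t B \<iota> U V .
  define q where "q = glue R z1 z2"
  have q: "q x \<in> finsupp R" if "x \<in> carrier A" for x
    unfolding q_def by (rule glue_finsupp[OF R z1 z2 that])
  define F where "F = (\<lambda>T. \<lambda>((u, v), g). \<zeta> T (\<lambda>x\<in>carrier A. hyp_eval T g u v (q x)))"
  define f where "f = (\<lambda>T\<in>kalgs k. restrict (F T) (?P T))"
  have ev: "hyp_evaluation R T g t u v" if "T \<in> kalgs k" "((u, v), g) \<in> ?P T" for T u v g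
    using that R t by (intro khom_hyp_evaluation) (auto simp: points_XS_Spec)
  have khom_ev: "(\<lambda>x\<in>carrier A. hyp_eval T g u v (q x)) \<in> khom k A T"
    if T: "T \<in> kalgs k" and P: "((u, v), g) \<in> ?P T" for T u v g
  proof -
    have "g \<in> khom k R T" "u \<in> carrier T" "v \<in> carrier T" "u \<otimes>\<^bsub>T\<^esub> v = g t"
      using P R T by (simp_all add: points_XS_Spec)
    then obtain h where h: "h \<in> khom k B T" "h U = u" "h V = v" "compose (carrier R) h \<iota> = g"
      using B.extend[OF T] by blast
    have "compose (carrier A) h (\<lambda>x\<in>carrier A. hyp_eval B \<iota> U V (glue R z1 z2 x)) =
        (\<lambda>x\<in>carrier A. hyp_eval T g u v (q x))"
      using B.extend_eval[OF T h(1) q] h by (auto simp: compose_def q_def intro!: restrict_ext)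
    then show ?thesis using khom_compose[OF glue_hom[OF R t z1 z2 comp BU] h(1) A] by simp
  qed
  have fT: "f T ((u, v), g) \<in> points Z T"
    and cf: "\<And>x. x \<in> carrier A \<Longrightarrow> coord T (f T ((u, v), g)) x = hyp_eval T g u v (q x)"
    if T: "T \<in> kalgs k" and P: "((u, v), g) \<in> ?P T" for T u v g
    using coord_\<zeta>[OF T khom_ev[OF T P]] T P by (simp_all add: f_def F_def)
  have "f \<in> Maps_Gm k (Spec k R) (Spec_over_A1 k R t) Z a"
    unfolding Maps_Gm_iff
  proof (intro conjI ballI allI impI)
    show "f \<in> (\<Pi>\<^sub>E T\<in>kalgs k. ?P T \<rightarrow>\<^sub>E points Z T)"
    proof (intro PiE_I)
      fix T x assume T: "T \<in> kalgs k" and x: "x \<in> ?P T"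
      obtain u v g where xe: "x = ((u, v), g)" by (metis surj_pair)
      show "f T x \<in> points Z T" using fT[OF T x[unfolded xe]] xe by simp
    qed (auto simp: f_def)
  next
    fix T T' h u v g
    assume T: "T \<in> kalgs k" "T' \<in> kalgs k" and h: "h \<in> khom k T T'" and P: "((u, v), g) \<in> ?P T"
    note P' = XS_Spec_push[OF R T h t P]
    interpret ev: hyp_evaluation R T g t u v by (rule ev[OF T(1) P])
    show "f T' ((h u, h v), on_hom (Spec k R) T T' h g) = on_hom Z T T' h (f T ((u, v), g))"
    proof (rule point_eqI[OF T(2)])
      show "f T' ((h u, h v), on_hom (Spec k R) T T' h g) \<in> points Z T'"
        using fT[OF T(2) P'] by (simp add: Spec_def)
      show "on_hom Z T T' h (f T ((u, v), g)) \<in> points Z T'"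
        by (rule kfunctor_closed[OF Z T h fT[OF T(1) P]])
      fix x assume x: "x \<in> carrier A"
      have "hyp_eval T' (compose (carrier R) h g) (h u) (h v) (q x) = h (hyp_eval T g u v (q x))"
        by (rule ev.hom_eval[symmetric, OF khom_ring_hom_ring[OF T h] q[OF x]]) (simp add: compose_eq)
      then show "coord T' (f T' ((h u, h v), on_hom (Spec k R) T T' h g)) x =
          coord T' (on_hom Z T T' h (f T ((u, v), g))) x"
        using cf[OF T(2) P' x] cf[OF T(1) P x] coord_natural[OF T h fT[OF T(1) P]] x
        by (simp add: Spec_def compose_eq)
    qed
  next
    fix T l u v g
    assume T: "T \<in> kalgs k" and l: "l \<in> Units T" and P: "((u, v), g) \<in> ?P T"
    note P' = X_act_closed(3)[OF T l P]
    interpret ev: hyp_evaluation R T g t u v by (rule ev[OF T P])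
    have lc: "l \<in> carrier T" "inv\<^bsub>T\<^esub> l \<in> carrier T" "l \<otimes>\<^bsub>T\<^esub> inv\<^bsub>T\<^esub> l = \<one>\<^bsub>T\<^esub>" using l by auto
    show "f T ((l \<otimes>\<^bsub>T\<^esub> u, inv\<^bsub>T\<^esub> l \<otimes>\<^bsub>T\<^esub> v), g) = a T (l, f T ((u, v), g))"
    proof (rule point_eqI[OF T fT[OF T P'] act_closed[OF T l fT[OF T P]]])
      fix x assume x: "x \<in> carrier A"
      have "g (q x n) \<otimes>\<^bsub>T\<^esub> hyp_pow T (l \<otimes>\<^bsub>T\<^esub> u) (inv\<^bsub>T\<^esub> l \<otimes>\<^bsub>T\<^esub> v) n =
          coord T (f T ((u, v), g)) (pr n x) \<otimes>\<^bsub>T\<^esub> hyp_pow T l (inv\<^bsub>T\<^esub> l) n" for n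
      proof -
        have "coord T (f T ((u, v), g)) (pr n x) = g (q x n) \<otimes>\<^bsub>T\<^esub> hyp_pow T u v n"
          unfolding cf[OF T P pr_closed[OF x]] using finsuppD(1)[OF q[OF x], of n]
          by (simp add: q_def glue_pr[OF R z1 z2 x] ev.eval_single)
        then show ?thesis
          unfolding ev.S.hyp_pow_distrib[OF lc(1,2) ev.u ev.v]
          using lc ev.u ev.v finsuppD(1)[OF q[OF x], of n] by (simp add: ev.S.m_ac)
      qed
      then show "coord T (f T ((l \<otimes>\<^bsub>T\<^esub> u, inv\<^bsub>T\<^esub> l \<otimes>\<^bsub>T\<^esub> v), g)) x = coord T (a T (l, f T ((u, v), g))) x"
        unfolding cf[OF T P' x] coord_act[OF T fT[OF T P] lc x] by (simp add: hyp_eval_def)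
    qed
  qed
  then have mem: "(t, f) \<in> points (Ztilde k Z a) R" using t by (simp add: points_Ztilde)
  note sp = section_points[OF R t]
  have "f R ((\<one>\<^bsub>R\<^esub>, t), kid R) = z1"
  proof (rule point_eqI[OF R fT[OF R sp(1)] z1])
    fix x assume x: "x \<in> carrier A"
    have "kid R (q x n) \<otimes>\<^bsub>R\<^esub> hyp_pow R \<one>\<^bsub>R\<^esub> t n = coord R z1 (pr n x)" for n
      using comp x finsuppD(1)[OF q[OF x], of n] t
      by (simp add: compatible_def q_def R.m_comm)
    then show "coord R (f R ((\<one>\<^bsub>R\<^esub>, t), kid R)) x = coord R z1 x"
      unfolding cf[OF R sp(1) x] hyp_eval_def by (simp add: fsum_pr[OF R z1 x])
  qed
  moreover have "f R ((t, \<one>\<^bsub>R\<^esub>), kid R) = z2"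
  proof (rule point_eqI[OF R fT[OF R sp(2)] z2])
    fix x assume x: "x \<in> carrier A"
    have "kid R (q x n) \<otimes>\<^bsub>R\<^esub> hyp_pow R t \<one>\<^bsub>R\<^esub> n = coord R z2 (pr n x)" for n
      using comp x finsuppD(1)[OF q[OF x], of n] t
      by (simp add: compatible_def q_def R.m_comm)
    then show "coord R (f R ((t, \<one>\<^bsub>R\<^esub>), kid R)) x = coord R z2 x"
      unfolding cf[OF R sp(2) x] hyp_eval_def by (simp add: fsum_pr[OF R z2 x])
  qed
  ultimately show ?thesis using mem by blast
qed

lemma ptilde_bij:
  assumes R: "R \<in> kalgs k"
  shows "bij_betw (ptilde k Z a R) (points (Ztilde k Z a) R)
    {(t, z1, z2) \<in> carrier R \<times> points Z R \<times> points Z R. compatible R t z1 z2}"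
proof (rule bij_betwI')
  fix q q' assume q: "q \<in> points (Ztilde k Z a) R" and q': "q' \<in> points (Ztilde k Z a) R"
  obtain t f t' f' where qe: "q = (t, f)" "q' = (t', f')" by (metis surj_pair)
  note p = ptilde_apply[OF R q[unfolded qe]] ptilde_apply[OF R q'[unfolded qe]]
  have "f = f'" if eq: "ptilde k Z a R q = ptilde k Z a R q'"
  proof -
    have tt: "t' = t" using eq p qe by simp
    note m = q[unfolded qe] q'[unfolded qe tt]
    have e: "f R ((\<one>\<^bsub>R\<^esub>, t), kid R) = f' R ((\<one>\<^bsub>R\<^esub>, t), kid R)"
      "f R ((t, \<one>\<^bsub>R\<^esub>), kid R) = f' R ((t, \<one>\<^bsub>R\<^esub>), kid R)"
      using eq p qe tt by simp_all
    have f: "f \<in> Maps_Gm k (Spec k R) (Spec_over_A1 k R t) Z a"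
      "f' \<in> Maps_Gm k (Spec k R) (Spec_over_A1 k R t) Z a"
      using m by (simp_all add: points_Ztilde)
    show ?thesis
    proof (rule Ztilde_point_eqI[OF m])
      fix T u v g assume T: "T \<in> kalgs k"
        and P: "((u, v), g) \<in> points (XS k (Spec k R) (Spec_over_A1 k R t)) T"
      show "f T ((u, v), g) = f' T ((u, v), g)"
        by (rule point_eqI[OF T Maps_Gm_closed[OF f(1) T P] Maps_Gm_closed[OF f(2) T P]])
          (simp add: Ztilde_coord(2)[OF R m(1) refl refl T P] Ztilde_coord(2)[OF R m(2) refl refl T P] e)
    qed
  qed
  then show "(ptilde k Z a R q = ptilde k Z a R q') = (q = q')" using p qe by auto
next
  fix q assume q: "q \<in> points (Ztilde k Z a) R"
  obtain t f where qe: "q = (t, f)" by (metis surj_pair)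
  note q' = q[unfolded qe]
  show "ptilde k Z a R q \<in> {(t, z1, z2) \<in> carrier R \<times> points Z R \<times> points Z R. compatible R t z1 z2}"
    using ptilde_closed[OF R q'] ptilde_apply[OF R q'] Ztilde_coord(1)[OF R q' refl refl] qe by simp
next
  fix y assume "y \<in> {(t, z1, z2) \<in> carrier R \<times> points Z R \<times> points Z R. compatible R t z1 z2}"
  then obtain t z1 z2 where y: "y = (t, z1, z2)" "t \<in> carrier R" "z1 \<in> points Z R" "z2 \<in> points Z R"
    "compatible R t z1 z2" by auto
  obtain f where f: "(t, f) \<in> points (Ztilde k Z a) R" "f R ((\<one>\<^bsub>R\<^esub>, t), kid R) = z1"
    "f R ((t, \<one>\<^bsub>R\<^esub>), kid R) = z2"
    using Ztilde_point_exists[OF R y(2-)] by blast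
  show "\<exists>q\<in>points (Ztilde k Z a) R. y = ptilde k Z a R q"
    by (rule bexI[OF _ f(1)]) (simp add: ptilde_apply[OF R f(1)] f y)
qed

end

section \<open>Closedness and representability\<close>

definition product_algebra :: "'j set \<Rightarrow> ('j \<Rightarrow> 'u alg) \<Rightarrow> ('u, 'j \<Rightarrow> 'u) module" where
  "product_algebra J R =
     \<lparr> carrier = (\<Pi>\<^sub>E j\<in>J. carrier (R j)), monoid.mult = (\<lambda>x y. \<lambda>j\<in>J. x j \<otimes>\<^bsub>R j\<^esub> y j),
       one = (\<lambda>j\<in>J. \<one>\<^bsub>R j\<^esub>), zero = (\<lambda>j\<in>J. \<zero>\<^bsub>R j\<^esub>),
       add = (\<lambda>x y. \<lambda>j\<in>J. x j \<oplus>\<^bsub>R j\<^esub> y j), smult = (\<lambda>c x. \<lambda>j\<in>J. c \<odot>\<^bsub>R j\<^esub> x j) \<rparr>"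

lemma product_algebra_simps [simp]:
  "carrier (product_algebra J R) = (\<Pi>\<^sub>E j\<in>J. carrier (R j))"
  "monoid.mult (product_algebra J R) = (\<lambda>x y. \<lambda>j\<in>J. x j \<otimes>\<^bsub>R j\<^esub> y j)"
  "one (product_algebra J R) = (\<lambda>j\<in>J. \<one>\<^bsub>R j\<^esub>)"
  "zero (product_algebra J R) = (\<lambda>j\<in>J. \<zero>\<^bsub>R j\<^esub>)"
  "add (product_algebra J R) = (\<lambda>x y. \<lambda>j\<in>J. x j \<oplus>\<^bsub>R j\<^esub> y j)"
  "smult (product_algebra J R) = (\<lambda>c x. \<lambda>j\<in>J. c \<odot>\<^bsub>R j\<^esub> x j)"
  by (simp_all add: product_algebra_def)

lemma product_algebra_algebra:
  assumes k: "cring k" and R: "\<And>j. j \<in> J \<Longrightarrow> R j \<in> kalgs k"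
  shows "algebra k (product_algebra J R)"
proof -
  let ?Q = "product_algebra J R"
  have alg: "algebra k (R j)" if "j \<in> J" for j using R[OF that] by (simp add: kalgs_def)
  have cr: "cring (R j)" if "j \<in> J" for j using algebra.M_cring[OF alg[OF that]] .
  have ab: "abelian_group (R j)" if "j \<in> J" for j
    using cr[OF that] by (simp add: cring_def ring_def)
  have am: "abelian_monoid (R j)" if "j \<in> J" for j
    using ab[OF that] by (simp add: abelian_group_def)
  have cm: "Group.comm_monoid (R j)" if "j \<in> J" for j
    using cr[OF that] by (simp add: cring_def)
  have mo: "Group.monoid (R j)" if "j \<in> J" for j
    using cm[OF that] by (simp add: Group.comm_monoid_def)
  have md: "module k (R j)" if "j \<in> J" for j
    using alg[OF that] by (simp add: algebra_def)
  show ?thesis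
  proof (rule algebraI)
    show "cring ?Q"
    proof (rule cringI)
      show "abelian_group ?Q"
      proof (rule abelian_groupI)
        fix x assume x: "x \<in> carrier ?Q"
        then have "(\<lambda>j\<in>J. \<ominus>\<^bsub>R j\<^esub> x j) \<in> carrier ?Q" using ab by (auto simp: PiE_iff abelian_group.a_inv_closed)
        moreover have "(\<lambda>j\<in>J. \<ominus>\<^bsub>R j\<^esub> x j) \<oplus>\<^bsub>?Q\<^esub> x = \<zero>\<^bsub>?Q\<^esub>"
          using x ab by (auto simp: PiE_iff abelian_group.l_neg)
        ultimately show "\<exists>y\<in>carrier ?Q. y \<oplus>\<^bsub>?Q\<^esub> x = \<zero>\<^bsub>?Q\<^esub>" by blast
      qed (use am in \<open>auto simp: PiE_iff abelian_monoid.a_closed abelian_monoid.zero_closed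
            abelian_monoid.l_zero abelian_monoid.r_zero abelian_monoid.a_assoc
            abelian_monoid.a_comm abelian_monoid.a_lcomm fun_eq_iff extensional_def\<close>)
      show "Group.comm_monoid ?Q"
        by (rule comm_monoidI)
          (use mo cm in \<open>auto simp: PiE_iff monoid.m_closed monoid.one_closed monoid.m_assoc monoid.l_one
             monoid.r_one comm_monoid.m_comm comm_monoid.m_lcomm fun_eq_iff extensional_def\<close>)
    qed (use cr in \<open>auto simp: PiE_iff cring_def ring.ring_simprules(13) fun_eq_iff\<close>)
  qed (use k md alg in \<open>auto simp: PiE_iff module.smult_closed[OF md] module.smult_l_distr[OF md]
      module.smult_r_distr[OF md] module.smult_assoc1[OF md] module.smult_one[OF md] algebra.smult_assoc2[OF alg] fun_eq_iff extensional_def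
      abelian_monoid.a_closed[OF am] monoid.m_closed[OF mo]\<close>)
qed

context affine_Gm_scheme
begin

lemma glue_natural:
  assumes R: "R \<in> kalgs k" and T: "T \<in> kalgs k" and h: "h \<in> khom k R T"
    and z: "z1 \<in> points Z R" "z2 \<in> points Z R" and x: "x \<in> carrier A"
  shows "glue T (on_hom Z R T h z1) (on_hom Z R T h z2) x n = h (glue R z1 z2 x n)"
  using coord_natural[OF R T h] z pr_closed[OF x] by (simp add: glue_def compose_eq)

text \<open>
  After a change of rings, compatibility is the image under \<open>h\<close> of the equations over \<open>R\<close>.
\<close>

lemma compatible_push:
  assumes R: "R \<in> kalgs k" and T: "T \<in> kalgs k" and h: "h \<in> khom k R T"
    and t: "t \<in> carrier R" and z1: "z1 \<in> points Z R" and z2: "z2 \<in> points Z R"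
  shows "compatible T (h t) (on_hom Z R T h z1) (on_hom Z R T h z2) \<longleftrightarrow> (\<forall>x\<in>carrier A. \<forall>n.
     h (coord R z1 (pr n x)) = h (hyp_pow R \<one>\<^bsub>R\<^esub> t n \<otimes>\<^bsub>R\<^esub> glue R z1 z2 x n) \<and>
     h (coord R z2 (pr n x)) = h (hyp_pow R t \<one>\<^bsub>R\<^esub> n \<otimes>\<^bsub>R\<^esub> glue R z1 z2 x n))"
proof -
  interpret h: ring_hom_cring R T h by (rule khom_ring_hom_cring[OF R T h])
  have "hyp_pow T \<one>\<^bsub>T\<^esub> (h t) n = h (hyp_pow R \<one>\<^bsub>R\<^esub> t n)" "hyp_pow T (h t) \<one>\<^bsub>T\<^esub> n = h (hyp_pow R t \<one>\<^bsub>R\<^esub> n)" for n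
    using hyp_pow_hom[OF khom_ring_hom_ring[OF R T h], of _ _ n] t by simp_all
  then show ?thesis
    unfolding compatible_def
    using t finsuppD(1)[OF glue_finsupp[OF R z1 z2]] pr_closed coord_natural[OF R T h z1]
      coord_natural[OF R T h z2] glue_natural[OF R T h z1 z2]
    by (simp add: compose_eq)
qed

lemma compatible_ideal:
  assumes R: "R \<in> kalgs k" and t: "t \<in> carrier R" and z1: "z1 \<in> points Z R" and z2: "z2 \<in> points Z R"
  shows "\<exists>I. ideal I R \<and> (\<forall>T\<in>kalgs k. \<forall>h\<in>khom k R T.
    (\<forall>b\<in>I. h b = \<zero>\<^bsub>T\<^esub>) \<longleftrightarrow> compatible T (h t) (on_hom Z R T h z1) (on_hom Z R T h z2))"
proof -
  interpret R: cring R by (rule kalgs_cring[OF R])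
  define eqs where "eqs = {(coord R z1 (pr n x), hyp_pow R \<one>\<^bsub>R\<^esub> t n \<otimes>\<^bsub>R\<^esub> glue R z1 z2 x n) | x n. x \<in> carrier A} \<union>
    {(coord R z2 (pr n x), hyp_pow R t \<one>\<^bsub>R\<^esub> n \<otimes>\<^bsub>R\<^esub> glue R z1 z2 x n) | x n. x \<in> carrier A}"
  have eqs: "p \<in> carrier R \<and> q \<in> carrier R" if "(p, q) \<in> eqs" for p q
    using that finsuppD(1)[OF glue_finsupp[OF R z1 z2]] finsuppD(1)[OF coord_pr_finsupp[OF R z1]]
      finsuppD(1)[OF coord_pr_finsupp[OF R z2]] t
    unfolding eqs_def by (elim UnE CollectE exE conjE) simp_all
  define E where "E = (\<lambda>(p, q). p \<ominus>\<^bsub>R\<^esub> q) ` eqs"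
  have E: "E \<subseteq> carrier R" using eqs R.minus_closed by (auto simp only: E_def)
  have "(\<forall>b\<in>genideal R E. h b = \<zero>\<^bsub>T\<^esub>) \<longleftrightarrow> compatible T (h t) (on_hom Z R T h z1) (on_hom Z R T h z2)"
    if T: "T \<in> kalgs k" and h: "h \<in> khom k R T" for T h
  proof -
    interpret h: ring_hom_ring R T h by (rule khom_ring_hom_ring[OF R T h])
    have ker: "b \<in> a_kernel R T h \<longleftrightarrow> b \<in> carrier R \<and> h b = \<zero>\<^bsub>T\<^esub>" for b
      unfolding a_kernel_def' by (rule mem_Collect_eq)
    have diff: "h (p \<ominus>\<^bsub>R\<^esub> q) = \<zero>\<^bsub>T\<^esub> \<longleftrightarrow> h p = h q" if pq: "p \<in> carrier R" "q \<in> carrier R" for p q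
    proof -
      have "h (p \<ominus>\<^bsub>R\<^esub> q) = h p \<ominus>\<^bsub>T\<^esub> h q"
        unfolding a_minus_def using pq by (simp only: h.hom_add h.hom_a_inv R.a_inv_closed)
      then show ?thesis
        using h.S.r_right_minus_eq[OF h.hom_closed[OF pq(1)] h.hom_closed[OF pq(2)]] by (simp only:)
    qed
    have "(\<forall>b\<in>genideal R E. h b = \<zero>\<^bsub>T\<^esub>) \<longleftrightarrow> (\<forall>b\<in>E. h b = \<zero>\<^bsub>T\<^esub>)"
    proof
      assume "\<forall>b\<in>E. h b = \<zero>\<^bsub>T\<^esub>"
      then have "E \<subseteq> a_kernel R T h" using E ker by blast
      then have "genideal R E \<subseteq> a_kernel R T h" by (rule R.genideal_minimal[OF h.kernel_is_ideal])
      then show "\<forall>b\<in>genideal R E. h b = \<zero>\<^bsub>T\<^esub>" using ker by blast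
    next
      assume "\<forall>b\<in>genideal R E. h b = \<zero>\<^bsub>T\<^esub>"
      then show "\<forall>b\<in>E. h b = \<zero>\<^bsub>T\<^esub>" using R.genideal_self[OF E] by blast
    qed
    also have "\<dots> \<longleftrightarrow> (\<forall>(p, q)\<in>eqs. h p = h q)"
      unfolding E_def ball_simps(9) using diff eqs by (auto simp only: intro!: ball_cong)
    also have "\<dots> \<longleftrightarrow> compatible T (h t) (on_hom Z R T h z1) (on_hom Z R T h z2)"
      unfolding compatible_push[OF R T h t z1 z2] eqs_def ball_Un by blast
    finally show ?thesis .
  qed
  then show ?thesis by (intro exI[of _ "genideal R E"] conjI R.genideal_ideal[OF E] ballI)
qed

lemma ptilde_natural:
  assumes "R \<in> kalgs k" "T \<in> kalgs k" "h \<in> khom k R T" "q \<in> points (Ztilde k Z a) R"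
  shows "ptilde k Z a T (on_hom (Ztilde k Z a) R T h q) = on_hom (A1 \<times>\<^sub>k Z \<times>\<^sub>k Z) R T h (ptilde k Z a R q)"
  using ptilde_kmaps[of k Z a] assms unfolding kmaps_def by blast

lemma closed_embedding_ptilde: "closed_embedding k (Ztilde k Z a) (A1 \<times>\<^sub>k Z \<times>\<^sub>k Z) (ptilde k Z a)"
  unfolding closed_embedding_def
proof (intro conjI ballI)
  show "kfunctor k (Ztilde k Z a)" by (rule kfunctor_Ztilde)
  show "kfunctor k (A1 \<times>\<^sub>k Z \<times>\<^sub>k Z)" by (rule kfunctor_A1ZZ[OF Z])
  show "ptilde k Z a \<in> kmaps k (Ztilde k Z a) (A1 \<times>\<^sub>k Z \<times>\<^sub>k Z)" by (rule ptilde_kmaps)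
  fix R y assume R: "R \<in> kalgs k" and y: "y \<in> points (A1 \<times>\<^sub>k Z \<times>\<^sub>k Z) R"
  obtain t z1 z2 where ye: "y = (t, z1, z2)" by (metis surj_pair)
  have y': "t \<in> carrier R" "z1 \<in> points Z R" "z2 \<in> points Z R" using y ye by (simp_all add: A1ZZ_simps)
  obtain I where I: "ideal I R" "\<And>T h. T \<in> kalgs k \<Longrightarrow> h \<in> khom k R T \<Longrightarrow>
    (\<forall>b\<in>I. h b = \<zero>\<^bsub>T\<^esub>) \<longleftrightarrow> compatible T (h t) (on_hom Z R T h z1) (on_hom Z R T h z2)"
    using compatible_ideal[OF R y'] by blast
  have "bij_betw snd
      (points (fibre_product (Ztilde k Z a) (ptilde k Z a) (Spec k R) (point_map k (A1 \<times>\<^sub>k Z \<times>\<^sub>k Z) R y)) T)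
      {h \<in> khom k R T. \<forall>b\<in>I. h b = \<zero>\<^bsub>T\<^esub>}" (is "bij_betw snd ?F ?K") if T: "T \<in> kalgs k" for T
  proof -
    have F: "?F = {(q, h). q \<in> points (Ztilde k Z a) T \<and> h \<in> khom k R T \<and>
        ptilde k Z a T q = (h t, on_hom Z R T h z1, on_hom Z R T h z2)}"
      using T by (auto simp: fibre_product_def Spec_def point_map_def A1ZZ_simps ye)
    note bij = ptilde_bij[OF T]
    show ?thesis
    proof (rule bij_betwI')
      fix p p' assume "p \<in> ?F" "p' \<in> ?F"
      then have "fst p \<in> points (Ztilde k Z a) T" "fst p' \<in> points (Ztilde k Z a) T"
        "snd p = snd p' \<Longrightarrow> ptilde k Z a T (fst p) = ptilde k Z a T (fst p')"
        by (auto simp: F)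
      then have "snd p = snd p' \<Longrightarrow> fst p = fst p'"
        by (intro inj_onD[OF bij_betw_imp_inj_on[OF bij]])
      then show "snd p = snd p' \<longleftrightarrow> p = p'" by (auto simp: prod_eq_iff[of p])
    next
      fix p assume "p \<in> ?F"
      then show "snd p \<in> ?K"
        using bij_betwE[OF bij] I(2)[OF T] by (fastforce simp: F)
    next
      fix h assume h: "h \<in> ?K"
      then have "(h t, on_hom Z R T h z1, on_hom Z R T h z2) \<in> ptilde k Z a T ` points (Ztilde k Z a) T"
        using bij_betw_imp_surj_on[OF bij] I(2)[OF T] y' khom_closed kfunctor_closed[OF Z R T] by auto
      then show "\<exists>p\<in>?F. h = snd p" using h by (force simp: F)
    qed
  qed
  then show "\<exists>I. ideal I R \<and> (\<forall>T\<in>kalgs k. bij_betw snd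
      (points (fibre_product (Ztilde k Z a) (ptilde k Z a) (Spec k R) (point_map k (A1 \<times>\<^sub>k Z \<times>\<^sub>k Z) R y)) T)
      {h \<in> khom k R T. \<forall>b\<in>I. h b = \<zero>\<^bsub>T\<^esub>})"
    using I(1) by blast
qed

text \<open>
  Compatible triples are defined by equations, hence the product of all test algebras, with one
  factor for each compatible triple, carries a tautological compatible triple \<open>(\<tau>, Y1, Y2)\<close>.  The
  subalgebra generated by its coordinates still maps to each factor, and homomorphisms from it are
  determined by the triple.  It is generated over \<open>k\<close> by \<open>\<tau>\<close> and by the values of \<open>Y1\<close> and \<open>Y2\<close> at
  finitely many generators of \<open>A\<close>, so it has a copy \<open>D\<close> in the universe.
\<close>

lemma universal_compatible_triple:
  assumes fg: "finitely_generated_algebra k A"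
  obtains D t z1 z2 where "D \<in> kalgs k" "finitely_generated_algebra k D"
    "t \<in> carrier D" "z1 \<in> points Z D" "z2 \<in> points Z D" "compatible D t z1 z2"
    "\<And>T s w1 w2. T \<in> kalgs k \<Longrightarrow> s \<in> carrier T \<Longrightarrow> w1 \<in> points Z T \<Longrightarrow> w2 \<in> points Z T \<Longrightarrow>
      compatible T s w1 w2 \<Longrightarrow>
      \<exists>!h. h \<in> khom k D T \<and> h t = s \<and> on_hom Z D T h z1 = w1 \<and> on_hom Z D T h z2 = w2"
proof -
  interpret AA: algebra k A using A by (simp add: kalgs_def)
  obtain G where G: "finite G" "G \<subseteq> carrier A"
    "carrier A = generate_ring A ((\<lambda>c. c \<odot>\<^bsub>A\<^esub> \<one>\<^bsub>A\<^esub>) ` carrier k \<union> G)"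
    using fg by (auto simp: finitely_generated_algebra_def)
  define J where "J = {(R, t, z1, z2). R \<in> kalgs k \<and> t \<in> carrier R \<and> z1 \<in> points Z R \<and> z2 \<in> points Z R \<and>
    compatible R t z1 z2}"
  define alg :: "'u alg \<times> 'u \<times> 'z \<times> 'z \<Rightarrow> 'u alg" where "alg = fst"
  let ?Q = "product_algebra J alg"
  define \<tau> where "\<tau> = (\<lambda>j\<in>J. fst (snd j))"
  define Y1 where "Y1 = (\<lambda>x. \<lambda>j\<in>J. coord (alg j) (fst (snd (snd j))) x)"
  define Y2 where "Y2 = (\<lambda>x. \<lambda>j\<in>J. coord (alg j) (snd (snd (snd j))) x)"
  have J: "alg j \<in> kalgs k" "fst (snd j) \<in> carrier (alg j)" "fst (snd (snd j)) \<in> points Z (alg j)"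
    "snd (snd (snd j)) \<in> points Z (alg j)"
    "compatible (alg j) (fst (snd j)) (fst (snd (snd j))) (snd (snd (snd j)))" if "j \<in> J" for j
    using that by (auto simp: J_def alg_def)
  have cj: "coord (alg j) (fst (snd (snd j))) \<in> khom k A (alg j)" "coord (alg j) (snd (snd (snd j))) \<in> khom k A (alg j)"
    if "j \<in> J" for j
    using J[OF that] coord_khom by auto
  have Q: "algebra k ?Q" by (rule product_algebra_algebra[OF AA.R_cring J(1)])
  interpret Q: algebra k ?Q by (rule Q)
  define G' where "G' = insert \<tau> (Y1 ` G \<union> Y2 ` G)"
  have Y_closed: "Y1 x \<in> carrier ?Q" "Y2 x \<in> carrier ?Q" if "x \<in> carrier A" for x
    using khom_closed[OF cj(1) that] khom_closed[OF cj(2) that] by (auto simp: Y1_def Y2_def)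
  have "\<tau> \<in> carrier ?Q" using J(2) by (auto simp: \<tau>_def)
  then have "finite G'" "G' \<subseteq> carrier ?Q"
    using G(1,2) Y_closed by (auto simp: G'_def simp del: product_algebra_simps)
  note copy = finitely_generated_copy_in_universe[OF inf Q this]
  define S where "S = generate_ring ?Q ((\<lambda>c. c \<odot>\<^bsub>?Q\<^esub> \<one>\<^bsub>?Q\<^esub>) ` carrier k \<union> G')"
  obtain D and e :: "_ \<Rightarrow> 'u" where MS: "algebra k (?Q\<lparr>carrier := S\<rparr>)" and D: "D \<in> kalgs k"
    and e: "bij_betw e S (carrier D)" "e \<in> ring_hom (?Q\<lparr>carrier := S\<rparr>) D"
      "\<And>c x. x \<in> S \<Longrightarrow> e (c \<odot>\<^bsub>?Q\<^esub> x) = c \<odot>\<^bsub>D\<^esub> e x"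
    and gen: "carrier D = generate_ring D ((\<lambda>c. c \<odot>\<^bsub>D\<^esub> \<one>\<^bsub>D\<^esub>) ` carrier k \<union> e ` G')"
    using copy[folded S_def] by blast
  interpret Dr: cring D by (rule kalgs_cring[OF D])
  have SQ: "S \<subseteq> carrier ?Q"
    unfolding S_def
    by (rule Q.generate_ring_incl)
      (use \<open>G' \<subseteq> carrier ?Q\<close> in \<open>auto simp del: product_algebra_simps\<close>)
  have S_ops: "x \<otimes>\<^bsub>?Q\<^esub> y \<in> S" "x \<oplus>\<^bsub>?Q\<^esub> y \<in> S" if "x \<in> S" "y \<in> S" for x y
    using that generate_ring.eng_mult generate_ring.eng_add unfolding S_def by metis+
  have S_one: "\<one>\<^bsub>?Q\<^esub> \<in> S" unfolding S_def by (rule generate_ring.one)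
  have S_smult: "c \<odot>\<^bsub>?Q\<^esub> x \<in> S" if "c \<in> carrier k" "x \<in> S" for c x
    using algebra.axioms(1)[OF MS] module.smult_closed that by fastforce
  have e_ops: "e (x \<otimes>\<^bsub>?Q\<^esub> y) = e x \<otimes>\<^bsub>D\<^esub> e y" "e (x \<oplus>\<^bsub>?Q\<^esub> y) = e x \<oplus>\<^bsub>D\<^esub> e y"
    if "x \<in> S" "y \<in> S" for x y
    using ring_hom_memE(2,3)[OF e(2)] that by simp_all
  have e_one: "e \<one>\<^bsub>?Q\<^esub> = \<one>\<^bsub>D\<^esub>" using ring_hom_memE(4)[OF e(2)] by simp
  have e_closed: "e x \<in> carrier D" if "x \<in> S" for x using bij_betwE[OF e(1)] that by blast
  \<comment> \<open>The projection of \<open>D\<close> to the test algebra with index \<open>j\<close>.\<close>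
  define \<pi> where "\<pi> = (\<lambda>j. \<lambda>d\<in>carrier D. inv_into S e d j)"
  have \<pi>e: "\<pi> j (e x) = x j" if "x \<in> S" for j x
    using e(1) that by (simp add: \<pi>_def bij_betw_def inv_into_f_f e_closed)
  have \<pi>: "\<pi> j \<in> khom k D (alg j)" if j: "j \<in> J" for j
  proof (rule khomI)
    have De: "\<exists>x\<in>S. d = e x" if "d \<in> carrier D" for d
      using e(1) that by (auto simp: bij_betw_def)
    show "\<pi> j \<in> ring_hom D (alg j)"
    proof (rule ring_hom_memI)
      fix d d' assume "d \<in> carrier D" "d' \<in> carrier D"
      then obtain x x' where x: "d = e x" "x \<in> S" "d' = e x'" "x' \<in> S" using De by blast
      show "\<pi> j d \<in> carrier (alg j)" using x SQ j by (auto simp: \<pi>e)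
      show "\<pi> j (d \<otimes>\<^bsub>D\<^esub> d') = \<pi> j d \<otimes>\<^bsub>alg j\<^esub> \<pi> j d'"
        using \<pi>e[OF S_ops(1)[OF x(2,4)], of j] x j by (simp add: e_ops[symmetric] \<pi>e del: product_algebra_simps) simp
      show "\<pi> j (d \<oplus>\<^bsub>D\<^esub> d') = \<pi> j d \<oplus>\<^bsub>alg j\<^esub> \<pi> j d'"
        using \<pi>e[OF S_ops(2)[OF x(2,4)], of j] x j by (simp add: e_ops[symmetric] \<pi>e del: product_algebra_simps) simp
    next
      show "\<pi> j \<one>\<^bsub>D\<^esub> = \<one>\<^bsub>alg j\<^esub>" using \<pi>e[OF S_one, of j] j e_one by simp
    qed
    fix c d assume c: "c \<in> carrier k" "d \<in> carrier D"
    then obtain x where x: "d = e x" "x \<in> S" using De by blast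
    show "\<pi> j (c \<odot>\<^bsub>D\<^esub> d) = c \<odot>\<^bsub>alg j\<^esub> \<pi> j d"
      using \<pi>e[OF S_smult[OF c(1) x(2)], of j] x j e(3)[OF x(2), of c] by (simp add: \<pi>e)
  qed (simp add: \<pi>_def)
  have joint: "d = d'" if d: "d \<in> carrier D" "d' \<in> carrier D" and eq: "\<And>j. j \<in> J \<Longrightarrow> \<pi> j d = \<pi> j d'" for d d'
  proof -
    have "d \<in> e ` S" "d' \<in> e ` S" using d bij_betw_imp_surj_on[OF e(1)] by simp_all
    then obtain x x' where x: "d = e x" "x \<in> S" "d' = e x'" "x' \<in> S" by (elim imageE)
    have "x = x'"
    proof (rule PiE_ext[of _ J "\<lambda>j. carrier (alg j)"])
      show "x \<in> (\<Pi>\<^sub>E j\<in>J. carrier (alg j))" "x' \<in> (\<Pi>\<^sub>E j\<in>J. carrier (alg j))" using x SQ by auto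
      show "x j = x' j" if "j \<in> J" for j
        using eq[OF that] \<pi>e[OF x(2), of j] \<pi>e[OF x(4), of j] x(1,3) by simp
    qed
    then show ?thesis using x by simp
  qed
  have Y_S: "Y1 x \<in> S \<and> Y2 x \<in> S" if "x \<in> carrier A" for x
  proof -
    have "x \<in> generate_ring A ((\<lambda>c. c \<odot>\<^bsub>A\<^esub> \<one>\<^bsub>A\<^esub>) ` carrier k \<union> G)" using that G(3) by simp
    then show ?thesis
    proof induction
      case one
      have "Y1 \<one>\<^bsub>A\<^esub> = \<one>\<^bsub>?Q\<^esub>" "Y2 \<one>\<^bsub>A\<^esub> = \<one>\<^bsub>?Q\<^esub>"
        using khom_one[OF cj(1)] khom_one[OF cj(2)] by (auto simp: Y1_def Y2_def intro!: restrict_ext)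
      then show ?case using S_one by (simp only: simp_thms)
    next
      case (incl x)
      then show ?case
      proof
        assume "x \<in> (\<lambda>c. c \<odot>\<^bsub>A\<^esub> \<one>\<^bsub>A\<^esub>) ` carrier k"
        then obtain c where c: "c \<in> carrier k" "x = c \<odot>\<^bsub>A\<^esub> \<one>\<^bsub>A\<^esub>" by blast
        have "Y1 x = c \<odot>\<^bsub>?Q\<^esub> \<one>\<^bsub>?Q\<^esub>" "Y2 x = c \<odot>\<^bsub>?Q\<^esub> \<one>\<^bsub>?Q\<^esub>"
          using c khom_smult[OF cj(1)] khom_smult[OF cj(2)] khom_one[OF cj(1)] khom_one[OF cj(2)]
          by (auto simp: Y1_def Y2_def intro!: restrict_ext)
        then show ?thesis using S_smult[OF c(1) S_one] by (simp only: simp_thms)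
      next
        assume "x \<in> G"
        then show ?thesis unfolding S_def G'_def by (blast intro: generate_ring.incl)
      qed
    next
      case (a_inv x)
      have xA: "x \<in> carrier A" using a_inv(1) G(3) by simp
      have "Y1 (\<ominus>\<^bsub>A\<^esub> x) = (\<lambda>j\<in>J. \<ominus>\<^bsub>alg j\<^esub> Y1 x j)" "Y2 (\<ominus>\<^bsub>A\<^esub> x) = (\<lambda>j\<in>J. \<ominus>\<^bsub>alg j\<^esub> Y2 x j)"
        using khom_a_inv[OF A J(1) cj(1) xA] khom_a_inv[OF A J(1) cj(2) xA]
        by (auto simp: Y1_def Y2_def intro!: restrict_ext)
      moreover have "(\<lambda>j\<in>J. \<ominus>\<^bsub>alg j\<^esub> y j) = \<ominus>\<^bsub>?Q\<^esub> y" if y: "y \<in> carrier ?Q" for y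
      proof -
        have ab: "abelian_group (alg j)" if "j \<in> J" for j
          using kalgs_cring[OF J(1)[OF that]] by (simp add: cring_def ring_def)
        have "(\<lambda>j\<in>J. \<ominus>\<^bsub>alg j\<^esub> y j) \<in> carrier ?Q"
          using y ab by (auto simp: PiE_iff abelian_group.a_inv_closed)
        moreover have "(\<lambda>j\<in>J. \<ominus>\<^bsub>alg j\<^esub> y j) \<oplus>\<^bsub>?Q\<^esub> y = \<zero>\<^bsub>?Q\<^esub>"
          using y ab by (auto simp: PiE_iff abelian_group.l_neg)
        ultimately show ?thesis using y by (intro Q.minus_equality[symmetric])
      qed
      ultimately show ?case
        using a_inv(2) Y_closed[OF xA] unfolding S_def by (auto intro: generate_ring.a_inv simp del: product_algebra_simps)
    next
      case (eng_add x y)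
      have xA: "x \<in> carrier A" "y \<in> carrier A" using eng_add(1,2) G(3) by simp_all
      have "Y1 (x \<oplus>\<^bsub>A\<^esub> y) = Y1 x \<oplus>\<^bsub>?Q\<^esub> Y1 y" "Y2 (x \<oplus>\<^bsub>A\<^esub> y) = Y2 x \<oplus>\<^bsub>?Q\<^esub> Y2 y"
        using khom_add[OF cj(1) xA] khom_add[OF cj(2) xA] by (auto simp: Y1_def Y2_def intro!: restrict_ext)
      then show ?case using eng_add(3,4) S_ops by (simp only: simp_thms)
    next
      case (eng_mult x y)
      have xA: "x \<in> carrier A" "y \<in> carrier A" using eng_mult(1,2) G(3) by simp_all
      have "Y1 (x \<otimes>\<^bsub>A\<^esub> y) = Y1 x \<otimes>\<^bsub>?Q\<^esub> Y1 y" "Y2 (x \<otimes>\<^bsub>A\<^esub> y) = Y2 x \<otimes>\<^bsub>?Q\<^esub> Y2 y"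
        using khom_mult[OF cj(1) xA] khom_mult[OF cj(2) xA] by (auto simp: Y1_def Y2_def intro!: restrict_ext)
      then show ?case using eng_mult(3,4) S_ops by (simp only: simp_thms)
    qed
  qed
  define y1 where "y1 = (\<lambda>x\<in>carrier A. e (Y1 x))"
  define y2 where "y2 = (\<lambda>x\<in>carrier A. e (Y2 x))"
  have \<pi>y: "\<pi> j (y1 x) = coord (alg j) (fst (snd (snd j))) x" "\<pi> j (y2 x) = coord (alg j) (snd (snd (snd j))) x"
    if "j \<in> J" "x \<in> carrier A" for j x
    using that Y_S by (simp_all add: y1_def y2_def \<pi>e, simp_all add: Y1_def Y2_def)
  have y_closed: "y1 x \<in> carrier D" "y2 x \<in> carrier D" if "x \<in> carrier A" for x
    using that Y_S e_closed by (simp_all add: y1_def y2_def)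
  \<comment> \<open>A map into \<open>D\<close> is a homomorphism as soon as its projections to all factors are.\<close>
  have khom_y: "y \<in> khom k A D"
    if ext: "y \<in> extensional (carrier A)" and cl: "\<And>x. x \<in> carrier A \<Longrightarrow> y x \<in> carrier D"
      and w: "\<And>j x. j \<in> J \<Longrightarrow> x \<in> carrier A \<Longrightarrow> \<pi> j (y x) = w j x" "\<And>j. j \<in> J \<Longrightarrow> w j \<in> khom k A (alg j)" for y w
  proof (rule khomI[OF _ ext])
    interpret DA: algebra k D using D by (simp add: kalgs_def)
    show "y \<in> ring_hom A D"
    proof (rule ring_hom_memI)
      fix x x' assume x: "x \<in> carrier A" "x' \<in> carrier A"
      show "y (x \<otimes>\<^bsub>A\<^esub> x') = y x \<otimes>\<^bsub>D\<^esub> y x'"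
        by (rule joint) (use x cl w khom_mult[OF \<pi>] khom_mult[OF w(2)] in simp_all)
      show "y (x \<oplus>\<^bsub>A\<^esub> x') = y x \<oplus>\<^bsub>D\<^esub> y x'"
        by (rule joint) (use x cl w khom_add[OF \<pi>] khom_add[OF w(2)] in simp_all)
    next
      show "y \<one>\<^bsub>A\<^esub> = \<one>\<^bsub>D\<^esub>"
        by (rule joint) (use cl w khom_one[OF \<pi>] khom_one[OF w(2)] in simp_all)
    qed (rule cl)
    fix c x assume c: "c \<in> carrier k" "x \<in> carrier A"
    show "y (c \<odot>\<^bsub>A\<^esub> x) = c \<odot>\<^bsub>D\<^esub> y x"
      by (rule joint) (use c cl w khom_smult[OF \<pi>] khom_smult[OF w(2)] in simp_all)
  qed
  have y_ext: "y1 \<in> extensional (carrier A)" "y2 \<in> extensional (carrier A)"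
    by (simp_all only: y1_def y2_def restrict_extensional)
  have y: "y1 \<in> khom k A D" by (rule khom_y[OF y_ext(1) y_closed(1) \<pi>y(1) cj(1)])
  have y': "y2 \<in> khom k A D" by (rule khom_y[OF y_ext(2) y_closed(2) \<pi>y(2) cj(2)])
  define t where "t = e \<tau>"
  define z1 where "z1 = \<zeta> D y1"
  define z2 where "z2 = \<zeta> D y2"
  note z = coord_\<zeta>[OF D y, folded z1_def] coord_\<zeta>[OF D y', folded z2_def]
  have \<tau>S: "\<tau> \<in> S" unfolding S_def G'_def by (blast intro: generate_ring.incl)
  then have t: "t \<in> carrier D" by (simp add: t_def e_closed)
  have \<pi>t: "\<pi> j t = fst (snd j)" if "j \<in> J" for j
    using that \<pi>e[OF \<tau>S] by (simp add: t_def \<tau>_def)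
  have \<pi>z: "on_hom Z D (alg j) (\<pi> j) z1 = fst (snd (snd j))" "on_hom Z D (alg j) (\<pi> j) z2 = snd (snd (snd j))"
    if j: "j \<in> J" for j
    by (rule point_eqI[OF J(1)[OF j] kfunctor_closed[OF Z D J(1)[OF j] \<pi>[OF j]]];
        simp add: z J[OF j] coord_natural[OF D J(1)[OF j] \<pi>[OF j]] compose_eq \<pi>y[OF j])+
  have comp: "compatible D t z1 z2"
  proof -
    have "compatible (alg j) (\<pi> j t) (on_hom Z D (alg j) (\<pi> j) z1) (on_hom Z D (alg j) (\<pi> j) z2)" if "j \<in> J" for j
      using J(5)[OF that] \<pi>t[OF that] \<pi>z[OF that] by simp
    note push = compatible_push[OF D J(1) \<pi> t z(1,3), THEN iffD1, OF _ _ this]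
    show ?thesis
      unfolding compatible_def
    proof (intro ballI allI conjI)
      fix x n assume x: "x \<in> carrier A"
      note g = finsuppD(1)[OF glue_finsupp[OF D z(1,3) x], of n]
      show "coord D z1 (pr n x) = hyp_pow D \<one>\<^bsub>D\<^esub> t n \<otimes>\<^bsub>D\<^esub> glue D z1 z2 x n"
        proof (rule joint)
        show "coord D z1 (pr n x) \<in> carrier D"
          by (rule finsuppD(1)[OF coord_pr_finsupp[OF D z(1) x]])
        show "hyp_pow D \<one>\<^bsub>D\<^esub> t n \<otimes>\<^bsub>D\<^esub> glue D z1 z2 x n \<in> carrier D"
          using t g by (intro Dr.m_closed Dr.hyp_pow_closed Dr.one_closed)
        show "\<pi> j (coord D z1 (pr n x)) = \<pi> j (hyp_pow D \<one>\<^bsub>D\<^esub> t n \<otimes>\<^bsub>D\<^esub> glue D z1 z2 x n)"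
          if "j \<in> J" for j
          using push[OF that that that] x by blast
      qed
      show "coord D z2 (pr n x) = hyp_pow D t \<one>\<^bsub>D\<^esub> n \<otimes>\<^bsub>D\<^esub> glue D z1 z2 x n"
        proof (rule joint)
        show "coord D z2 (pr n x) \<in> carrier D"
          by (rule finsuppD(1)[OF coord_pr_finsupp[OF D z(3) x]])
        show "hyp_pow D t \<one>\<^bsub>D\<^esub> n \<otimes>\<^bsub>D\<^esub> glue D z1 z2 x n \<in> carrier D"
          using t g by (intro Dr.m_closed Dr.hyp_pow_closed Dr.one_closed)
        show "\<pi> j (coord D z2 (pr n x)) = \<pi> j (hyp_pow D t \<one>\<^bsub>D\<^esub> n \<otimes>\<^bsub>D\<^esub> glue D z1 z2 x n)"
          if "j \<in> J" for j
          using push[OF that that that] x by blast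
      qed
    qed
  qed
  have univ: "\<exists>!h. h \<in> khom k D T \<and> h t = s \<and> on_hom Z D T h z1 = w1 \<and> on_hom Z D T h z2 = w2"
    if T: "T \<in> kalgs k" "s \<in> carrier T" "w1 \<in> points Z T" "w2 \<in> points Z T" "compatible T s w1 w2"
    for T s w1 w2
  proof -
    define j where "j = (T, s, w1, w2)"
    have j: "j \<in> J" using T by (simp add: J_def j_def)
    have "\<pi> j \<in> khom k D T \<and> \<pi> j t = s \<and> on_hom Z D T (\<pi> j) z1 = w1 \<and> on_hom Z D T (\<pi> j) z2 = w2"
      using \<pi>[OF j] \<pi>t[OF j] \<pi>z[OF j] by (simp add: j_def alg_def)
    moreover have "h = h'"
      if h: "h \<in> khom k D T" "h t = s" "on_hom Z D T h z1 = w1" "on_hom Z D T h z2 = w2"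
        and h': "h' \<in> khom k D T" "h' t = s" "on_hom Z D T h' z1 = w1" "on_hom Z D T h' z2 = w2" for h h'
    proof (rule khom_eq_on_generators[OF D T(1) h(1) h'(1) gen])
      have "compose (carrier A) h y1 = compose (carrier A) h' y1" "compose (carrier A) h y2 = compose (carrier A) h' y2"
        using coord_natural[OF D T(1) h(1) z(1)] coord_natural[OF D T(1) h'(1) z(1)]
          coord_natural[OF D T(1) h(1) z(3)] coord_natural[OF D T(1) h'(1) z(3)] h h' z by simp_all
      note fun_cong[OF this(1)] fun_cong[OF this(2)]
      then have "h (y1 x) = h' (y1 x)" "h (y2 x) = h' (y2 x)" if "x \<in> carrier A" for x
        using that by (metis compose_eq)+
      then have "h (e (Y1 x)) = h' (e (Y1 x))" "h (e (Y2 x)) = h' (e (Y2 x))" if "x \<in> carrier A" for x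
        using that by (simp_all add: y1_def y2_def)
      then show "h d = h' d" if "d \<in> e ` G'" for d
        using that G(2) h(2) h'(2) by (auto simp: G'_def t_def)
    qed
    ultimately show ?thesis by blast
  qed
  have "finite (e ` G')" "e ` G' \<subseteq> carrier D"
    using \<open>finite G'\<close> e_closed by (auto simp: S_def intro: generate_ring.incl)
  then have "finitely_generated_algebra k D"
    unfolding finitely_generated_algebra_def using gen by blast
  then show ?thesis
    using that[OF D _ t z(1,3) comp univ] by blast
qed

text \<open>
  By \<open>ptilde_bij\<close> the universal compatible triple is the image of a point \<open>q0\<close> of \<open>Ztilde\<close>, and the
  morphism \<open>Spec D \<rightarrow> Ztilde\<close> that \<open>q0\<close> defines is bijective on points.
\<close>

lemma affine_Ztilde:
  assumes fg: "finitely_generated_algebra k A"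
  shows "affine_scheme_of_finite_type k (Ztilde k Z a)"
proof -
  obtain D t z1 z2 where D: "D \<in> kalgs k" and Dfg: "finitely_generated_algebra k D"
    and tz: "t \<in> carrier D" "z1 \<in> points Z D" "z2 \<in> points Z D" "compatible D t z1 z2"
    and univ: "\<And>T s w1 w2. T \<in> kalgs k \<Longrightarrow> s \<in> carrier T \<Longrightarrow> w1 \<in> points Z T \<Longrightarrow> w2 \<in> points Z T \<Longrightarrow>
      compatible T s w1 w2 \<Longrightarrow>
      \<exists>!h. h \<in> khom k D T \<and> h t = s \<and> on_hom Z D T h z1 = w1 \<and> on_hom Z D T h z2 = w2"
    using universal_compatible_triple[OF fg] by blast
  have "(t, z1, z2) \<in> ptilde k Z a D ` points (Ztilde k Z a) D"
    using bij_betw_imp_surj_on[OF ptilde_bij[OF D]] tz by simp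
  then obtain q0 where q0: "q0 \<in> points (Ztilde k Z a) D" "ptilde k Z a D q0 = (t, z1, z2)" by auto
  note Zt = kfunctor_Ztilde[of k Z a]
  have pt: "ptilde k Z a T (on_hom (Ztilde k Z a) D T h q0) = (h t, on_hom Z D T h z1, on_hom Z D T h z2)"
    if "T \<in> kalgs k" "h \<in> khom k D T" for T h
    using ptilde_natural[OF D that q0(1)] q0(2) by (simp add: A1ZZ_simps)
  have "kiso k (Spec k D) (Ztilde k Z a) (point_map k (Ztilde k Z a) D q0)"
    unfolding kiso_def
  proof (intro conjI ballI)
    show "point_map k (Ztilde k Z a) D q0 \<in> kmaps k (Spec k D) (Ztilde k Z a)"
      by (rule point_map_kmaps[OF Zt D q0(1)])
    fix T assume T: "T \<in> kalgs k"
    note bij = ptilde_bij[OF T]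
    have "\<exists>!h. h \<in> khom k D T \<and> on_hom (Ztilde k Z a) D T h q0 = q" if q: "q \<in> points (Ztilde k Z a) T" for q
    proof -
      obtain s w1 w2 where w: "ptilde k Z a T q = (s, w1, w2)" by (metis surj_pair)
      then have "s \<in> carrier T" "w1 \<in> points Z T" "w2 \<in> points Z T" "compatible T s w1 w2"
        using bij_betwE[OF bij] q by auto
      note u = univ[OF T this]
      have "on_hom (Ztilde k Z a) D T h q0 = q \<longleftrightarrow> h t = s \<and> on_hom Z D T h z1 = w1 \<and> on_hom Z D T h z2 = w2"
        if "h \<in> khom k D T" for h
        using inj_on_eq_iff[OF bij_betw_imp_inj_on[OF bij] kfunctor_closed[OF Zt D T that q0(1)] q]
          pt[OF T that] w by simp
      then show ?thesis using u by (metis (no_types, lifting))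
    qed
    note ex1 = this
    have ev: "point_map k (Ztilde k Z a) D q0 T h = on_hom (Ztilde k Z a) D T h q0" if "h \<in> khom k D T" for h
      using T that by (simp add: point_map_def)
    have "bij_betw (point_map k (Ztilde k Z a) D q0 T) (khom k D T) (points (Ztilde k Z a) T)"
    proof (rule bij_betwI')
      fix h h' assume h: "h \<in> khom k D T" "h' \<in> khom k D T"
      show "point_map k (Ztilde k Z a) D q0 T h = point_map k (Ztilde k Z a) D q0 T h' \<longleftrightarrow> h = h'"
        using ex1[OF kfunctor_closed[OF Zt D T h(1) q0(1)]] h ev by metis
    next
      fix h assume "h \<in> khom k D T"
      then show "point_map k (Ztilde k Z a) D q0 T h \<in> points (Ztilde k Z a) T"
        using kfunctor_closed[OF Zt D T _ q0(1)] ev by simp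
    next
      fix q assume "q \<in> points (Ztilde k Z a) T"
      then show "\<exists>h\<in>khom k D T. q = point_map k (Ztilde k Z a) D q0 T h" using ex1 ev by metis
    qed
    then show "bij_betw (point_map k (Ztilde k Z a) D q0 T) (points (Spec k D) T) (points (Ztilde k Z a) T)"
      by (simp add: Spec_def)
  qed
  then show ?thesis
    unfolding affine_scheme_of_finite_type_def using Zt D Dfg by blast
qed

end

theorem proposition2p3p3:
  fixes k :: "'u ring"
    and Z :: "('u, 'z) func"
    and a :: "'u alg \<Rightarrow> 'u \<times> 'z \<Rightarrow> 'z"
  assumes "infinite (UNIV :: 'u set)"
    and "field k"
    and "affine_scheme_of_finite_type k Z"
    and "Gm_action k Z a"
  shows "closed_embedding k (Ztilde k Z a) (A1 \<times>\<^sub>k Z \<times>\<^sub>k Z) (ptilde k Z a)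
       \<and> affine_scheme_of_finite_type k (Ztilde k Z a)"
proof -
  obtain A \<zeta> where A: "A \<in> kalgs k" "kiso k (Spec k A) Z \<zeta>" and fg: "finitely_generated_algebra k A"
    and Z: "kfunctor k Z"
    using assms(3) by (auto simp: affine_scheme_of_finite_type_def)
  interpret affine_Gm_scheme k Z a A \<zeta>
    using assms(1,4) A Z by unfold_locales
  show ?thesis using closed_embedding_ptilde affine_Ztilde[OF fg] by blast
qed

end
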